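(* Let $q\in(0,1)$, let $n\ge 1$, $m\ge 2$ be integers, $N=n+m$, and let $\lambda\in\mathbb{R}$. The sesquilinear form $$(f_1,f_2)=\int f_2^*f_1\,db_q,\qquad f_1,f_2\in\mathscr{E}_{i\lambda}(\Xi_{n,m})_q,$$ is $U_q\mathfrak{su}_{n,m}$-invariant (i.e. $(af_1,f_2)=(f_1,a^*f_2)$ for all $a\in U_q\mathfrak{su}_{n,m}$) and positive definite.
   Context: Notation: $\mathbb{Z}_+=\{0,1,2,\dots\}$, $\mathbb{N}=\{1,2,\dots\}$; algebras are over $\mathbb{C}$; in $\mathscr{E}_{i\lambda}$, $i=\sqrt{-1}$. **Algebras.** $\mathrm{Pol}(\widetilde{\Xi}_{n,m})_q$ is the unital $*$-algebra with generators $t_1,\dots,t_N$ and relations $t_it_j=qt_jt_i$ for $i<j$; $t_it_j^*=qt_j^*t_i$ for $i\ne j$; $t_it_i^*=t_i^*t_i+(q^{-2}-1)\sum_{k=i+1}^N t_kt_k^*$ for $i>n$; $t_it_i^*=t_i^*t_i+(q^{-2}-1)\sum_{k=i+1}^n t_kt_k^*-(q^{-2}-1)\sum_{k=n+1}^N t_kt_k^*$ for $i\le n$; and $-\sum_{j=1}^n t_jt_j^*+\sum_{j=n+1}^N t_jt_j^*=0$. Put $\xi_j=\sum_{k=j}^N t_kt_k^*$ for $j>n$ and $\xi_j=-\sum_{k=j}^n t_kt_k^*+\sum_{k=n+1}^N t_kt_k^*$ for $j\le n$. Then $\xi_1=0$, the $\xi_k$ commute pairwise, $t_j\xi_k=q^2\xi_kt_j$,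 $t_j^*\xi_k=q^{-2}\xi_kt_j^*$ for $j<k$, and $t_j,t_j^*$ commute with $\xi_k$ for $j\ge k$. Consider finite sums $$f=\sum_{I,J} t_1^{i_1}\cdots t_n^{i_n}t_{n+1}^{*i_{n+1}}\cdots t_N^{*i_N}\,f_{IJ}(\xi_2,\dots,\xi_N)\,t_N^{j_N}\cdots t_{n+1}^{j_{n+1}}t_n^{*j_n}\cdots t_1^{*j_1}\qquad(\dagger)$$ over $I,J\in\mathbb{Z}_+^N$ with $i_kj_k=0$ for all $k$ and $i_1+\dots+i_n+j_{n+1}+\dots+j_N=j_1+\dots+j_n+i_{n+1}+\dots+i_N$, where each $f_{IJ}$ is a finite linear combination of terms $\xi_2^{k_2}\cdots\xi_n^{k_n}\,g(\xi_{n+1})\,\xi_{n+2}^{k_{n+2}}\cdots\xi_N^{k_N}$, $k_i\in\mathbb{Z}_+$, with $g$ a function on $q^{2\mathbb{Z}}$. If the $g$ are finitely supported one gets the $*$-algebra $\mathscr{D}(\Xi_{n,m})_q$. If the $g$ are complex powers $\xi_{n+1}^\kappa$, $\kappa\in\mathbb{C}$ (the function $q^{2l}\mapsto q^{2l\kappa}$), one gets the $*$-algebra $\mathscr{E}(\Xi_{n,m})_q$. Multiplication and involution are determined by those of $\mathrm{Pol}(\widetilde{\Xi}_{n,m})_q$, by pointwise multiplication and complex conjugation of functions of $\xi_{n+1}$ on $q^{2\mathbb{Z}}$ ($\xi_{n+1}$ itself being the coordinate function), and by $t_jg(\xi_{n+1})=g(q^2\xi_{n+1})t_j$, $t_j^*g(\xi_{n+1})=g(q^{-2}\xi_{n+1})t_j^*$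 for $j\le n$, while $g(\xi_{n+1})$ commutes with $t_j,t_j^*$ for $j>n$ and with all $\xi_k$. By the same rules $\mathscr{D}(\Xi_{n,m})_q$ is an $\mathscr{E}(\Xi_{n,m})_q$-bimodule. Let $\gamma$ be the automorphism of $\mathscr{E}(\Xi_{n,m})_q$ induced by $t_j\mapsto qt_j$, $t_j^*\mapsto qt_j^*$ (so $\gamma(\xi_{n+1}^\kappa)=q^{2\kappa}\xi_{n+1}^\kappa$). For $s\in\mathbb{C}$ put $\mathscr{E}_s(\Xi_{n,m})_q=\{f\in\mathscr{E}(\Xi_{n,m})_q:\gamma(f)=q^{s-N+1}f\}$. If $f_1,f_2\in\mathscr{E}_{i\lambda}(\Xi_{n,m})_q$ then $f_2^*f_1\in\mathscr{E}_{-N+1}(\Xi_{n,m})_q$. **Integral.** $\mathscr{H}_0$ is the pre-Hilbert space spanned by an orthonormal basis $\{e(i_1,\dots,i_{N-1}): i_1\in\mathbb{Z};\ i_2,\dots,i_n\in-\mathbb{Z}_+;\ i_{n+1},\dots,i_{N-1}\in\mathbb{N}\}$. With $e=e(i_1,\dots,i_{N-1})$, $S_j=\sum_{k=1}^{j-1}i_k$: $T_0(t_1)e=q^{i_1-1}e(i_1-1,i_2,\dots)$, $T_0(t_1^* )e=q^{i_1}e(i_1+1,i_2,\dots)$; for $1<j\le n$: $T_0(t_j)e=q^{S_j}(q^{2(i_j-1)}-1)^{1/2}e(\dots,i_j-1,\dots)$, $T_0(t_j^* )e=q^{S_j}(q^{2i_j}-1)^{1/2}e(\dots,i_j+1,\dots)$;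 for $n<j<N$: $T_0(t_j)e=q^{S_j}(1-q^{2(i_j-1)})^{1/2}e(\dots,i_j-1,\dots)$, $T_0(t_j^* )e=q^{S_j}(1-q^{2i_j})^{1/2}e(\dots,i_j+1,\dots)$; $T_0(t_N)e=T_0(t_N^* )e=q^{S_N}e$; $T_0(g(\xi_{n+1}))e=g(q^{2(i_1+\dots+i_n)})e$. $Q_0e=\mathrm{const}\cdot q^{2\sum_{j=1}^{N-1}(N-j)i_j}e$ with a fixed const $>0$, and $\int_{\Xi_{n,m}}f\,d\nu_q^0=\nu_q^0(f)=\operatorname{Tr}(T_0(f)Q_0)$ for $f\in\mathscr{D}(\Xi_{n,m})_q$ (absolutely convergent sum of diagonal matrix elements). For $l\in\mathbb{Z}$ let $\chi_l\in\mathscr{D}(\Xi_{n,m})_q$ be the function of $\xi_{n+1}$ with $\chi_l(q^{2k})=\delta_{kl}$. For $f\in\mathscr{E}_{-N+1}(\Xi_{n,m})_q$, $\int f\,db_q=b_q(f)=\int_{\Xi_{n,m}}f\chi_l\,d\nu_q^0$, which does not depend on $l\in\mathbb{Z}$. **Quantum group.** $U_q\mathfrak{su}_{n,m}$ is the Hopf $*$-algebra $U_q\mathfrak{sl}_N$ with standard Drinfeld–Jimbo generators $E_j,F_j,K_j^{\pm1}$, $1\le j\le N-1$ ($K_iE_j=q^{a_{ij}}E_jK_i$, $K_iF_j=q^{-a_{ij}}F_jK_i$ with $(a_{ij})$ the Cartan matrix, $[E_i,F_j]=\delta_{ij}(K_i-K_i^{-1})/(q-q^{-1})$, $q$-Serre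 relations), $\Delta E_j=E_j\otimes1+K_j\otimes E_j$, $\Delta F_j=F_j\otimes K_j^{-1}+1\otimes F_j$, $\Delta K_j=K_j\otimes K_j$, $\varepsilon(E_j)=\varepsilon(F_j)=0$, $\varepsilon(K_j)=1$, $S(E_j)=-K_j^{-1}E_j$, $S(F_j)=-F_jK_j$, $S(K_j)=K_j^{-1}$, and involution $K_j^*=K_j$, $E_j^*=K_jF_j$, $F_j^*=E_jK_j^{-1}$ for $j\ne n$, $E_n^*=-K_nF_n$, $F_n^*=-E_nK_n^{-1}$. **Action.** $\mathscr{E}(\Xi_{n,m})_q$ and $\mathscr{D}(\Xi_{n,m})_q$ are $U_q\mathfrak{su}_{n,m}$-module algebras, each $\mathscr{E}_s(\Xi_{n,m})_q$ being a submodule; the action is determined by $a(fg)=\sum(a_{(1)}f)(a_{(2)}g)$ and (unlisted values of $E_j,F_j$ are $0$): $E_jt_{j+1}=q^{-1/2}t_j$; $F_jt_j=q^{1/2}t_{j+1}$; $K_jt_j=qt_j$, $K_jt_{j+1}=q^{-1}t_{j+1}$, $K_jt_i=t_i$ otherwise; $E_jt_j^*=-q^{-3/2}t_{j+1}^*$ for $j\ne n$, $E_nt_n^*=q^{-3/2}t_{n+1}^*$; $F_jt_{j+1}^*=-q^{3/2}t_j^*$ for $j\ne n$, $F_nt_{n+1}^*=q^{3/2}t_n^*$; $K_jt_j^*=q^{-1}t_j^*$, $K_jt_{j+1}^*=qt_{j+1}^*$, $K_jt_i^*=t_i^*$ otherwise; for a function $g$ of $\xi=\xi_{n+1}$: $E_ng(\xi)=q^{-1/2}t_n\frac{g(q^{-2}\xi)-g(\xi)}{q^{-2}\xi-\xi}t_{n+1}^*$,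 $F_ng(\xi)=q^{3/2}t_{n+1}\frac{g(q^{-2}\xi)-g(\xi)}{q^{-2}\xi-\xi}t_n^*$, $K_ng(\xi)=g(\xi)$, and $E_jg(\xi)=F_jg(\xi)=(K_j-1)g(\xi)=0$ for $j\ne n$. *)

theory Defs
  imports "HOL-Analysis.Analysis" "HOL-Library.Poly_Mapping" "HOL-Library.Product_Plus"
    "HOL-Algebra.QuotRing"
begin

section \<open>Complex algebras given by generators and relations\<close>

text \<open>The free monoid, written additively because the product of finitely supported functions
  (\<open>poly_mapping\<close>) is the convolution over an additive monoid.\<close>

datatype 'g fmon = Word (letters: "'g list")

instantiation fmon :: (type) monoid_add
begin
definition zero_fmon :: "'a fmon" where "zero_fmon = Word []"
definition plus_fmon :: "'a fmon \<Rightarrow> 'a fmon \<Rightarrow> 'a fmon"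
  where "plus_fmon u v = Word (letters u @ letters v)"
instance by standard (simp_all add: zero_fmon_def plus_fmon_def)
end

type_synonym 'g fa = "'g fmon \<Rightarrow>\<^sub>0 complex"

definition gen :: "'g \<Rightarrow> 'g fa"
  where "gen x = Poly_Mapping.single (Word [x]) 1"

definition scal :: "complex \<Rightarrow> ('w::monoid_add \<Rightarrow>\<^sub>0 complex)"
  where "scal c = Poly_Mapping.single 0 c"

text \<open>The extensions of a map on generators to an algebra homomorphism, respectively to an
  antilinear antihomomorphism.\<close>

definition lift_hom :: "('g \<Rightarrow> ('w::monoid_add \<Rightarrow>\<^sub>0 complex)) \<Rightarrow> 'g fa \<Rightarrow> ('w \<Rightarrow>\<^sub>0 complex)" where
  "lift_hom \<phi> f =
     (\<Sum>w\<in>Poly_Mapping.keys f. scal (Poly_Mapping.lookup f w) * prod_list (map \<phi> (letters w)))"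

definition lift_star :: "('g \<Rightarrow> 'g fa) \<Rightarrow> 'g fa \<Rightarrow> 'g fa" where
  "lift_star \<phi> f =
     (\<Sum>w\<in>Poly_Mapping.keys f.
        scal (cnj (Poly_Mapping.lookup f w)) * prod_list (map \<phi> (rev (letters w))))"

definition free_alg :: "'g set \<Rightarrow> 'g fa ring" where
  "free_alg G = \<lparr>carrier = {f. \<forall>w\<in>Poly_Mapping.keys f. set (letters w) \<subseteq> G},
     mult = (*), one = 1, zero = 0, add = (+)\<rparr>"

text \<open>Relations are given as elements to be set to \<open>0\<close>. The elements of the presented algebra
  are cosets; a two-sided ring ideal is automatically a complex subspace, since the free algebra
  contains the scalars.\<close>

definition presented :: "'g set \<Rightarrow> 'g fa set \<Rightarrow> 'g fa set ring" where
  "presented G R = free_alg G Quot (Idl\<^bsub>free_alg G\<^esub> R)"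

definition cls :: "'g set \<Rightarrow> 'g fa set \<Rightarrow> 'g fa \<Rightarrow> 'g fa set" where
  "cls G R f = (Idl\<^bsub>free_alg G\<^esub> R) +>\<^bsub>free_alg G\<^esub> f"

text \<open>The map of a presented algebra into itself induced by a map \<open>h\<close> of the free algebra that is
  compatible with the relations.\<close>

definition cls_map :: "'g set \<Rightarrow> 'g fa set \<Rightarrow> ('g fa \<Rightarrow> 'g fa) \<Rightarrow> 'g fa set \<Rightarrow> 'g fa set" where
  "cls_map G R h A = the_elem ((\<lambda>f. cls G R (h f)) ` A)"


section \<open>Functions on the quantum cone\<close>

text \<open>\<open>Tg j\<close>, \<open>Ts j\<close> stand for $t_j$, $t_j^*$; a function $g$ on $q^{2\mathbb{Z}}$ is encoded
  as \<open>\<lambda>l. g (q^(2l))\<close>, and \<open>Fn g\<close> stands for $g(\xi_{n+1})$.\<close>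

datatype cgen = Tg nat | Ts nat | Fn "int \<Rightarrow> complex"

abbreviation tt :: "nat \<Rightarrow> cgen fa" where "tt j \<equiv> gen (Tg j)"
abbreviation ts :: "nat \<Rightarrow> cgen fa" where "ts j \<equiv> gen (Ts j)"
abbreviation fn :: "(int \<Rightarrow> complex) \<Rightarrow> cgen fa" where "fn g \<equiv> gen (Fn g)"

definition cone_gens :: "nat \<Rightarrow> nat \<Rightarrow> cgen set" where
  "cone_gens n m = Tg ` {1..n+m} \<union> Ts ` {1..n+m} \<union> range Fn"

fun cgen_star :: "cgen \<Rightarrow> cgen fa" where
  "cgen_star (Tg j) = ts j"
| "cgen_star (Ts j) = tt j"
| "cgen_star (Fn g) = fn (\<lambda>l. cnj (g l))"

definition pol_rels :: "real \<Rightarrow> nat \<Rightarrow> nat \<Rightarrow> cgen fa set" where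
  "pol_rels q n m =
     {tt i * tt j - scal (of_real q) * tt j * tt i | i j. 1 \<le> i \<and> i < j \<and> j \<le> n + m}
   \<union> {tt i * ts j - scal (of_real q) * ts j * tt i | i j.
        i \<in> {1..n+m} \<and> j \<in> {1..n+m} \<and> i \<noteq> j}
   \<union> {tt i * ts i - (ts i * tt i
        + scal (of_real (q powi (-2) - 1)) * (\<Sum>k\<in>{i+1..n+m}. tt k * ts k)) | i.
        n < i \<and> i \<le> n + m}
   \<union> {tt i * ts i - (ts i * tt i
        + scal (of_real (q powi (-2) - 1)) * (\<Sum>k\<in>{i+1..n}. tt k * ts k)
        - scal (of_real (q powi (-2) - 1)) * (\<Sum>k\<in>{n+1..n+m}. tt k * ts k)) | i.
        1 \<le> i \<and> i \<le> n}
   \<union> {- (\<Sum>j\<in>{1..n}. tt j * ts j) + (\<Sum>j\<in>{n+1..n+m}. tt j * ts j)}"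

definition cone_xi :: "nat \<Rightarrow> nat \<Rightarrow> nat \<Rightarrow> cgen fa" where
  "cone_xi n m j = (if n < j then (\<Sum>k\<in>{j..n+m}. tt k * ts k)
     else - (\<Sum>k\<in>{j..n}. tt k * ts k) + (\<Sum>k\<in>{n+1..n+m}. tt k * ts k))"

text \<open>Relations involving functions of $\xi_{n+1}$. Replacing $\xi_{n+1}$ by
  $q^{\pm 2}\xi_{n+1}$ shifts the encoding by \<open>\<plusminus> 1\<close>. Commutation of $g(\xi_{n+1})$ with the
  $\xi_k$ follows, each $\xi_k$ being a combination of the $t_jt_j^*$.\<close>

definition fun_rels :: "real \<Rightarrow> nat \<Rightarrow> nat \<Rightarrow> cgen fa set" where
  "fun_rels q n m =
     {fn (\<lambda>l. g l + h l) - (fn g + fn h) | g h. True}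
   \<union> {fn (\<lambda>l. c * g l) - scal c * fn g | c g. True}
   \<union> {fn (\<lambda>l. g l * h l) - fn g * fn h | g h. True}
   \<union> {fn (\<lambda>l. 1) - 1}
   \<union> {fn (\<lambda>l. of_real (q powi (2 * l))) - cone_xi n m (n + 1)}
   \<union> {tt j * fn g - fn (\<lambda>l. g (l + 1)) * tt j | j g. 1 \<le> j \<and> j \<le> n}
   \<union> {ts j * fn g - fn (\<lambda>l. g (l - 1)) * ts j | j g. 1 \<le> j \<and> j \<le> n}
   \<union> {tt j * fn g - fn g * tt j | j g. n < j \<and> j \<le> n + m}
   \<union> {ts j * fn g - fn g * ts j | j g. n < j \<and> j \<le> n + m}"

text \<open>The presentations are presentations of $*$-algebras, so the adjoint relations are included.
  The algebra generated by the $t_j$, $t_j^*$ and all functions of $\xi_{n+1}$ is the common ambient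
  algebra of $\mathscr{D}(\Xi_{n,m})_q$ and $\mathscr{E}(\Xi_{n,m})_q$; in particular it provides
  the products of elements of $\mathscr{E}(\Xi_{n,m})_q$ with the $\chi_l$.\<close>

definition cone_rels :: "real \<Rightarrow> nat \<Rightarrow> nat \<Rightarrow> cgen fa set" where
  "cone_rels q n m = (let R = pol_rels q n m \<union> fun_rels q n m in R \<union> lift_star cgen_star ` R)"

definition cone_alg :: "real \<Rightarrow> nat \<Rightarrow> nat \<Rightarrow> cgen fa set ring" where
  "cone_alg q n m = presented (cone_gens n m) (cone_rels q n m)"

definition cone_cls :: "real \<Rightarrow> nat \<Rightarrow> nat \<Rightarrow> cgen fa \<Rightarrow> cgen fa set" where
  "cone_cls q n m = cls (cone_gens n m) (cone_rels q n m)"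

definition cone_scale :: "real \<Rightarrow> nat \<Rightarrow> nat \<Rightarrow> complex \<Rightarrow> cgen fa set \<Rightarrow> cgen fa set" where
  "cone_scale q n m c A = cone_cls q n m (scal c) \<otimes>\<^bsub>cone_alg q n m\<^esub> A"

definition cone_star :: "real \<Rightarrow> nat \<Rightarrow> nat \<Rightarrow> cgen fa set \<Rightarrow> cgen fa set" where
  "cone_star q n m = cls_map (cone_gens n m) (cone_rels q n m) (lift_star cgen_star)"

text \<open>On powers of $\xi_{n+1}$ the automorphism \<open>\<gamma>\<close> is $\xi_{n+1}^\kappa \mapsto
  q^{2\kappa}\xi_{n+1}^\kappa$, that is $g(\xi_{n+1}) \mapsto g(q^2\xi_{n+1})$.\<close>

fun cgen_gamma :: "real \<Rightarrow> cgen \<Rightarrow> cgen fa" where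
  "cgen_gamma q (Tg j) = scal (of_real q) * tt j"
| "cgen_gamma q (Ts j) = scal (of_real q) * ts j"
| "cgen_gamma q (Fn g) = fn (\<lambda>l. g (l + 1))"

definition cone_gamma :: "real \<Rightarrow> nat \<Rightarrow> nat \<Rightarrow> cgen fa set \<Rightarrow> cgen fa set" where
  "cone_gamma q n m = cls_map (cone_gens n m) (cone_rels q n m) (lift_hom (cgen_gamma q))"

definition cone_monom ::
  "nat \<Rightarrow> nat \<Rightarrow> (nat \<Rightarrow> nat) \<Rightarrow> (nat \<Rightarrow> nat) \<Rightarrow> (nat \<Rightarrow> nat) \<Rightarrow> (int \<Rightarrow> complex) \<Rightarrow> cgen fa" where
  "cone_monom n m I J k g =
     prod_list (map (\<lambda>a. tt a ^ I a) [1..<n+1]) *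
     prod_list (map (\<lambda>a. ts a ^ I a) [n+1..<n+m+1]) *
     (prod_list (map (\<lambda>a. cone_xi n m a ^ k a) [2..<n+1]) * fn g *
      prod_list (map (\<lambda>a. cone_xi n m a ^ k a) [n+2..<n+m+1])) *
     prod_list (map (\<lambda>a. tt a ^ J a) (rev [n+1..<n+m+1])) *
     prod_list (map (\<lambda>a. ts a ^ J a) (rev [1..<n+1]))"

definition admissible :: "nat \<Rightarrow> nat \<Rightarrow> (nat \<Rightarrow> nat) \<Rightarrow> (nat \<Rightarrow> nat) \<Rightarrow> bool" where
  "admissible n m I J \<longleftrightarrow> (\<forall>a\<in>{1..n+m}. I a * J a = 0) \<and>
     (\<Sum>a\<in>{1..n}. I a) + (\<Sum>a\<in>{n+1..n+m}. J a) = (\<Sum>a\<in>{1..n}. J a) + (\<Sum>a\<in>{n+1..n+m}. I a)"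

definition xi_power :: "real \<Rightarrow> complex \<Rightarrow> int \<Rightarrow> complex" where
  "xi_power q \<kappa> l = of_real q powr (2 * of_int l * \<kappa>)"

definition cone_E :: "real \<Rightarrow> nat \<Rightarrow> nat \<Rightarrow> cgen fa set set" where
  "cone_E q n m = cone_cls q n m `
     Modules.module.span (\<lambda>c f. scal c * f)
       {cone_monom n m I J k (xi_power q \<kappa>) | I J k \<kappa>. admissible n m I J}"

definition cone_Es :: "real \<Rightarrow> nat \<Rightarrow> nat \<Rightarrow> complex \<Rightarrow> cgen fa set set" where
  "cone_Es q n m s = {A \<in> cone_E q n m.
     cone_gamma q n m A = cone_scale q n m (of_real q powr (s - of_nat (n + m) + 1)) A}"


section \<open>The integrals\<close>

text \<open>Basis vectors are indexed by functions that vanish outside \<open>{1..N-1}\<close>.\<close>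

definition basis_idx :: "nat \<Rightarrow> nat \<Rightarrow> (nat \<Rightarrow> int) set" where
  "basis_idx n m = {i. (\<forall>j. j \<notin> {1..n+m-1} \<longrightarrow> i j = 0) \<and>
     (\<forall>j\<in>{2..n}. i j \<le> 0) \<and> (\<forall>j\<in>{n+1..n+m-1}. 1 \<le> i j)}"

type_synonym hvec = "(nat \<Rightarrow> int) \<Rightarrow>\<^sub>0 complex"

definition idx_sum :: "nat \<Rightarrow> (nat \<Rightarrow> int) \<Rightarrow> int" where
  "idx_sum j i = (\<Sum>k\<in>{1..<j}. i k)"

fun T0_basis :: "real \<Rightarrow> nat \<Rightarrow> nat \<Rightarrow> cgen \<Rightarrow> (nat \<Rightarrow> int) \<Rightarrow> hvec" where
  "T0_basis q n m (Tg j) i =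
     (if j = 1 then Poly_Mapping.single (i(1 := i 1 - 1)) (of_real (q powi (i 1 - 1)))
      else if j \<le> n then Poly_Mapping.single (i(j := i j - 1))
        (of_real (q powi (idx_sum j i) * sqrt (q powi (2 * (i j - 1)) - 1)))
      else if j < n + m then Poly_Mapping.single (i(j := i j - 1))
        (of_real (q powi (idx_sum j i) * sqrt (1 - q powi (2 * (i j - 1)))))
      else Poly_Mapping.single i (of_real (q powi (idx_sum j i))))"
| "T0_basis q n m (Ts j) i =
     (if j = 1 then Poly_Mapping.single (i(1 := i 1 + 1)) (of_real (q powi (i 1)))
      else if j \<le> n then Poly_Mapping.single (i(j := i j + 1))
        (of_real (q powi (idx_sum j i) * sqrt (q powi (2 * i j) - 1)))
      else if j < n + m then Poly_Mapping.single (i(j := i j + 1))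
        (of_real (q powi (idx_sum j i) * sqrt (1 - q powi (2 * i j))))
      else Poly_Mapping.single i (of_real (q powi (idx_sum j i))))"
| "T0_basis q n m (Fn g) i = Poly_Mapping.single i (g (idx_sum (n + 1) i))"

definition T0_gen :: "real \<Rightarrow> nat \<Rightarrow> nat \<Rightarrow> cgen \<Rightarrow> hvec \<Rightarrow> hvec" where
  "T0_gen q n m x v = (\<Sum>i\<in>Poly_Mapping.keys v.
     Poly_Mapping.map ((*) (Poly_Mapping.lookup v i)) (T0_basis q n m x i))"

definition T0 :: "real \<Rightarrow> nat \<Rightarrow> nat \<Rightarrow> cgen fa \<Rightarrow> hvec \<Rightarrow> hvec" where
  "T0 q n m f v = (\<Sum>w\<in>Poly_Mapping.keys f.
     Poly_Mapping.map ((*) (Poly_Mapping.lookup f w)) (foldr (T0_gen q n m) (letters w) v))"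

definition Q0_basis :: "real \<Rightarrow> nat \<Rightarrow> nat \<Rightarrow> real \<Rightarrow> (nat \<Rightarrow> int) \<Rightarrow> hvec" where
  "Q0_basis q n m const i = Poly_Mapping.single i
     (of_real (const * q powi (2 * (\<Sum>j\<in>{1..n+m-1}. int (n + m - j) * i j))))"

text \<open>\<open>Tr(T\<^sub>0(f)Q\<^sub>0)\<close>. Only vectors supported on \<open>basis_idx\<close> enter, and on their span the operators
  satisfy the relations; so the value depends on the coset of \<open>f\<close> only.\<close>

definition trace_TQ :: "real \<Rightarrow> nat \<Rightarrow> nat \<Rightarrow> real \<Rightarrow> cgen fa \<Rightarrow> complex" where
  "trace_TQ q n m const f = infsum
     (\<lambda>i. Poly_Mapping.lookup (T0 q n m f (Q0_basis q n m const i)) i) (basis_idx n m)"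

definition nu0 :: "real \<Rightarrow> nat \<Rightarrow> nat \<Rightarrow> real \<Rightarrow> cgen fa set \<Rightarrow> complex" where
  "nu0 q n m const A = the_elem (trace_TQ q n m const ` A)"

definition chi :: "int \<Rightarrow> int \<Rightarrow> complex" where
  "chi l k = (if k = l then 1 else 0)"

text \<open>On $\mathscr{E}_{-N+1}(\Xi_{n,m})_q$ the value does not depend on \<open>l\<close>; it is kept as a
  parameter.\<close>

definition b_int :: "real \<Rightarrow> nat \<Rightarrow> nat \<Rightarrow> real \<Rightarrow> int \<Rightarrow> cgen fa set \<Rightarrow> complex" where
  "b_int q n m const l A = nu0 q n m const (A \<otimes>\<^bsub>cone_alg q n m\<^esub> cone_cls q n m (fn (chi l)))"

definition b_form ::
  "real \<Rightarrow> nat \<Rightarrow> nat \<Rightarrow> real \<Rightarrow> int \<Rightarrow> cgen fa set \<Rightarrow> cgen fa set \<Rightarrow> complex" where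
  "b_form q n m const l f\<^sub>1 f\<^sub>2 =
     b_int q n m const l (cone_star q n m f\<^sub>2 \<otimes>\<^bsub>cone_alg q n m\<^esub> f\<^sub>1)"


section \<open>The quantum group and its action\<close>

text \<open>\<open>Eg j\<close>, \<open>Fg j\<close>, \<open>Kg j\<close>, \<open>Ki j\<close> stand for $E_j$, $F_j$, $K_j$, $K_j^{-1}$.\<close>

datatype ugen = Eg nat | Fg nat | Kg nat | Ki nat

definition uq_gens :: "nat \<Rightarrow> nat \<Rightarrow> ugen set" where
  "uq_gens n m = (\<Union>j\<in>{1..n+m-1}. {Eg j, Fg j, Kg j, Ki j})"

definition cartan :: "nat \<Rightarrow> nat \<Rightarrow> int" where
  "cartan i j = (if i = j then 2 else if i = j + 1 \<or> j = i + 1 then -1 else 0)"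

definition serre :: "real \<Rightarrow> ugen fa \<Rightarrow> ugen fa \<Rightarrow> ugen fa" where
  "serre q x y = x * x * y - scal (of_real (q + inverse q)) * x * y * x + y * x * x"

definition uq_rels :: "real \<Rightarrow> nat \<Rightarrow> nat \<Rightarrow> ugen fa set" where
  "uq_rels q n m = (\<Union>i\<in>{1..n+m-1}. \<Union>j\<in>{1..n+m-1}.
     {gen (Kg i) * gen (Ki i) - 1, gen (Ki i) * gen (Kg i) - 1,
      gen (Kg i) * gen (Kg j) - gen (Kg j) * gen (Kg i),
      gen (Kg i) * gen (Eg j) - scal (of_real (q powi cartan i j)) * gen (Eg j) * gen (Kg i),
      gen (Kg i) * gen (Fg j) - scal (of_real (q powi (- cartan i j))) * gen (Fg j) * gen (Kg i),
      gen (Eg i) * gen (Fg j) - gen (Fg j) * gen (Eg i)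
        - (if i = j then scal (of_real (1 / (q - inverse q))) * (gen (Kg i) - gen (Ki i)) else 0)}
     \<union> (if cartan i j = -1 then
          {serre q (gen (Eg i)) (gen (Eg j)), serre q (gen (Fg i)) (gen (Fg j))}
        else if cartan i j = 0 then
          {gen (Eg i) * gen (Eg j) - gen (Eg j) * gen (Eg i),
           gen (Fg i) * gen (Fg j) - gen (Fg j) * gen (Fg i)}
        else {}))"

definition uq_alg :: "real \<Rightarrow> nat \<Rightarrow> nat \<Rightarrow> ugen fa set ring" where
  "uq_alg q n m = presented (uq_gens n m) (uq_rels q n m)"

definition uq_cls :: "real \<Rightarrow> nat \<Rightarrow> nat \<Rightarrow> ugen fa \<Rightarrow> ugen fa set" where
  "uq_cls q n m = cls (uq_gens n m) (uq_rels q n m)"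

fun ugen_star :: "nat \<Rightarrow> ugen \<Rightarrow> ugen fa" where
  "ugen_star n (Eg j) = (if j = n then - (gen (Kg j) * gen (Fg j)) else gen (Kg j) * gen (Fg j))"
| "ugen_star n (Fg j) = (if j = n then - (gen (Eg j) * gen (Ki j)) else gen (Eg j) * gen (Ki j))"
| "ugen_star n (Kg j) = gen (Kg j)"
| "ugen_star n (Ki j) = gen (Ki j)"

definition uq_star :: "real \<Rightarrow> nat \<Rightarrow> nat \<Rightarrow> ugen fa set \<Rightarrow> ugen fa set" where
  "uq_star q n m = cls_map (uq_gens n m) (uq_rels q n m) (lift_star (ugen_star n))"

text \<open>The tensor square of the free algebra is the monoid algebra of pairs of words. The
  comultiplication and the counit are lifted to the free algebra; they respect \<open>uq_rels\<close>.\<close>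

definition tens :: "'g fa \<Rightarrow> 'g fa \<Rightarrow> ('g fmon \<times> 'g fmon \<Rightarrow>\<^sub>0 complex)" (infix \<open>\<otimes>\<^sub>t\<close> 75) where
  "a \<otimes>\<^sub>t b = (\<Sum>u\<in>Poly_Mapping.keys a. \<Sum>v\<in>Poly_Mapping.keys b.
     Poly_Mapping.single (u, v) (Poly_Mapping.lookup a u * Poly_Mapping.lookup b v))"

fun ugen_comult :: "ugen \<Rightarrow> (ugen fmon \<times> ugen fmon \<Rightarrow>\<^sub>0 complex)" where
  "ugen_comult (Eg j) = gen (Eg j) \<otimes>\<^sub>t 1 + gen (Kg j) \<otimes>\<^sub>t gen (Eg j)"
| "ugen_comult (Fg j) = gen (Fg j) \<otimes>\<^sub>t gen (Ki j) + 1 \<otimes>\<^sub>t gen (Fg j)"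
| "ugen_comult (Kg j) = gen (Kg j) \<otimes>\<^sub>t gen (Kg j)"
| "ugen_comult (Ki j) = gen (Ki j) \<otimes>\<^sub>t gen (Ki j)"

definition uq_comult :: "ugen fa \<Rightarrow> (ugen fmon \<times> ugen fmon \<Rightarrow>\<^sub>0 complex)" where
  "uq_comult = lift_hom ugen_comult"

fun ugen_counit :: "ugen \<Rightarrow> complex" where
  "ugen_counit (Eg j) = 0"
| "ugen_counit (Fg j) = 0"
| "ugen_counit (Kg j) = 1"
| "ugen_counit (Ki j) = 1"

definition uq_counit :: "ugen fa \<Rightarrow> complex" where
  "uq_counit a = (\<Sum>w\<in>Poly_Mapping.keys a.
     Poly_Mapping.lookup a w * prod_list (map ugen_counit (letters w)))"

text \<open>A left module algebra structure over the quantum group on the ambient algebra. In the last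
  clause \<open>\<Delta>(a) = \<Sum> c u \<otimes> v\<close> is expanded in pairs \<open>(u, v)\<close> of words. Complex linearity of each
  operator \<open>act X\<close> follows, scalars being central.\<close>

definition uq_module_algebra ::
  "real \<Rightarrow> nat \<Rightarrow> nat \<Rightarrow> (ugen fa set \<Rightarrow> cgen fa set \<Rightarrow> cgen fa set) \<Rightarrow> bool" where
  "uq_module_algebra q n m act \<longleftrightarrow> (let U = uq_alg q n m; C = cone_alg q n m in
     (\<forall>X\<in>carrier U. \<forall>A\<in>carrier C. act X A \<in> carrier C) \<and>
     (\<forall>X\<in>carrier U. \<forall>A\<in>carrier C. \<forall>B\<in>carrier C.
        act X (A \<oplus>\<^bsub>C\<^esub> B) = act X A \<oplus>\<^bsub>C\<^esub> act X B) \<and>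
     (\<forall>X\<in>carrier U. \<forall>Y\<in>carrier U. \<forall>A\<in>carrier C.
        act (X \<oplus>\<^bsub>U\<^esub> Y) A = act X A \<oplus>\<^bsub>C\<^esub> act Y A) \<and>
     (\<forall>X\<in>carrier U. \<forall>Y\<in>carrier U. \<forall>A\<in>carrier C.
        act (X \<otimes>\<^bsub>U\<^esub> Y) A = act X (act Y A)) \<and>
     (\<forall>c. \<forall>A\<in>carrier C. act (uq_cls q n m (scal c)) A = cone_scale q n m c A) \<and>
     (\<forall>a\<in>carrier (free_alg (uq_gens n m)).
        act (uq_cls q n m a) \<one>\<^bsub>C\<^esub> = cone_scale q n m (uq_counit a) \<one>\<^bsub>C\<^esub>) \<and>
     (\<forall>a\<in>carrier (free_alg (uq_gens n m)). \<forall>A\<in>carrier C. \<forall>B\<in>carrier C.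
        act (uq_cls q n m a) (A \<otimes>\<^bsub>C\<^esub> B) =
          finsum C (\<lambda>(u, v). cone_scale q n m (Poly_Mapping.lookup (uq_comult a) (u, v))
              (act (uq_cls q n m (Poly_Mapping.single u 1)) A \<otimes>\<^bsub>C\<^esub>
               act (uq_cls q n m (Poly_Mapping.single v 1)) B))
            (Poly_Mapping.keys (uq_comult a))))"

text \<open>The exponent in $K_j x = q^{w} x$.\<close>

fun weight :: "nat \<Rightarrow> cgen \<Rightarrow> int" where
  "weight j (Tg i) = (if i = j then 1 else if i = j + 1 then -1 else 0)"
| "weight j (Ts i) = (if i = j then -1 else if i = j + 1 then 1 else 0)"
| "weight j (Fn g) = 0"

text \<open>The function $x \mapsto (g(q^{-2}x) - g(x)) / (q^{-2}x - x)$ on $q^{2\mathbb{Z}}$.\<close>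

definition qdiff :: "real \<Rightarrow> (int \<Rightarrow> complex) \<Rightarrow> int \<Rightarrow> complex" where
  "qdiff q g l = (g (l - 1) - g l) / of_real (q powi (2 * (l - 1)) - q powi (2 * l))"

fun action_val :: "real \<Rightarrow> nat \<Rightarrow> ugen \<Rightarrow> cgen \<Rightarrow> cgen fa" where
  "action_val q n (Eg j) (Tg i) =
     (if i = j + 1 then scal (of_real (q powr (-1/2))) * tt j else 0)"
| "action_val q n (Eg j) (Ts i) =
     (if i = j then scal (of_real ((if j = n then 1 else -1) * q powr (-3/2))) * ts (j + 1) else 0)"
| "action_val q n (Eg j) (Fn g) =
     (if j = n then scal (of_real (q powr (-1/2))) * tt n * fn (qdiff q g) * ts (n + 1) else 0)"
| "action_val q n (Fg j) (Tg i) =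
     (if i = j then scal (of_real (q powr (1/2))) * tt (j + 1) else 0)"
| "action_val q n (Fg j) (Ts i) =
     (if i = j + 1 then scal (of_real ((if j = n then 1 else -1) * q powr (3/2))) * ts j else 0)"
| "action_val q n (Fg j) (Fn g) =
     (if j = n then scal (of_real (q powr (3/2))) * tt (n + 1) * fn (qdiff q g) * ts n else 0)"
| "action_val q n (Kg j) x = scal (of_real (q powi (weight j x))) * gen x"
| "action_val q n (Ki j) x = scal (of_real (q powi (- weight j x))) * gen x"

definition uq_action ::
  "real \<Rightarrow> nat \<Rightarrow> nat \<Rightarrow> (ugen fa set \<Rightarrow> cgen fa set \<Rightarrow> cgen fa set) \<Rightarrow> bool" where
  "uq_action q n m act \<longleftrightarrow> uq_module_algebra q n m act \<and>
     (\<forall>u\<in>uq_gens n m. \<forall>x\<in>cone_gens n m.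
        act (uq_cls q n m (gen u)) (cone_cls q n m (gen x)) = cone_cls q n m (action_val q n u x))"


section \<open>Properties of the form\<close>

definition sesquilinear_on ::
  "real \<Rightarrow> nat \<Rightarrow> nat \<Rightarrow> cgen fa set set \<Rightarrow> (cgen fa set \<Rightarrow> cgen fa set \<Rightarrow> complex) \<Rightarrow> bool" where
  "sesquilinear_on q n m V \<Phi> \<longleftrightarrow> (\<forall>f\<in>V. \<forall>g\<in>V. \<forall>h\<in>V. \<forall>c.
     \<Phi> (f \<oplus>\<^bsub>cone_alg q n m\<^esub> g) h = \<Phi> f h + \<Phi> g h \<and>
     \<Phi> h (f \<oplus>\<^bsub>cone_alg q n m\<^esub> g) = \<Phi> h f + \<Phi> h g \<and>
     \<Phi> (cone_scale q n m c f) h = c * \<Phi> f h \<and>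
     \<Phi> h (cone_scale q n m c f) = cnj c * \<Phi> h f)"

definition invariant_on ::
  "real \<Rightarrow> nat \<Rightarrow> nat \<Rightarrow> (ugen fa set \<Rightarrow> cgen fa set \<Rightarrow> cgen fa set) \<Rightarrow> cgen fa set set \<Rightarrow>
   (cgen fa set \<Rightarrow> cgen fa set \<Rightarrow> complex) \<Rightarrow> bool" where
  "invariant_on q n m act V \<Phi> \<longleftrightarrow> (\<forall>a\<in>carrier (uq_alg q n m). \<forall>f\<^sub>1\<in>V. \<forall>f\<^sub>2\<in>V.
     \<Phi> (act a f\<^sub>1) f\<^sub>2 = \<Phi> f\<^sub>1 (act (uq_star q n m a) f\<^sub>2))"

definition pos_def_on ::
  "real \<Rightarrow> nat \<Rightarrow> nat \<Rightarrow> cgen fa set set \<Rightarrow> (cgen fa set \<Rightarrow> cgen fa set \<Rightarrow> complex) \<Rightarrow> bool" where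
  "pos_def_on q n m V \<Phi> \<longleftrightarrow>
     (\<forall>f\<in>V. f \<noteq> \<zero>\<^bsub>cone_alg q n m\<^esub> \<longrightarrow> \<Phi> f f \<in> \<real> \<and> 0 < Re (\<Phi> f f))"

end

theory Submission
  imports Defs
begin

text \<open>The representation $T_0$ is extended to a larger index set, with one more free coordinate moved
  by $t_N$ and $t_N^*$. There $K_j$ is conjugation with a diagonal operator, and $E_j$ and $F_j$ are
  multiples of the commutators, twisted by $K_j^{\pm 1}$, with $y_j = t_jt_{j+1}^*\xi_{j+1}^{-1}$
  and $y_j^*$; both sides are twisted derivations, so it suffices to compare them on the generators.

  On elements of degree zero the form is a weighted sum, over the indices of one level, of products of
  matrix coefficients. Of the two terms of each of $(E_jf_1,f_2)$ and $(f_1,E_j^*f_2)$, one is common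
  to both; the others are exchanged by the index shift of $y_j$. For $j = n$ this shift
  changes the level by one. The level is restored by the shift that implements $\gamma$: as $\lambda$
  is real, the eigenvalue of $\gamma$ on $\mathscr{E}_{i\lambda}$ has modulus $q^{-(N-1)}$, and its
  square compensates the change of the weight.

  The form $(f,f)$ is a weighted sum of squared absolute values of matrix coefficients. If it is zero,
  then so are all coefficients of $f$ on one level, and then on every level since $f$ is an
  eigenvector of $\gamma$. Such an $f$ is zero: terms of different bidegree act by different shifts, and
  along a suitable sequence of indices the monomials in the $\xi_a$ decay at pairwise different
  rates.\<close>

section \<open>Presented algebras\<close>

text \<open>On the original index set t_N acts diagonally although K_(N-1) gives it weight -1, so no
  diagonal operator there can implement K_(N-1); this forces the additional coordinate. For elements
  of degree zero that coordinate is determined by the others, so the trace is not changed by the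
  enlargement. The element y_j is dictated by the fact that t_(j+1)^* t_(j+1) - q^(-2) t_(j+1)
  t_(j+1)^* is a multiple of \<xi>_(j+1): after division, the twisted commutator of y_j with t_(j+1)
  is a multiple of t_j. Since y_j may be unbounded, the terms exchanged by an index shift must first
  be shown to be summable separately. The coefficients of y_j grow at most like q^(-d) in the size d
  of the inner coordinates, while the weight decays like q^(2d). All structure maps are defined on
  cosets through \<open>the_elem\<close>, so each must be shown to respect the relations. For the
  involution of the quantum group this includes the Serre relations.\<close>

lemma single_decomp:
  fixes f :: "'w \<Rightarrow>\<^sub>0 'c::comm_monoid_add"
  shows "f = (\<Sum>w\<in>Poly_Mapping.keys f. Poly_Mapping.single w (Poly_Mapping.lookup f w))"
proof (rule poly_mapping_eqI)
  fix k
  have "(\<Sum>w\<in>Poly_Mapping.keys f. Poly_Mapping.lookup (Poly_Mapping.single w (Poly_Mapping.lookup f w)) k)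
      = (\<Sum>w\<in>Poly_Mapping.keys f. if w = k then Poly_Mapping.lookup f w else 0)"
    by (intro sum.cong) (auto simp: lookup_single when_def)
  also have "\<dots> = Poly_Mapping.lookup f k"
    by (auto simp: sum.delta in_keys_iff)
  finally show "Poly_Mapping.lookup f k =
      Poly_Mapping.lookup (\<Sum>w\<in>Poly_Mapping.keys f. Poly_Mapping.single w (Poly_Mapping.lookup f w)) k"
    by (simp add: lookup_sum)
qed

text \<open>Only words of \<open>f\<close> itself occur, but with arbitrary coefficients. Thus a
  condition on the words of \<open>f\<close>, such as lying over a given set of generators, is
  available in the induction.\<close>

lemma poly_mapping_single_induct:
  fixes f :: "'w \<Rightarrow>\<^sub>0 'c::comm_monoid_add"
  assumes "P 0" "\<And>w c. w \<in> Poly_Mapping.keys f \<Longrightarrow> P (Poly_Mapping.single w c)"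
    and "\<And>g h. P g \<Longrightarrow> P h \<Longrightarrow> P (g + h)"
  shows "P f"
proof -
  have "P (\<Sum>w\<in>A. Poly_Mapping.single w (Poly_Mapping.lookup f w))"
    if "A \<subseteq> Poly_Mapping.keys f" for A
    using finite_subset[OF that finite_keys] that
    by (induction A rule: finite_induct) (auto intro: assms)
  then show ?thesis
    using single_decomp[of f] by force
qed

lemma additive_eqI:
  fixes F G :: "('w \<Rightarrow>\<^sub>0 'c::comm_monoid_add) \<Rightarrow> 'b::monoid_add"
  assumes "F 0 = G 0" "\<And>g h. F (g + h) = F g + F h" "\<And>g h. G (g + h) = G g + G h"
    and "\<And>w c. w \<in> Poly_Mapping.keys f \<Longrightarrow> F (Poly_Mapping.single w c) = G (Poly_Mapping.single w c)"
  shows "F f = G f"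
  by (rule poly_mapping_single_induct[where f=f and P="\<lambda>f. F f = G f"]) (auto simp: assms)

lemma single_mult_zero [simp]: "scal c * Poly_Mapping.single w d = Poly_Mapping.single w (c * d)"
  "Poly_Mapping.single w d * scal c = Poly_Mapping.single w (d * c)"
  by (simp_all add: scal_def mult_single)

lemma scal_central: "scal c * f = f * scal c"
  by (rule additive_eqI[where f=f]) (simp_all add: algebra_simps)

lemma scal_simps [simp]: "scal 0 = 0" "scal 1 = 1" "scal a * scal b = scal (a * b)"
  by (simp_all add: scal_def mult_single)

lemma scal_add: "scal (a + b) = scal a + scal b"
  by (simp add: scal_def single_add)

lemma scal_uminus: "scal (- a) = - scal a"
  by (simp add: scal_def single_uminus)

lemma scal_assoc: "scal a * (scal b * f) = scal (a * b) * f"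
  by (simp flip: mult.assoc)

lemma letters_zero [simp]: "letters 0 = []"
  and letters_plus [simp]: "letters (u + v) = letters u @ letters v"
  by (simp_all add: zero_fmon_def plus_fmon_def)

lemma prod_list_gen: "prod_list (map gen xs) = Poly_Mapping.single (Word xs) (1::complex)"
proof (induction xs)
  case Nil
  then show ?case by (metis list.simps(8) prod_list.Nil single_one zero_fmon_def)
next
  case (Cons x xs)
  then show ?case by (simp add: gen_def mult_single plus_fmon_def)
qed

lemma single_eq_scal_gens: "Poly_Mapping.single w c = scal c * prod_list (map gen (letters w))"
  by (cases w) (simp add: prod_list_gen)

lemma lift_hom_add: "lift_hom \<phi> (f + g) = lift_hom \<phi> f + lift_hom \<phi> g"
  unfolding lift_hom_def
  by (rule setsum_keys_plus_distrib) (simp_all add: scal_add distrib_right)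

lemma lift_hom_single: "lift_hom \<phi> (Poly_Mapping.single w c) = scal c * prod_list (map \<phi> (letters w))"
  by (cases "c = 0") (simp_all add: lift_hom_def)

lemma lift_hom_0 [simp]: "lift_hom \<phi> 0 = 0"
  by (simp add: lift_hom_def)

lemma lift_hom_scal [simp]: "lift_hom \<phi> (scal c) = scal c"
  by (subst (1) scal_def) (simp add: lift_hom_single)

lemma lift_hom_gen [simp]: "lift_hom \<phi> (gen x) = \<phi> x"
  by (simp add: gen_def lift_hom_single)

lemma lift_hom_1 [simp]: "lift_hom \<phi> 1 = 1"
  using lift_hom_scal[of \<phi> 1] by simp

lemma lift_hom_mult:
  fixes \<phi> :: "'g \<Rightarrow> ('w::monoid_add \<Rightarrow>\<^sub>0 complex)"
  shows "lift_hom \<phi> (f * g) = lift_hom \<phi> f * lift_hom \<phi> g"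
proof (rule additive_eqI[where f=f])
  fix u and c :: complex
  show "lift_hom \<phi> (Poly_Mapping.single u c * g) = lift_hom \<phi> (Poly_Mapping.single u c) * lift_hom \<phi> g"
  proof (rule additive_eqI[where f=g])
    fix v d
    have "scal (c * d) * (a * b) = scal c * a * (scal d * b)" for a b :: "'w \<Rightarrow>\<^sub>0 complex"
      by (simp add: scal_central[of d b] scal_central[of d "a * b"] mult.assoc flip: scal_assoc[of c d "a * b"])
    then show "lift_hom \<phi> (Poly_Mapping.single u c * Poly_Mapping.single v d) =
      lift_hom \<phi> (Poly_Mapping.single u c) * lift_hom \<phi> (Poly_Mapping.single v d)"
      by (simp add: mult_single lift_hom_single)
  qed (simp_all add: lift_hom_add algebra_simps)
qed (simp_all add: lift_hom_add algebra_simps)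

lemma lift_hom_uminus: "lift_hom \<phi> (- f) = - lift_hom \<phi> f"
  by (metis add_eq_0_iff lift_hom_0 lift_hom_add)

lemma lift_hom_diff: "lift_hom \<phi> (f - g) = lift_hom \<phi> f - lift_hom \<phi> g"
  by (metis add_diff_cancel diff_add_cancel lift_hom_add)

lemma lift_hom_sum: "lift_hom \<phi> (\<Sum>i\<in>A. h i) = (\<Sum>i\<in>A. lift_hom \<phi> (h i))"
  by (induction A rule: infinite_finite_induct) (simp_all add: lift_hom_add)

lemma lift_star_add: "lift_star \<phi> (f + g) = lift_star \<phi> f + lift_star \<phi> g"
  unfolding lift_star_def
  by (rule setsum_keys_plus_distrib) (simp_all add: scal_add distrib_right)

lemma lift_star_single:
  "lift_star \<phi> (Poly_Mapping.single w c) = scal (cnj c) * prod_list (map \<phi> (rev (letters w)))"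
  by (cases "c = 0") (simp_all add: lift_star_def)

lemma lift_star_0 [simp]: "lift_star \<phi> 0 = 0"
  by (simp add: lift_star_def)

lemma lift_star_scal [simp]: "lift_star \<phi> (scal c) = scal (cnj c)"
  by (subst (1) scal_def) (simp add: lift_star_single)

lemma lift_star_gen [simp]: "lift_star \<phi> (gen x) = \<phi> x"
  by (simp add: gen_def lift_star_single)

lemma lift_star_1 [simp]: "lift_star \<phi> 1 = 1"
  using lift_star_scal[of \<phi> 1] by simp

lemma lift_star_mult: "lift_star \<phi> (f * g) = lift_star \<phi> g * lift_star \<phi> f"
proof (rule additive_eqI[where f=f])
  fix u and c :: complex
  show "lift_star \<phi> (Poly_Mapping.single u c * g) = lift_star \<phi> g * lift_star \<phi> (Poly_Mapping.single u c)"
  proof (rule additive_eqI[where f=g])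
    fix v d
    have "scal (c * d) * (a * b) = scal d * a * (scal c * b)" for a b :: "'a fa" and c d
      by (simp add: scal_central[of c b] scal_central[of c "a * b"] mult.assoc mult.commute[of c d]
          flip: scal_assoc[of d c "a * b"])
    then show "lift_star \<phi> (Poly_Mapping.single u c * Poly_Mapping.single v d) =
      lift_star \<phi> (Poly_Mapping.single v d) * lift_star \<phi> (Poly_Mapping.single u c)"
      by (simp add: mult_single lift_star_single)
  qed (simp_all add: lift_star_add algebra_simps)
qed (simp_all add: lift_star_add algebra_simps)

lemma lift_star_uminus: "lift_star \<phi> (- f) = - lift_star \<phi> f"
  by (metis add_eq_0_iff lift_star_0 lift_star_add)

lemma lift_star_diff: "lift_star \<phi> (f - g) = lift_star \<phi> f - lift_star \<phi> g"
  by (metis add_diff_cancel diff_add_cancel lift_star_add)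

lemma lift_star_sum: "lift_star \<phi> (\<Sum>i\<in>A. h i) = (\<Sum>i\<in>A. lift_star \<phi> (h i))"
  by (induction A rule: infinite_finite_induct) (simp_all add: lift_star_add)

lemmas lift_simps = lift_hom_add lift_hom_mult lift_hom_uminus lift_hom_diff lift_hom_sum
  lift_star_add lift_star_mult lift_star_uminus lift_star_diff lift_star_sum

lemma mem_free_alg: "f \<in> carrier (free_alg G) \<longleftrightarrow> (\<forall>w\<in>Poly_Mapping.keys f. set (letters w) \<subseteq> G)"
  by (simp add: free_alg_def)

lemma free_alg_single: "set (letters w) \<subseteq> G \<Longrightarrow> Poly_Mapping.single w c \<in> carrier (free_alg G)"
  by (simp add: mem_free_alg)

lemma free_alg_closed [simp, intro]:
  shows free_alg_0: "0 \<in> carrier (free_alg G)"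
    and free_alg_1: "1 \<in> carrier (free_alg G)"
    and free_alg_scal: "scal c \<in> carrier (free_alg G)"
    and free_alg_add: "f \<in> carrier (free_alg G) \<Longrightarrow> g \<in> carrier (free_alg G) \<Longrightarrow> f + g \<in> carrier (free_alg G)"
    and free_alg_diff: "f \<in> carrier (free_alg G) \<Longrightarrow> g \<in> carrier (free_alg G) \<Longrightarrow> f - g \<in> carrier (free_alg G)"
    and free_alg_uminus: "f \<in> carrier (free_alg G) \<Longrightarrow> - f \<in> carrier (free_alg G)"
    and free_alg_mult: "f \<in> carrier (free_alg G) \<Longrightarrow> g \<in> carrier (free_alg G) \<Longrightarrow> f * g \<in> carrier (free_alg G)"
proof -
  show "0 \<in> carrier (free_alg G)" "1 \<in> carrier (free_alg G)"
    by (simp_all add: mem_free_alg)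
  show "scal c \<in> carrier (free_alg G)"
    by (simp add: mem_free_alg scal_def)
  show add: "f + g \<in> carrier (free_alg G)"
    if "f \<in> carrier (free_alg G)" "g \<in> carrier (free_alg G)" for f g
    using that Poly_Mapping.keys_add[of f g] unfolding mem_free_alg by blast
  show mult: "f * g \<in> carrier (free_alg G)"
    if "f \<in> carrier (free_alg G)" "g \<in> carrier (free_alg G)" for f g
    unfolding mem_free_alg
  proof
    fix w assume "w \<in> Poly_Mapping.keys (f * g)"
    then obtain u v where "w = u + v" "u \<in> Poly_Mapping.keys f" "v \<in> Poly_Mapping.keys g"
      using keys_mult[of f g] by blast
    then show "set (letters w) \<subseteq> G"
      using that by (simp add: mem_free_alg)
  qed
  have "- f = scal (-1) * f"
    by (simp add: scal_uminus)
  moreover have "scal (-1) \<in> carrier (free_alg G)"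
    by (simp add: mem_free_alg scal_def)
  ultimately show minus: "- f \<in> carrier (free_alg G)" if "f \<in> carrier (free_alg G)"
    using mult that by metis
  have "- g = scal (-1) * g"
    by (simp add: scal_uminus)
  then show "f - g \<in> carrier (free_alg G)"
    if "f \<in> carrier (free_alg G)" "g \<in> carrier (free_alg G)"
    using mult[OF \<open>scal (-1) \<in> carrier (free_alg G)\<close> that(2)] add[OF that(1), of "- g"]
    by (metis uminus_add_conv_diff add.commute)
qed

lemma free_alg_gen [simp]: "x \<in> G \<Longrightarrow> gen x \<in> carrier (free_alg G)"
  by (simp add: mem_free_alg gen_def)

lemma free_alg_sum [simp, intro]:
  "(\<And>i. i \<in> A \<Longrightarrow> h i \<in> carrier (free_alg G)) \<Longrightarrow> (\<Sum>i\<in>A. h i) \<in> carrier (free_alg G)"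
  by (induction A rule: infinite_finite_induct) simp_all

lemma free_alg_prod_list [simp, intro]:
  "(\<And>x. x \<in> set xs \<Longrightarrow> x \<in> carrier (free_alg G)) \<Longrightarrow> prod_list xs \<in> carrier (free_alg G)"
  by (induction xs) simp_all

lemma free_alg_power [simp, intro]:
  "f \<in> carrier (free_alg G) \<Longrightarrow> f ^ k \<in> carrier (free_alg G)"
  by (induction k) simp_all

lemma free_alg_induct [consumes 1, case_names scal gen add mult]:
  assumes "f \<in> carrier (free_alg G)"
    and "\<And>c. P (scal c)" "\<And>x. x \<in> G \<Longrightarrow> P (gen x)"
    and "\<And>f g. f \<in> carrier (free_alg G) \<Longrightarrow> g \<in> carrier (free_alg G) \<Longrightarrow> P f \<Longrightarrow> P g \<Longrightarrow> P (f + g)"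
    and "\<And>f g. f \<in> carrier (free_alg G) \<Longrightarrow> g \<in> carrier (free_alg G) \<Longrightarrow> P f \<Longrightarrow> P g \<Longrightarrow> P (f * g)"
  shows "P f"
proof -
  have gens: "P (prod_list (map gen xs))" if "set xs \<subseteq> G" for xs
    using that
  proof (induction xs)
    case Nil
    then show ?case using assms(2)[of 1] by simp
  next
    case (Cons x xs)
    then have "prod_list (map gen xs) \<in> carrier (free_alg G)"
      by (intro free_alg_prod_list) auto
    then show ?case using Cons by (auto intro!: assms)
  qed
  \<comment> \<open>Membership is carried along because the cases \<open>add\<close> and
    \<open>mult\<close> of the rule ask for it.\<close>
  have "f \<in> carrier (free_alg G) \<and> P f"
  proof (rule poly_mapping_single_induct[where f=f])
    show "0 \<in> carrier (free_alg G) \<and> P 0"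
      using assms(2)[of 0] by simp
  next
    fix w c assume "w \<in> Poly_Mapping.keys f"
    then have w: "set (letters w) \<subseteq> G"
      using assms(1) by (simp add: mem_free_alg)
    have "prod_list (map gen (letters w)) \<in> carrier (free_alg G)"
      using w by (intro free_alg_prod_list) auto
    then show "Poly_Mapping.single w c \<in> carrier (free_alg G) \<and> P (Poly_Mapping.single w c)"
      unfolding single_eq_scal_gens[of w c] using w by (intro conjI assms gens free_alg_closed) auto
  qed (auto intro: assms)
  then show ?thesis ..
qed

lemma lift_hom_closed:
  assumes "f \<in> carrier (free_alg G)" "\<And>x. x \<in> G \<Longrightarrow> \<phi> x \<in> carrier (free_alg G')"
  shows "lift_hom \<phi> f \<in> carrier (free_alg G')"
  using assms(1)
  by (induction f rule: free_alg_induct) (simp_all add: lift_simps assms(2))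

lemma lift_star_closed:
  assumes "f \<in> carrier (free_alg G)" "\<And>x. x \<in> G \<Longrightarrow> \<phi> x \<in> carrier (free_alg G)"
  shows "lift_star \<phi> f \<in> carrier (free_alg G)"
  using assms(1)
  by (induction f rule: free_alg_induct) (simp_all add: lift_simps assms(2))

lemma lift_star_lift_star:
  assumes "f \<in> carrier (free_alg G)" "\<And>x. x \<in> G \<Longrightarrow> lift_star \<phi> (\<phi> x) = gen x"
  shows "lift_star \<phi> (lift_star \<phi> f) = f"
  using assms(1)
  by (induction f rule: free_alg_induct) (simp_all add: lift_simps assms(2))

lemma free_alg_simps [simp]:
  "mult (free_alg G) = (*)" "one (free_alg G) = 1" "zero (free_alg G) = 0" "add (free_alg G) = (+)"
  by (simp_all add: free_alg_def)

lemma free_alg_ring: "ring (free_alg G)"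
proof (rule ringI)
  show "abelian_group (free_alg G)"
  proof (rule abelian_groupI)
    fix x assume "x \<in> carrier (free_alg G)"
    then show "\<exists>y\<in>carrier (free_alg G). y \<oplus>\<^bsub>free_alg G\<^esub> x = \<zero>\<^bsub>free_alg G\<^esub>"
      by (intro bexI[of _ "- x"]) auto
  qed (auto simp: algebra_simps)
  show "Group.monoid (free_alg G)"
    by (rule monoidI) (auto simp: mult.assoc)
qed (auto simp: algebra_simps)

lemma free_alg_a_inv: "f \<in> carrier (free_alg G) \<Longrightarrow> \<ominus>\<^bsub>free_alg G\<^esub> f = - f"
  by (rule abelian_group.minus_equality[OF ring.is_abelian_group[OF free_alg_ring]]) simp_all

locale presentation =
  fixes G :: "'g set" and R :: "'g fa set"
  assumes rels: "R \<subseteq> carrier (free_alg G)"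
begin

abbreviation "FA \<equiv> carrier (free_alg G)"
abbreviation "I \<equiv> Idl\<^bsub>free_alg G\<^esub> R"
abbreviation "PA \<equiv> presented G R"

sublocale ideal I "free_alg G"
  by (rule ring.genideal_ideal[OF free_alg_ring rels])

lemma Idl_FA: "f \<in> I \<Longrightarrow> f \<in> FA"
  by (rule a_Hcarr)

lemma Idl_rel: "r \<in> R \<Longrightarrow> r \<in> I"
  using ring.genideal_self[OF free_alg_ring rels] by blast

lemma Idl_add: "f \<in> I \<Longrightarrow> g \<in> I \<Longrightarrow> f + g \<in> I"
  using additive_subgroup.a_closed[OF additive_subgroup_axioms, of f g] by simp

lemma Idl_mult: "f \<in> I \<Longrightarrow> a \<in> FA \<Longrightarrow> a * f \<in> I" "f \<in> I \<Longrightarrow> a \<in> FA \<Longrightarrow> f * a \<in> I"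
  using I_l_closed[of f a] I_r_closed[of f a] by simp_all

lemma Idl_uminus: "f \<in> I \<Longrightarrow> - f \<in> I"
  using Idl_mult(1)[of f "- 1"] by simp

lemma Idl_diff: "f \<in> I \<Longrightarrow> g \<in> I \<Longrightarrow> f - g \<in> I"
  using Idl_add[of f "- g"] Idl_uminus by simp

lemma Idl_0: "0 \<in> I"
  using additive_subgroup.zero_closed[OF additive_subgroup_axioms] by simp

text \<open>The elements of the ideal with property \<open>P\<close> form an ideal containing
  \<open>R\<close>, so minimality applies. Closure under negation comes from \<open>left\<close>
  with the factor -1.\<close>

lemma Idl_induct [consumes 1, case_names zero rel add left right]:
  assumes "f \<in> I" and P0: "P 0" and rel: "\<And>r. r \<in> R \<Longrightarrow> P r"
    and add: "\<And>f g. f \<in> I \<Longrightarrow> g \<in> I \<Longrightarrow> P f \<Longrightarrow> P g \<Longrightarrow> P (f + g)"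
    and left: "\<And>a f. a \<in> FA \<Longrightarrow> f \<in> I \<Longrightarrow> P f \<Longrightarrow> P (a * f)"
    and right: "\<And>a f. a \<in> FA \<Longrightarrow> f \<in> I \<Longrightarrow> P f \<Longrightarrow> P (f * a)"
  shows "P f"
proof -
  have Pm: "P (- f)" if "f \<in> I" "P f" for f
    using left[of "- 1" f] that by simp
  have "I \<subseteq> {f \<in> I. P f}"
  proof (rule ring.genideal_minimal[OF free_alg_ring])
    show "ideal {f \<in> I. P f} (free_alg G)"
    proof (rule idealI[OF free_alg_ring])
      show "subgroup {f \<in> I. P f} (add_monoid (free_alg G))"
      proof (rule group.subgroupI)
        show "group (add_monoid (free_alg G))"
          using a_group .
        fix a b assume a: "a \<in> {f \<in> I. P f}"
        then show "inv\<^bsub>add_monoid (free_alg G)\<^esub> a \<in> {f \<in> I. P f}"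
          using Pm free_alg_a_inv[of a] by (auto simp: a_inv_def Idl_uminus Idl_FA)
        assume "b \<in> {f \<in> I. P f}"
        then show "a \<otimes>\<^bsub>add_monoid (free_alg G)\<^esub> b \<in> {f \<in> I. P f}"
          using a by (auto simp: Idl_add add)
      qed (use Idl_FA Idl_0 P0 in auto)
    qed (auto simp: Idl_mult left right)
    show "R \<subseteq> {f \<in> I. P f}"
      using rel Idl_rel by blast
  qed
  then show ?thesis using assms(1) by blast
qed

abbreviation "cl \<equiv> cls G R"

lemma mem_cls: "f \<in> FA \<Longrightarrow> h \<in> cl f \<longleftrightarrow> h \<in> FA \<and> h - f \<in> I"
  unfolding cls_def a_r_coset_def'
  using Idl_FA by (auto intro: bexI[of _ "h - f"])

lemma self_mem_cls: "f \<in> FA \<Longrightarrow> f \<in> cl f"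
  by (simp add: mem_cls Idl_0)

lemma cls_eq_iff: "f \<in> FA \<Longrightarrow> g \<in> FA \<Longrightarrow> cl f = cl g \<longleftrightarrow> f - g \<in> I"
proof
  assume f: "f \<in> FA" "g \<in> FA" and "f - g \<in> I"
  then have "h - f \<in> I \<longleftrightarrow> h - g \<in> I" for h
    using Idl_add[of "h - f" "f - g"] Idl_diff[of "h - g" "f - g"] by auto
  then show "cl f = cl g"
    using f by (auto simp: mem_cls)
qed (metis mem_cls self_mem_cls)

lemma carrier_presented: "carrier PA = cl ` FA"
  unfolding presented_def FactRing_def cls_def A_RCOSETS_def' by auto

lemma cls_closed [simp, intro]: "f \<in> FA \<Longrightarrow> cl f \<in> carrier PA"
  by (simp add: carrier_presented)

lemma presented_ring: "ring PA"
  unfolding presented_def by (rule quotient_is_ring)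

lemma cls_mult: "f \<in> FA \<Longrightarrow> g \<in> FA \<Longrightarrow> cl f \<otimes>\<^bsub>PA\<^esub> cl g = cl (f * g)"
  using rcoset_mult_add[of f g] by (simp add: presented_def FactRing_def cls_def)

lemma cls_add: "f \<in> FA \<Longrightarrow> g \<in> FA \<Longrightarrow> cl f \<oplus>\<^bsub>PA\<^esub> cl g = cl (f + g)"
  using a_rcos_sum[of f g] by (simp add: presented_def FactRing_def cls_def)

lemma cls_one: "\<one>\<^bsub>PA\<^esub> = cl 1"
  by (simp add: presented_def FactRing_def cls_def)

lemma cls_zero: "\<zero>\<^bsub>PA\<^esub> = cl 0"
proof -
  have "cl 0 = I"
    using Idl_FA by (auto simp: mem_cls)
  then show ?thesis
    by (simp add: presented_def FactRing_def)
qed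

lemma presented_induct [consumes 1, case_names scal gen add mult]:
  assumes "A \<in> carrier PA"
    and "\<And>c. P (cl (scal c))" "\<And>x. x \<in> G \<Longrightarrow> P (cl (gen x))"
    and "\<And>A B. A \<in> carrier PA \<Longrightarrow> B \<in> carrier PA \<Longrightarrow> P A \<Longrightarrow> P B \<Longrightarrow> P (A \<oplus>\<^bsub>PA\<^esub> B)"
    and "\<And>A B. A \<in> carrier PA \<Longrightarrow> B \<in> carrier PA \<Longrightarrow> P A \<Longrightarrow> P B \<Longrightarrow> P (A \<otimes>\<^bsub>PA\<^esub> B)"
  shows "P A"
proof -
  obtain f where f: "f \<in> FA" "A = cl f"
    using assms(1) by (auto simp: carrier_presented)
  from f(1) have "P (cl f)"
  proof (induction f rule: free_alg_induct)
    case (add f g)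
    then show ?case using assms(4)[of "cl f" "cl g"] by (simp add: cls_add)
  next
    case (mult f g)
    then show ?case using assms(5)[of "cl f" "cl g"] by (simp add: cls_mult)
  qed (simp_all add: assms)
  then show ?thesis using f by simp
qed

text \<open>Modulo the ideal \<open>h\<close> is constant on a coset, so \<open>the_elem\<close> is
  applied to a singleton.\<close>

lemma cls_map_cls:
  assumes f: "f \<in> FA" and h: "\<And>f. f \<in> FA \<Longrightarrow> h f \<in> FA" "\<And>f. f \<in> I \<Longrightarrow> h f \<in> I"
    and diff: "\<And>f g. h (f - g) = h f - h g"
  shows "cls_map G R h (cl f) = cl (h f)"
proof -
  have "cl (h g) = cl (h f)" if "g \<in> cl f" for g
  proof -
    have g: "g \<in> FA" "g - f \<in> I"
      using that f by (simp_all add: mem_cls)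
    from h(2)[OF g(2)] show ?thesis
      using cls_eq_iff[OF h(1)[OF g(1)] h(1)[OF f]] unfolding diff by blast
  qed
  then have "(\<lambda>g. cl (h g)) ` cl f = (\<lambda>g. cl (h f)) ` cl f"
    by (rule image_cong[OF refl])
  also have "\<dots> = {cl (h f)}"
    using self_mem_cls[OF f] by (simp only: image_constant)
  finally show ?thesis
    by (simp add: cls_map_def)
qed

lemma lift_hom_Idl:
  assumes "f \<in> I" "\<And>x. x \<in> G \<Longrightarrow> \<phi> x \<in> FA" "\<And>r. r \<in> R \<Longrightarrow> lift_hom \<phi> r \<in> I"
  shows "lift_hom \<phi> f \<in> I"
  using assms(1)
  by (induction f rule: Idl_induct)
    (simp_all add: lift_simps assms Idl_0 Idl_add Idl_mult lift_hom_closed[OF _ assms(2)])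

lemma lift_star_Idl:
  assumes "f \<in> I" "\<And>x. x \<in> G \<Longrightarrow> \<phi> x \<in> FA" "\<And>r. r \<in> R \<Longrightarrow> lift_star \<phi> r \<in> I"
  shows "lift_star \<phi> f \<in> I"
  using assms(1)
  by (induction f rule: Idl_induct)
    (simp_all add: lift_simps assms Idl_0 Idl_add Idl_mult lift_star_closed[OF _ assms(2)])

end

section \<open>The quantum cone\<close>

locale cone =
  fixes q :: real and n m :: nat
  assumes q: "0 < q" "q < 1" and n: "1 \<le> n" and m: "2 \<le> m"
begin

abbreviation "N \<equiv> n + m"
abbreviation "CG \<equiv> cone_gens n m"
abbreviation "CR \<equiv> cone_rels q n m"
abbreviation "CF \<equiv> carrier (free_alg CG)"
abbreviation "CA \<equiv> cone_alg q n m"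
abbreviation "cc \<equiv> cone_cls q n m"
abbreviation "star \<equiv> lift_star cgen_star"

lemma cone_gens_iff [simp]:
  "Tg j \<in> CG \<longleftrightarrow> j \<in> {1..N}" "Ts j \<in> CG \<longleftrightarrow> j \<in> {1..N}" "Fn g \<in> CG"
  by (auto simp: cone_gens_def)

lemma cgen_star_CF: "x \<in> CG \<Longrightarrow> cgen_star x \<in> CF"
  by (cases x) simp_all

lemma cone_xi_CF: "1 \<le> j \<Longrightarrow> cone_xi n m j \<in> CF"
  by (auto simp: cone_xi_def intro!: free_alg_closed free_alg_sum)

lemma pol_rels_CF: "pol_rels q n m \<subseteq> CF"
  unfolding pol_rels_def by (auto intro!: free_alg_closed free_alg_sum)

lemma fun_rels_CF: "fun_rels q n m \<subseteq> CF"
  unfolding fun_rels_def using n cone_xi_CF[of "n+1"]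
  by (auto intro!: free_alg_closed free_alg_sum free_alg_gen)

lemma star_CF: "f \<in> CF \<Longrightarrow> star f \<in> CF"
  by (rule lift_star_closed) (simp_all add: cgen_star_CF)

lemma star_star: "f \<in> CF \<Longrightarrow> star (star f) = f"
proof (rule lift_star_lift_star)
  fix x assume "x \<in> CG"
  then show "lift_star cgen_star (cgen_star x) = gen x" by (cases x) simp_all
qed

lemma cone_rels_CF: "CR \<subseteq> CF"
  using subsetD[OF pol_rels_CF] subsetD[OF fun_rels_CF] star_CF unfolding cone_rels_def Let_def by blast

sublocale P: presentation CG CR
  by unfold_locales (rule cone_rels_CF)

lemma cone_alg_eq: "cone_alg q n m = presented CG CR"
  and cone_cls_eq: "cone_cls q n m = cls CG CR"
  by (simp_all add: cone_alg_def cone_cls_def)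

text \<open>Adding one image of each relation already closes the set, because \<open>star\<close> is
  an involution.\<close>

lemma star_rel: "r \<in> CR \<Longrightarrow> star r \<in> CR"
  using subsetD[OF pol_rels_CF] subsetD[OF fun_rels_CF] star_star unfolding cone_rels_def Let_def by auto

lemma star_Idl: "f \<in> P.I \<Longrightarrow> star f \<in> P.I"
  by (rule P.lift_star_Idl) (simp_all add: cgen_star_CF star_rel P.Idl_rel)

lemma cone_star_cls: "f \<in> CF \<Longrightarrow> cone_star q n m (cc f) = cc (star f)"
  unfolding cone_star_def cone_cls_eq
  by (rule P.cls_map_cls) (simp_all add: star_CF star_Idl lift_simps)

lemma cone_scale_cls: "f \<in> CF \<Longrightarrow> cone_scale q n m c (cc f) = cc (scal c * f)"
  by (simp add: cone_scale_def cone_cls_eq cone_alg_eq P.cls_mult)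

end

text \<open>The index set is enlarged by a free coordinate \<open>N\<close> that $t_N$ and $t_N^*$ shift. On it every
  $K_j$ is implemented by conjugation with a diagonal operator.\<close>

fun sft :: "cgen \<Rightarrow> (nat \<Rightarrow> int) \<Rightarrow> nat \<Rightarrow> int" where
  "sft (Tg j) i = i(j := i j - 1)"
| "sft (Ts j) i = i(j := i j + 1)"
| "sft (Fn g) i = i"

definition sfw :: "cgen list \<Rightarrow> (nat \<Rightarrow> int) \<Rightarrow> nat \<Rightarrow> int" where
  "sfw w = foldr sft w"

lemma sfw_simps [simp]: "sfw [] i = i" "sfw (x # w) i = sft x (sfw w i)"
  "sfw (u @ w) i = sfw u (sfw w i)"
  by (simp_all add: sfw_def)

lemma idx_sum_upd: "idx_sum k (i(j := a)) = idx_sum k i + (if 1 \<le> j \<and> j < k then a - i j else 0)"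
proof -
  have *: "(\<Sum>x\<in>{1..<k}. (i(j := a)) x) = (\<Sum>x\<in>{1..<k}. i x + (if x = j then a - i j else 0))"
    by (intro sum.cong) auto
  show ?thesis
    unfolding idx_sum_def * sum.distrib by (simp add: sum.delta)
qed

lemma idx_sum_Suc: "1 \<le> k \<Longrightarrow> idx_sum (k + 1) i = idx_sum k i + i k"
  by (simp add: idx_sum_def)

context cone
begin

text \<open>The coefficient with which t_j sends the basis vector at \<open>i\<close> to the one
  with coordinate \<open>j\<close> lowered. For t_j^* the function \<open>cf\<close> uses the same
  number at the raised index, so the two operators are adjoint by construction.\<close>

definition C :: "nat \<Rightarrow> (nat \<Rightarrow> int) \<Rightarrow> real" where
  "C j i = (if j = 1 then q powi (i 1 - 1)
     else if j \<le> n then q powi (idx_sum j i) * sqrt (q powi (2 * (i j - 1)) - 1)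
     else if j < N then q powi (idx_sum j i) * sqrt (1 - q powi (2 * (i j - 1)))
     else q powi (idx_sum j i))"

fun cf :: "cgen \<Rightarrow> (nat \<Rightarrow> int) \<Rightarrow> complex" where
  "cf (Tg j) i = of_real (C j i)"
| "cf (Ts j) i = of_real (C j (i(j := i j + 1)))"
| "cf (Fn g) i = g (idx_sum (n + 1) i)"

fun cfw :: "cgen list \<Rightarrow> (nat \<Rightarrow> int) \<Rightarrow> complex" where
  "cfw [] i = 1"
| "cfw (x # w) i = cfw w i * cf x (sfw w i)"

lemma cfw_append: "cfw (u @ w) i = cfw w i * cfw u (sfw w i)"
  by (induction u) simp_all

text \<open>\<open>Rop f\<close> is the transpose of the operator representing \<open>f\<close>, so that it acts on arbitrary
  functions; it reverses products.\<close>

definition Rop :: "cgen fa \<Rightarrow> ((nat \<Rightarrow> int) \<Rightarrow> complex) \<Rightarrow> (nat \<Rightarrow> int) \<Rightarrow> complex" where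
  "Rop f v i = (\<Sum>w\<in>Poly_Mapping.keys f.
     Poly_Mapping.lookup f w * (cfw (letters w) i * v (sfw (letters w) i)))"

lemma Rop_add: "Rop (f + g) v i = Rop f v i + Rop g v i"
  unfolding Rop_def by (rule setsum_keys_plus_distrib) (simp_all add: distrib_right)

lemma Rop_single: "Rop (Poly_Mapping.single w c) v i = c * (cfw (letters w) i * v (sfw (letters w) i))"
  by (cases "c = 0") (simp_all add: Rop_def)

lemma Rop_0 [simp]: "Rop 0 v i = 0"
  by (simp add: Rop_def)

lemma Rop_scal [simp]: "Rop (scal c) v i = c * v i"
  by (simp add: scal_def Rop_single)

lemma Rop_1 [simp]: "Rop 1 v = v"
  using Rop_scal[of 1 v] by auto

lemma Rop_gen [simp]: "Rop (gen x) v i = cf x i * v (sft x i)"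
  by (simp add: gen_def Rop_single)

lemma Rop_vadd: "Rop f (\<lambda>k. u k + v k) i = Rop f u i + Rop f v i"
  by (simp add: Rop_def algebra_simps sum.distrib)

lemma Rop_vscale: "Rop f (\<lambda>k. c * v k) i = c * Rop f v i"
  by (simp add: Rop_def algebra_simps sum_distrib_left)

lemma Rop_v0 [simp]: "Rop f (\<lambda>k. 0) i = 0"
  by (simp add: Rop_def)

lemma Rop_mult: "Rop (f * g) v i = Rop g (Rop f v) i"
proof (rule additive_eqI[where f=f])
  fix u c
  show "Rop (Poly_Mapping.single u c * g) v i = Rop g (Rop (Poly_Mapping.single u c) v) i"
  proof (rule additive_eqI[where f=g])
    fix w d
    show "Rop (Poly_Mapping.single u c * Poly_Mapping.single w d) v i =
        Rop (Poly_Mapping.single w d) (Rop (Poly_Mapping.single u c) v) i"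
      by (simp add: mult_single Rop_single cfw_append)
  qed (simp_all add: Rop_add algebra_simps)
next
  fix f1 f2
  have "Rop (f1 + f2) v = (\<lambda>k. Rop f1 v k + Rop f2 v k)"
    by (simp add: fun_eq_iff Rop_add)
  then show "Rop g (Rop (f1 + f2) v) i = Rop g (Rop f1 v) i + Rop g (Rop f2 v) i"
    by (simp add: Rop_vadd)
next
  have "Rop 0 v = (\<lambda>k. 0)" by (simp add: fun_eq_iff)
  then show "Rop (0 * g) v i = Rop g (Rop 0 v) i" by simp
qed (simp_all add: Rop_add algebra_simps)

lemma Rop_uminus: "Rop (- f) v i = - Rop f v i"
  by (metis Rop_add Rop_0 add_eq_0_iff)

lemma Rop_diff: "Rop (f - g) v i = Rop f v i - Rop g v i"
  by (metis Rop_add add_diff_cancel diff_add_cancel)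

lemma Rop_sum: "Rop (\<Sum>a\<in>A. h a) v i = (\<Sum>a\<in>A. Rop (h a) v i)"
  by (induction A rule: infinite_finite_induct) (simp_all add: Rop_add)

lemmas Rop_simps = Rop_add Rop_mult Rop_uminus Rop_diff Rop_sum

lemma Rop_scal_mult: "Rop (scal c * f) v i = c * Rop f v i"
proof -
  have "Rop (scal c) v = (\<lambda>k. c * v k)"
    by (simp add: fun_eq_iff)
  then show ?thesis
    by (simp add: Rop_mult Rop_vscale)
qed

lemma Rop_vsum: "Rop f (\<lambda>k. \<Sum>a\<in>A. h a k) i = (\<Sum>a\<in>A. Rop f (h a) i)"
  by (induction A rule: infinite_finite_induct) (simp_all add: Rop_vadd)

subsection \<open>The index set\<close>

definition Bh :: "(nat \<Rightarrow> int) set" where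
  "Bh = {i. (\<forall>j. j \<notin> {1..N} \<longrightarrow> i j = 0) \<and> (\<forall>j\<in>{2..n}. i j \<le> 0) \<and> (\<forall>j\<in>{n+1..N-1}. 1 \<le> i j)}"

lemma Bh_upd:
  assumes "i \<in> Bh" "1 \<le> j" "j \<le> N" "2 \<le> j \<Longrightarrow> j \<le> n \<Longrightarrow> a \<le> 0" "n < j \<Longrightarrow> j < N \<Longrightarrow> 1 \<le> a"
  shows "i(j := a) \<in> Bh"
  using assms by (auto simp: Bh_def)

lemma Bh_D:
  assumes "i \<in> Bh"
  shows "2 \<le> j \<Longrightarrow> j \<le> n \<Longrightarrow> i j \<le> 0" "n < j \<Longrightarrow> j < N \<Longrightarrow> 1 \<le> i j"
  using assms by (auto simp: Bh_def)

text \<open>On the boundary of the index set the square root in \<open>C\<close> is zero, so a step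
  that would leave \<open>Bh\<close> has coefficient 0.\<close>

lemma sft_Bh:
  assumes "x \<in> CG" "i \<in> Bh" "cf x i \<noteq> 0"
  shows "sft x i \<in> Bh"
proof (cases x)
  case (Tg j)
  then have j: "1 \<le> j" "j \<le> N" "C j i \<noteq> 0" using assms by auto
  then have "n < j \<Longrightarrow> j < N \<Longrightarrow> i j \<noteq> 1"
    unfolding C_def using n by auto
  then show ?thesis
    unfolding Tg sft.simps using Bh_D[OF assms(2), of j] j
    by (intro Bh_upd[OF assms(2)]) force+
next
  case (Ts j)
  then have j: "1 \<le> j" "j \<le> N" "C j (i(j := i j + 1)) \<noteq> 0" using assms by auto
  then have "2 \<le> j \<Longrightarrow> j \<le> n \<Longrightarrow> i j \<noteq> 0"
    unfolding C_def by auto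
  then show ?thesis
    unfolding Ts sft.simps using Bh_D[OF assms(2), of j] j
    by (intro Bh_upd[OF assms(2)]) force+
qed (use assms in simp)

lemma sfw_Bh: "set w \<subseteq> CG \<Longrightarrow> i \<in> Bh \<Longrightarrow> cfw w i \<noteq> 0 \<Longrightarrow> sfw w i \<in> Bh"
  by (induction w) (auto intro: sft_Bh)

lemma Rop_cong:
  assumes "f \<in> CF" "i \<in> Bh" "\<And>k. k \<in> Bh \<Longrightarrow> u k = v k"
  shows "Rop f u i = Rop f v i"
  unfolding Rop_def
proof (rule sum.cong[OF refl])
  fix w assume "w \<in> Poly_Mapping.keys f"
  then have "set (letters w) \<subseteq> CG" using assms(1) by (simp add: mem_free_alg)
  then show "Poly_Mapping.lookup f w * (cfw (letters w) i * u (sfw (letters w) i)) =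
      Poly_Mapping.lookup f w * (cfw (letters w) i * v (sfw (letters w) i))"
    using sfw_Bh[OF _ assms(2)] assms(3) by (cases "cfw (letters w) i = 0") auto
qed

text \<open>The eigenvalue of \<xi>_k. The value 0 at 1 is the relation \<xi>_1 = 0, and at N + 1 it
  stands for the empty sum; with these conventions \<open>C_sq\<close> needs no exceptional
  cases.\<close>

definition xx :: "nat \<Rightarrow> (nat \<Rightarrow> int) \<Rightarrow> real" where
  "xx k i = (if k = 1 \<or> k = N + 1 then 0 else q powi (2 * idx_sum k i))"

definition eps :: "nat \<Rightarrow> real" where
  "eps k = (if k \<le> n then - 1 else 1)"

lemma eps_sq [simp]: "eps k * eps k = 1" "eps k * (eps k * x) = x"
  by (auto simp: eps_def)

lemma q_ne [simp]: "q \<noteq> 0" "q > 0" "q \<ge> 0" "q \<le> 1" "\<not> q < 0"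
  using q by auto

lemma powi_pos [simp]: "q powi a > 0"
  using q by simp

lemma powi_le_1: "a \<ge> 0 \<Longrightarrow> q powi a \<le> 1"
  using q by (simp add: power_int_def power_le_one)

lemma powi_ge_1: "a \<le> 0 \<Longrightarrow> q powi a \<ge> 1"
  using powi_le_1[of "-a"] by (simp add: power_int_minus inverse_le_1_iff) (use powi_pos[of a] in linarith)

lemma powi_add: "q powi (a + b) = q powi a * q powi b"
  by (simp add: power_int_add)

lemma powi_diff: "q powi (a - b) = q powi a / q powi b"
  by (simp add: power_int_diff)

lemma powi_double: "q powi (2 * a) = (q powi a)\<^sup>2"
  by (simp add: power2_eq_square flip: powi_add)

text \<open>The four cases of \<open>C\<close> collapse into the eigenvalue of t_k^* t_k, free of
  square roots. Membership in \<open>Bh\<close> makes the radicands nonnegative.\<close>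

lemma C_sq:
  assumes "i \<in> Bh" "k \<in> {1..N}"
  shows "(C k i)\<^sup>2 = eps k * (xx k i - xx (k + 1) i / q\<^sup>2)"
proof -
  have S: "idx_sum (k + 1) i = idx_sum k i + i k"
    using assms by (intro idx_sum_Suc) auto
  consider "k = 1" | "2 \<le> k" "k \<le> n" | "n < k" "k < N" "k \<noteq> 1" | "k = N" "k \<noteq> 1"
    using assms n m by (cases "k = 1"; cases "k \<le> n"; cases "k = N") auto
  then show ?thesis
  proof cases
    case 1
    then show ?thesis using n m S
      by (simp add: C_def xx_def eps_def idx_sum_def powi_double powi_diff power_divide)
  next
    case 2
    then have "q powi (2 * (i k - 1)) \<ge> 1"
      using Bh_D(1)[OF assms(1), of k] by (intro powi_ge_1) auto
    then have "(C k i)\<^sup>2 = (q powi (idx_sum k i))\<^sup>2 * (q powi (2 * (i k - 1)) - 1)"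
      using 2 by (simp add: C_def power_mult_distrib)
    also have "\<dots> = eps k * (xx k i - xx (k + 1) i / q\<^sup>2)"
      using 2 m S by (simp add: xx_def eps_def powi_double powi_diff power_divide powi_add
          power_mult_distrib right_diff_distrib)
    finally show ?thesis .
  next
    case 3
    then have "q powi (2 * (i k - 1)) \<le> 1"
      using Bh_D(2)[OF assms(1), of k] by (intro powi_le_1) auto
    then have "(C k i)\<^sup>2 = (q powi (idx_sum k i))\<^sup>2 * (1 - q powi (2 * (i k - 1)))"
      using 3 by (simp add: C_def power_mult_distrib)
    also have "\<dots> = eps k * (xx k i - xx (k + 1) i / q\<^sup>2)"
      using 3 m S by (simp add: xx_def eps_def powi_double powi_diff power_divide powi_add
          power_mult_distrib right_diff_distrib)
    finally show ?thesis .
  next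
    case 4
    then show ?thesis using n m by (simp add: C_def xx_def eps_def powi_double)
  qed
qed

lemma C_sq_up:
  assumes "i \<in> Bh" "k \<in> {1..N}"
  shows "(C k (i(k := i k + 1)))\<^sup>2 = eps k * (xx k i - xx (k + 1) i)"
proof (cases "i(k := i k + 1) \<in> Bh")
  case True
  have "xx k (i(k := i k + 1)) = xx k i"
    by (simp add: xx_def idx_sum_upd)
  moreover have "xx (k + 1) (i(k := i k + 1)) = q\<^sup>2 * xx (k + 1) i"
    using assms by (auto simp: xx_def idx_sum_upd powi_double powi_add power_mult_distrib)
  ultimately show ?thesis
    using C_sq[OF True assms(2)] by simp
next
  case False
  \<comment> \<open>Raising leaves \<open>Bh\<close> only at this face, where both sides
    vanish.\<close>
  have k: "2 \<le> k \<and> k \<le> n \<and> i k = 0"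
  proof (rule ccontr)
    assume *: "\<not> (2 \<le> k \<and> k \<le> n \<and> i k = 0)"
    have "i(k := i k + 1) \<in> Bh"
      using assms * Bh_D[OF assms(1), of k] by (intro Bh_upd) auto
    then show False using False by simp
  qed
  then have "idx_sum (k + 1) i = idx_sum k i"
    by (subst idx_sum_Suc) auto
  then show ?thesis
    using k m by (simp add: C_def xx_def)
qed

text \<open>Another coordinate enters \<open>C\<close> only through the power of q given by the
  partial sum, so the q-commutation of different generators becomes a count of exponents.\<close>

lemma C_upd:
  assumes "k \<in> {1..N}" "l \<in> {1..N}" "l \<noteq> k"
  shows "C k (i(l := a)) = q powi (if l < k then a - i l else 0) * C k i"
  using assms by (auto simp: C_def idx_sum_upd powi_add)

lemma xx_upd:
  assumes "k \<in> {1..N}" "l \<in> {1..N}"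
  shows "xx k (i(l := a)) = q powi (if l < k then 2 * (a - i l) else 0) * xx k i"
  using assms by (auto simp: xx_def idx_sum_upd powi_add distrib_left)

subsection \<open>The relations\<close>

lemma Rop_tts:
  assumes "i \<in> Bh" "k \<in> {1..N}"
  shows "Rop (tt k * ts k) v i = of_real (eps k * (xx k i - xx (k + 1) i)) * v i"
    and "Rop (ts k * tt k) v i = of_real (eps k * (xx k i - xx (k + 1) i / q\<^sup>2)) * v i"
proof -
  have "complex_of_real (C k (i(k := i k + 1))) * of_real (C k (i(k := i k + 1)))
      = of_real (eps k * (xx k i - xx (k + 1) i))"
    by (metis C_sq_up[OF assms] of_real_mult power2_eq_square)
  then show "Rop (tt k * ts k) v i = of_real (eps k * (xx k i - xx (k + 1) i)) * v i"
    by (simp add: Rop_mult)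
  have "complex_of_real (C k i) * of_real (C k i) = of_real (eps k * (xx k i - xx (k + 1) i / q\<^sup>2))"
    by (metis C_sq[OF assms] of_real_mult power2_eq_square)
  then show "Rop (ts k * tt k) v i = of_real (eps k * (xx k i - xx (k + 1) i / q\<^sup>2)) * v i"
    by (simp add: Rop_mult)
qed

text \<open>The eigenvalues of t_k t_k^* telescope; the upper end contributes
  \<open>xx (N + 1) i\<close>, which is 0.\<close>

lemma Rop_tts_sum_hi:
  assumes "i \<in> Bh" "n < j" "j \<le> N + 1"
  shows "(\<Sum>k\<in>{j..N}. Rop (tt k * ts k) v i) = of_real (xx j i) * v i"
proof -
  have "(\<Sum>k\<in>{j..N}. Rop (tt k * ts k) v i) = (\<Sum>k\<in>{j..N}. of_real (xx k i - xx (Suc k) i) * v i)"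
    using assms n by (intro sum.cong) (auto simp: Rop_tts eps_def)
  also have "\<dots> = of_real (\<Sum>k\<in>{j..N}. - xx (Suc k) i - - xx k i) * v i"
    by (simp flip: sum_distrib_right)
  also have "(\<Sum>k\<in>{j..N}. - xx (Suc k) i - - xx k i) = - xx (Suc N) i - - xx j i"
    using assms by (intro sum_Suc_diff) simp
  finally show ?thesis by (simp add: xx_def)
qed

lemma Rop_tts_sum_lo:
  assumes "i \<in> Bh" "1 \<le> j" "j \<le> n + 1"
  shows "(\<Sum>k\<in>{j..n}. Rop (tt k * ts k) v i) = of_real (xx (n + 1) i - xx j i) * v i"
proof -
  have "(\<Sum>k\<in>{j..n}. Rop (tt k * ts k) v i) = (\<Sum>k\<in>{j..n}. of_real (xx (Suc k) i - xx k i) * v i)"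
    using assms by (intro sum.cong) (auto simp: Rop_tts eps_def)
  also have "\<dots> = of_real (\<Sum>k\<in>{j..n}. xx (Suc k) i - xx k i) * v i"
    by (simp flip: sum_distrib_right)
  also have "(\<Sum>k\<in>{j..n}. xx (Suc k) i - xx k i) = xx (Suc n) i - xx j i"
    using assms by (intro sum_Suc_diff) simp
  finally show ?thesis by simp
qed

lemma Rop_cone_xi:
  assumes "i \<in> Bh" "1 \<le> j" "j \<le> N"
  shows "Rop (cone_xi n m j) v i = of_real (xx j i) * v i"
  using assms m Rop_tts_sum_hi[of i j v] Rop_tts_sum_lo[of i j v] Rop_tts_sum_hi[of i "n+1" v]
  by (auto simp: cone_xi_def Rop_add Rop_diff Rop_uminus Rop_sum algebra_simps)

definition ker :: "cgen fa set" where
  "ker = {f. \<forall>v. \<forall>i\<in>Bh. Rop f v i = 0}"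

text \<open>Relations between different indices are the scaling in \<open>C_upd\<close>; the others
  compare eigenvalues from \<open>Rop_tts\<close> with the telescoped sums. The last one expresses
  that \<open>xx 1\<close> is 0.\<close>

lemma pol_rels_ker: "pol_rels q n m \<subseteq> ker"
proof -
  have 1: "tt i * tt j - scal (of_real q) * tt j * tt i \<in> ker" if "1 \<le> i" "i < j" "j \<le> N" for i j
    using that by (simp add: ker_def Rop_simps C_upd fun_upd_twist[of i j] power_int_minus field_simps)
  have 2: "tt i * ts j - scal (of_real q) * ts j * tt i \<in> ker"
    if "i \<in> {1..N}" "j \<in> {1..N}" "i \<noteq> j" for i j
    using that by (auto simp: ker_def Rop_simps C_upd fun_upd_twist[of i j] power_int_minus field_simps)
  have 3: "tt i * ts i - (ts i * tt i
        + scal (of_real (q powi (-2) - 1)) * (\<Sum>k\<in>{i+1..N}. tt k * ts k)) \<in> ker"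
    if i: "n < i" "i \<le> N" for i
    unfolding ker_def
  proof safe
    fix v k assume k: "k \<in> Bh"
    have ki: "i \<in> {1..N}" and h: "n < i + 1" "i + 1 \<le> N + 1"
      using i n by auto
    show "Rop (tt i * ts i - (ts i * tt i
        + scal (of_real (q powi (-2) - 1)) * (\<Sum>k\<in>{i+1..N}. tt k * ts k))) v k = 0"
      using i n
      unfolding Rop_diff Rop_add Rop_scal_mult Rop_sum Rop_tts[OF k ki] Rop_tts_sum_hi[OF k h]
      by (simp add: eps_def field_simps power_int_minus)
  qed
  have 4: "tt i * ts i - (ts i * tt i
        + scal (of_real (q powi (-2) - 1)) * (\<Sum>k\<in>{i+1..n}. tt k * ts k)
        - scal (of_real (q powi (-2) - 1)) * (\<Sum>k\<in>{n+1..n+m}. tt k * ts k)) \<in> ker"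
    if i: "1 \<le> i" "i \<le> n" for i
    unfolding ker_def
  proof safe
    fix v k assume k: "k \<in> Bh"
    have ki: "i \<in> {1..N}" and h: "n < n + 1" "n + 1 \<le> N + 1" and l: "1 \<le> i + 1" "i + 1 \<le> n + 1"
      using i n by auto
    show "Rop (tt i * ts i - (ts i * tt i
        + scal (of_real (q powi (-2) - 1)) * (\<Sum>k\<in>{i+1..n}. tt k * ts k)
        - scal (of_real (q powi (-2) - 1)) * (\<Sum>k\<in>{n+1..n+m}. tt k * ts k))) v k = 0"
      using i n m
      unfolding Rop_diff Rop_add Rop_scal_mult Rop_sum Rop_tts[OF k ki]
        Rop_tts_sum_hi[OF k h] Rop_tts_sum_lo[OF k l]
      by (simp add: eps_def field_simps power_int_minus)
  qed
  have 5: "- (\<Sum>j\<in>{1..n}. tt j * ts j) + (\<Sum>j\<in>{n+1..n+m}. tt j * ts j) \<in> ker"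
    unfolding ker_def
  proof safe
    fix v k assume k: "k \<in> Bh"
    show "Rop (- (\<Sum>j\<in>{1..n}. tt j * ts j) + (\<Sum>j\<in>{n+1..n+m}. tt j * ts j)) v k = 0"
      unfolding Rop_add Rop_uminus Rop_sum
      using Rop_tts_sum_hi[OF k, of "n+1" v] Rop_tts_sum_lo[OF k, of 1 v] m
      by (simp add: xx_def)
  qed
  show ?thesis
    unfolding pol_rels_def using 1 2 3 4 5 by blast
qed

lemma fun_rels_ker: "fun_rels q n m \<subseteq> ker"
proof -
  have xi: "fn (\<lambda>l. of_real (q powi (2 * l))) - cone_xi n m (n + 1) \<in> ker"
    using m n Rop_cone_xi[of _ "n + 1"] by (auto simp: ker_def Rop_diff xx_def)
  have t: "tt j * fn g - fn (\<lambda>l. g (l + 1)) * tt j \<in> ker"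
    "ts j * fn g - fn (\<lambda>l. g (l - 1)) * ts j \<in> ker" if "1 \<le> j" "j \<le> n" for j g
    using that by (auto simp: ker_def Rop_simps idx_sum_upd)
  have t': "tt j * fn g - fn g * tt j \<in> ker" "ts j * fn g - fn g * ts j \<in> ker" if "n < j" "j \<le> N" for j g
    using that by (auto simp: ker_def Rop_simps idx_sum_upd)
  have f: "fn (\<lambda>l. g l + h l) - (fn g + fn h) \<in> ker" "fn (\<lambda>l. c * g l) - scal c * fn g \<in> ker"
    "fn (\<lambda>l. g l * h l) - fn g * fn h \<in> ker" "fn (\<lambda>l. 1) - 1 \<in> ker" for g h c
    by (simp_all add: ker_def Rop_simps algebra_simps)
  show ?thesis
    unfolding fun_rels_def using xi t t' f by blast
qed

end

section \<open>The involution as conjugate transpose\<close>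

fun stl :: "cgen \<Rightarrow> cgen" where
  "stl (Tg j) = Ts j"
| "stl (Ts j) = Tg j"
| "stl (Fn g) = Fn (\<lambda>l. cnj (g l))"

lemma cgen_star_eq: "cgen_star x = gen (stl x)"
  by (cases x) simp_all

lemma lift_star_cgen_single:
  "lift_star cgen_star (Poly_Mapping.single w c) =
     Poly_Mapping.single (Word (map stl (rev (letters w)))) (cnj c)"
proof -
  have "map cgen_star xs = map gen (map stl xs)" for xs
    by (simp add: cgen_star_eq)
  then show ?thesis
    by (simp only: lift_star_single prod_list_gen) simp
qed

definition dl :: "'a \<Rightarrow> 'a \<Rightarrow> complex" where
  "dl k i = (if i = k then 1 else 0)"

lemma dl_simps [simp]: "dl k k = 1" "i \<noteq> k \<Longrightarrow> dl k i = 0"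
  by (simp_all add: dl_def)

context cone
begin

text \<open>Letter by letter, conjugating and transposing the matrix of a word gives the matrix of
  the reversed word in the adjoint letters. This holds at all integer indices because
  \<open>cf\<close> at \<open>Ts\<close> is \<open>cf\<close> at \<open>Tg\<close> read at the other
  end of the step.\<close>

lemma cfw_star:
  "cfw (map stl (rev w)) k * dl i (sfw (map stl (rev w)) k) = cnj (cfw w i * dl k (sfw w i))"
proof (induction w arbitrary: k)
  case Nil
  then show ?case by (simp add: dl_def)
next
  case (Cons x w)
  define j where "j = sfw w i"
  have *: "cf (stl x) k * dl (sft (stl x) k) j = cnj (cf x j) * dl k (sft x j)"
  proof (cases x)
    case (Tg a)
    have "j = k(a := k a + 1) \<longleftrightarrow> j(a := j a - 1) = k"
      by (auto simp: fun_eq_iff)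
    then show ?thesis by (auto simp: Tg dl_def)
  next
    case (Ts a)
    have "j = k(a := k a - 1) \<longleftrightarrow> j(a := j a + 1) = k"
      by (auto simp: fun_eq_iff)
    then show ?thesis by (auto simp: Ts dl_def)
  qed (auto simp: dl_def)
  have "cfw (map stl (rev (x # w))) k * dl i (sfw (map stl (rev (x # w))) k)
      = cf (stl x) k * (cfw (map stl (rev w)) (sft (stl x) k) * dl i (sfw (map stl (rev w)) (sft (stl x) k)))"
    by (simp add: cfw_append)
  also have "\<dots> = cf (stl x) k * cnj (cfw w i * dl (sft (stl x) k) j)"
    by (simp only: Cons.IH j_def)
  also have "\<dots> = cnj (cfw w i) * (cf (stl x) k * dl (sft (stl x) k) j)"
    by (simp add: dl_def)
  also have "\<dots> = cnj (cfw (x # w) i * dl k (sfw (x # w) i))"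
    unfolding * by (simp add: j_def dl_def)
  finally show ?case .
qed

lemma Rop_star: "Rop (star f) (dl i) k = cnj (Rop f (dl k) i)"
proof (rule additive_eqI[where f=f])
  fix w c
  show "Rop (star (Poly_Mapping.single w c)) (dl i) k = cnj (Rop (Poly_Mapping.single w c) (dl k) i)"
    using cfw_star[of "letters w" k i] by (simp add: lift_star_cgen_single Rop_single)
qed (simp_all add: Rop_add lift_star_add)

definition reach :: "cgen fa \<Rightarrow> (nat \<Rightarrow> int) \<Rightarrow> (nat \<Rightarrow> int) set" where
  "reach f i = (\<lambda>w. sfw (letters w) i) ` Poly_Mapping.keys f"

lemma finite_reach [simp]: "finite (reach f i)"
  by (simp add: reach_def)

text \<open>The functional at a fixed index has finite support, so identities known for point
  masses, such as \<open>Rop_star\<close>, extend to arbitrary functions.\<close>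

lemma Rop_expand:
  assumes "reach f i \<subseteq> F" "finite F"
  shows "Rop f v i = (\<Sum>k\<in>F. Rop f (dl k) i * v k)"
proof -
  have "Rop f v i = Rop f (\<lambda>x. \<Sum>k\<in>F. v k * dl k x) i"
    unfolding Rop_def
  proof (rule sum.cong[OF refl])
    fix w assume "w \<in> Poly_Mapping.keys f"
    then have "sfw (letters w) i \<in> F" using assms by (auto simp: reach_def)
    then have "v (sfw (letters w) i) = (\<Sum>k\<in>F. v k * dl k (sfw (letters w) i))"
      using assms(2) by (simp add: dl_def if_distrib[of "(*) _"] sum.delta' cong: if_cong)
    then show "Poly_Mapping.lookup f w * (cfw (letters w) i * v (sfw (letters w) i)) =
      Poly_Mapping.lookup f w * (cfw (letters w) i * (\<Sum>k\<in>F. v k * dl k (sfw (letters w) i)))"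
      by simp
  qed
  then show ?thesis
    by (simp add: Rop_vsum Rop_vscale mult.commute)
qed

lemma ker_star:
  assumes "r \<in> ker" "r \<in> CF"
  shows "star r \<in> ker"
  unfolding ker_def
proof safe
  fix v k assume k: "k \<in> Bh"
  have "Rop (star r) (dl i) k = 0" for i
  proof (cases "i \<in> Bh")
    case True
    then show ?thesis using assms(1) by (simp add: Rop_star ker_def)
  next
    case False
    have "Rop (star r) (dl i) k = Rop (star r) (\<lambda>_. 0) k"
      using False by (intro Rop_cong star_CF assms k) (auto simp: dl_def)
    then show ?thesis by simp
  qed
  then show "Rop (star r) v k = 0"
    by (subst Rop_expand[OF order_refl finite_reach]) simp
qed

lemma cone_rels_ker: "CR \<subseteq> ker"
  using pol_rels_ker fun_rels_ker ker_star subsetD[OF pol_rels_CF] subsetD[OF fun_rels_CF]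
  unfolding cone_rels_def Let_def by blast

lemma Idl_ker: "f \<in> P.I \<Longrightarrow> f \<in> ker"
proof (induction f rule: P.Idl_induct)
  case (rel r)
  then show ?case using cone_rels_ker by blast
next
  case (right a f)
  \<comment> \<open>As products are reversed, \<open>Rop f v\<close> is the inner function. It is
    known to vanish on \<open>Bh\<close> only, and \<open>Rop_cong\<close> then allows replacing it
    by 0.\<close>
  have "Rop a (Rop f v) i = 0" if "i \<in> Bh" for v i
    using Rop_cong[OF right(1) that, of "Rop f v" "\<lambda>_. 0"] right(3) by (simp add: ker_def)
  then show ?case by (simp add: ker_def Rop_mult)
qed (simp_all add: ker_def Rop_simps)

subsection \<open>The automorphism\<close>

abbreviation "gam \<equiv> lift_hom (cgen_gamma q)"

text \<open>\<open>gam\<close> is implemented by the index shift \<open>U\<close>, which raises the level by one and fixes the total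
  sum.\<close>

definition U :: "(nat \<Rightarrow> int) \<Rightarrow> nat \<Rightarrow> int" where "U i = i(1 := i 1 + 1, N := i N - 1)"
definition V :: "(nat \<Rightarrow> int) \<Rightarrow> nat \<Rightarrow> int" where "V i = i(1 := i 1 - 1, N := i N + 1)"

lemma N_ne: "N \<noteq> 1" "1 \<noteq> N" "N \<noteq> Suc 0" "Suc 0 \<noteq> N" "1 < N" "n < N" "1 \<le> N"
  using n m by auto

lemma UV [simp]: "U (V i) = i" "V (U i) = i"
  using N_ne by (auto simp: U_def V_def fun_eq_iff)

lemma U_Bh [simp]: "U i \<in> Bh \<longleftrightarrow> i \<in> Bh" and V_Bh [simp]: "V i \<in> Bh \<longleftrightarrow> i \<in> Bh"
  using n m by (auto simp: U_def V_def Bh_def)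

lemma sft_U: "sft x (U i) = U (sft x i)"
  using N_ne by (cases x) (auto simp: U_def fun_eq_iff)

text \<open>Every partial sum that counts coordinate 1 but not \<open>N\<close> rises by one; for
  \<open>j\<close> = 1 the factor comes from the coordinate itself.\<close>

lemma C_U: "1 \<le> j \<Longrightarrow> j \<le> N \<Longrightarrow> C j (U i) = q * C j i"
  using N_ne by (auto simp: C_def U_def idx_sum_upd powi_add powi_diff)

lemma idx_sum_U: "2 \<le> j \<Longrightarrow> j \<le> N \<Longrightarrow> idx_sum j (U i) = idx_sum j i + 1"
  using N_ne by (auto simp: U_def idx_sum_upd)

lemma cf_U:
  "1 \<le> j \<Longrightarrow> j \<le> N \<Longrightarrow> cf (Tg j) (U i) = of_real q * cf (Tg j) i"
  "1 \<le> j \<Longrightarrow> j \<le> N \<Longrightarrow> cf (Ts j) (U i) = of_real q * cf (Ts j) i"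
  "cf (Fn g) (U i) = g (idx_sum (n + 1) i + 1)"
proof -
  have "(U i)(j := U i j + 1) = U (i(j := i j + 1))"
    using sft_U[of "Ts j" i] by simp
  then show "1 \<le> j \<Longrightarrow> j \<le> N \<Longrightarrow> cf (Ts j) (U i) = of_real q * cf (Ts j) i"
    by (simp add: C_U)
qed (use n m in \<open>simp_all add: C_U idx_sum_U\<close>)

lemma Rop_gam:
  assumes "f \<in> CF"
  shows "Rop (gam f) v i = Rop f (\<lambda>k. v (V k)) (U i)"
  using assms
proof (induction f arbitrary: v i rule: free_alg_induct)
  case (gen x)
  show ?case
  proof (cases x)
    case (Tg j)
    then show ?thesis
      using gen cf_U(1)[of j i] sft_U[of "Tg j" i] by (simp add: Rop_scal_mult)
  next
    case (Ts j)
    then show ?thesis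
      using gen cf_U(2)[of j i] sft_U[of "Ts j" i] by (simp add: Rop_scal_mult)
  next
    case (Fn g)
    then show ?thesis
      using cf_U(3)[of g i] by simp
  qed
next
  case (mult f g)
  have "Rop (gam f) v = (\<lambda>k. Rop f (\<lambda>k. v (V k)) (U k))"
    using mult(3) by (simp add: fun_eq_iff)
  then show ?case using mult(4) by (simp add: lift_hom_mult Rop_mult)
qed (simp_all add: lift_hom_add Rop_add)

lemma gam_CF: "f \<in> CF \<Longrightarrow> gam f \<in> CF"
proof (rule lift_hom_closed)
  fix x assume "x \<in> CG"
  then show "cgen_gamma q x \<in> CF" by (cases x) simp_all
qed

lemma scal_mult_mult: "scal a * f * (scal b * g) = scal (a * b) * (f * g)"
  by (simp add: scal_central[of b g] scal_central[of b "f * g"] mult.assoc flip: scal_assoc[of a b "f * g"])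

text \<open>All polynomial relations are homogeneous of degree two in the generators.\<close>

lemma gam_pol_rels:
  assumes "r \<in> pol_rels q n m"
  shows "gam r = scal (of_real (q\<^sup>2)) * r"
proof -
  define h where "h f \<longleftrightarrow> gam f = scal (of_real (q\<^sup>2)) * f" for f
  have gg: "h (tt i * tt j)" "h (tt i * ts j)" "h (ts i * tt j)" for i j
    by (simp_all add: h_def lift_hom_mult scal_mult_mult power2_eq_square)
  have ad: "h (f + g)" "h (f - g)" if "h f" "h g" for f g
    using that by (simp_all add: h_def lift_simps algebra_simps)
  have um: "h (- f)" if "h f" for f
    using that by (simp add: h_def lift_simps)
  have sc: "h (scal c * f)" if "h f" for f c
    using that by (simp add: h_def lift_simps scal_assoc mult.commute)
  have su: "h (\<Sum>k\<in>A. F k)" if "\<And>k. k \<in> A \<Longrightarrow> h (F k)" for A :: "nat set" and F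
    using that by (simp add: h_def lift_simps sum_distrib_left)
  have "h r"
    using assms unfolding pol_rels_def
    by (auto simp: mult.assoc intro!: ad um sc su gg)
  then show ?thesis by (simp add: h_def)
qed

lemma mult_scal_left: "f * (scal c * g) = scal c * (f * g)"
  by (metis mult.assoc scal_central)

lemma fun_rels_Idl:
  "fn (\<lambda>l. g l + h l) - (fn g + fn h) \<in> P.I"
  "fn (\<lambda>l. c * g l) - scal c * fn g \<in> P.I"
  "fn (\<lambda>l. g l * h l) - fn g * fn h \<in> P.I"
  "fn (\<lambda>l. 1) - 1 \<in> P.I"
  "fn (\<lambda>l. of_real (q powi (2 * l))) - cone_xi n m (n + 1) \<in> P.I"
  "1 \<le> j \<Longrightarrow> j \<le> n \<Longrightarrow> tt j * fn g - fn (\<lambda>l. g (l + 1)) * tt j \<in> P.I"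
  "1 \<le> j \<Longrightarrow> j \<le> n \<Longrightarrow> ts j * fn g - fn (\<lambda>l. g (l - 1)) * ts j \<in> P.I"
  "n < j \<Longrightarrow> j \<le> N \<Longrightarrow> tt j * fn g - fn g * tt j \<in> P.I"
  "n < j \<Longrightarrow> j \<le> N \<Longrightarrow> ts j * fn g - fn g * ts j \<in> P.I"
  by (rule P.Idl_rel; unfold cone_rels_def fun_rels_def Let_def; blast)+

lemma gam_fun_rels:
  assumes "r \<in> fun_rels q n m"
  shows "gam r \<in> P.I"
proof -
  have a: "gam (fn (\<lambda>l. g l + h l) - (fn g + fn h)) \<in> P.I"
     "gam (fn (\<lambda>l. c * g l) - scal c * fn g) \<in> P.I"
     "gam (fn (\<lambda>l. g l * h l) - fn g * fn h) \<in> P.I" "gam (fn (\<lambda>l. 1) - 1) \<in> P.I" for g h c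
    using fun_rels_Idl(1)[of "\<lambda>l. g (l + 1)" "\<lambda>l. h (l + 1)"]
      fun_rels_Idl(3)[of "\<lambda>l. g (l + 1)" "\<lambda>l. h (l + 1)"] fun_rels_Idl(4) fun_rels_Idl(2)[of c "\<lambda>l. g (l + 1)"]
    by (simp_all add: lift_simps)
  have sc: "scal (of_real q) * f * g - h * (scal (of_real q) * k) \<in> P.I" if "f * g - h * k \<in> P.I" for f g h k
    using P.Idl_mult(1)[OF that, of "scal (of_real q)"]
    by (simp add: mult_scal_left mult.assoc right_diff_distrib)
  have t: "gam (tt j * fn g - fn (\<lambda>l. g (l + 1)) * tt j) \<in> P.I"
     "gam (ts j * fn g - fn (\<lambda>l. g (l - 1)) * ts j) \<in> P.I" if "1 \<le> j" "j \<le> n" for j g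
    using sc[OF fun_rels_Idl(6)[OF that, of "\<lambda>l. g (l + 1)"]] sc[OF fun_rels_Idl(7)[OF that, of "\<lambda>l. g (l + 1)"]]
    by (simp_all add: lift_simps)
  have t': "gam (tt j * fn g - fn g * tt j) \<in> P.I" "gam (ts j * fn g - fn g * ts j) \<in> P.I"
    if "n < j" "j \<le> N" for j g
    using sc[OF fun_rels_Idl(8)[OF that, of "\<lambda>l. g (l + 1)"]] sc[OF fun_rels_Idl(9)[OF that, of "\<lambda>l. g (l + 1)"]]
    by (simp_all add: lift_simps)
  have xi: "gam (fn (\<lambda>l. of_real (q powi (2 * l))) - cone_xi n m (n + 1)) \<in> P.I"
  proof -
    let ?g = "\<lambda>l. of_real (q powi (2 * l)) :: complex"
    have "gam (tt k * ts k) = scal (of_real (q\<^sup>2)) * (tt k * ts k)" for k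
      by (simp add: lift_hom_mult scal_mult_mult power2_eq_square)
    then have "gam (cone_xi n m (n + 1)) = scal (of_real (q\<^sup>2)) * cone_xi n m (n + 1)"
      by (simp add: cone_xi_def lift_simps sum_distrib_left)
    moreover have "(\<lambda>l. ?g (l + 1)) = (\<lambda>l. of_real (q\<^sup>2) * ?g l)"
      by (simp add: fun_eq_iff powi_add distrib_left mult.commute)
    \<comment> \<open>The map multiplies both parts of the relation by q^2, but in the first part
      the factor sits inside \<open>fn\<close>; the first summand takes it out.\<close>
    ultimately have "gam (fn ?g - cone_xi n m (n + 1))
      = (fn (\<lambda>l. of_real (q\<^sup>2) * ?g l) - scal (of_real (q\<^sup>2)) * fn ?g)
        + scal (of_real (q\<^sup>2)) * (fn ?g - cone_xi n m (n + 1))"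
      by (simp add: lift_simps algebra_simps)
    also have "\<dots> \<in> P.I"
      by (intro P.Idl_add P.Idl_mult fun_rels_Idl free_alg_scal)
    finally show ?thesis .
  qed
  show ?thesis
    using assms a t t' xi unfolding fun_rels_def by blast
qed

text \<open>Transfers the compatibility of \<open>gam\<close> with the relations to their adjoints.
  It rests on q being real.\<close>

lemma gam_star: "f \<in> CF \<Longrightarrow> gam (star f) = star (gam f)"
proof (induction f rule: free_alg_induct)
  case (gen x)
  then show ?case by (cases x) (simp_all add: lift_simps scal_central)
qed (simp_all add: lift_simps)

lemma gam_Idl: "f \<in> P.I \<Longrightarrow> gam f \<in> P.I"
proof (rule P.lift_hom_Idl)
  fix x assume "x \<in> CG"
  then show "cgen_gamma q x \<in> CF" by (cases x) simp_all
next
  fix r assume r: "r \<in> CR"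
  have *: "gam r \<in> P.I" if "r \<in> pol_rels q n m \<union> fun_rels q n m" for r
    using that
  proof
    assume r: "r \<in> pol_rels q n m"
    then have "r \<in> P.I" by (intro P.Idl_rel) (simp add: cone_rels_def Let_def)
    then show ?thesis by (simp add: gam_pol_rels[OF r] P.Idl_mult)
  qed (rule gam_fun_rels)
  from r obtain r' where r': "r' \<in> pol_rels q n m \<union> fun_rels q n m" "r = r' \<or> r = star r'"
    by (auto simp: cone_rels_def Let_def)
  have "r' \<in> CF" using r'(1) pol_rels_CF fun_rels_CF by blast
  then show "gam r \<in> P.I"
    using r'(2) *[OF r'(1)] by (auto simp: gam_star star_Idl)
qed

lemma cone_gamma_cls: "f \<in> CF \<Longrightarrow> cone_gamma q n m (cc f) = cc (gam f)"
  unfolding cone_gamma_def cone_cls_eq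
  by (rule P.cls_map_cls) (simp_all add: gam_CF gam_Idl lift_simps)

subsection \<open>The representation of the quotient\<close>

text \<open>The chosen representative is immaterial by \<open>RC_cls\<close>. The value 0 outside
  \<open>Bh\<close> makes results equal as functions, so that identities like \<open>RC_mult\<close>
  can be used at every index.\<close>

definition RC :: "cgen fa set \<Rightarrow> ((nat \<Rightarrow> int) \<Rightarrow> complex) \<Rightarrow> (nat \<Rightarrow> int) \<Rightarrow> complex" where
  "RC A v i = (if i \<in> Bh then Rop (SOME f. f \<in> CF \<and> A = cc f) v i else 0)"

lemma RC_cls:
  assumes "f \<in> CF"
  shows "RC (cc f) v i = (if i \<in> Bh then Rop f v i else 0)"
proof -
  define g where "g = (SOME g. g \<in> CF \<and> cc f = cc g)"
  have "g \<in> CF \<and> cc f = cc g"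
    unfolding g_def by (rule someI[of _ f]) (use assms in simp)
  then have "f - g \<in> ker"
    using assms P.cls_eq_iff[of f g] by (intro Idl_ker) (simp add: cone_cls_eq)
  then show ?thesis
    by (auto simp: RC_def ker_def Rop_diff simp flip: g_def)
qed

lemma cone_carrier: "A \<in> carrier CA \<longleftrightarrow> (\<exists>f\<in>CF. A = cc f)"
  by (auto simp: cone_alg_eq cone_cls_eq P.carrier_presented)

lemma cc_closed [simp]: "f \<in> CF \<Longrightarrow> cc f \<in> carrier CA"
  by (auto simp: cone_carrier)

lemma cc_add: "f \<in> CF \<Longrightarrow> g \<in> CF \<Longrightarrow> cc f \<oplus>\<^bsub>CA\<^esub> cc g = cc (f + g)"
  and cc_mult: "f \<in> CF \<Longrightarrow> g \<in> CF \<Longrightarrow> cc f \<otimes>\<^bsub>CA\<^esub> cc g = cc (f * g)"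
  by (simp_all add: cone_alg_eq cone_cls_eq P.cls_add P.cls_mult)

lemma cone_closed [simp]:
  "A \<in> carrier CA \<Longrightarrow> B \<in> carrier CA \<Longrightarrow> A \<oplus>\<^bsub>CA\<^esub> B \<in> carrier CA"
  "A \<in> carrier CA \<Longrightarrow> B \<in> carrier CA \<Longrightarrow> A \<otimes>\<^bsub>CA\<^esub> B \<in> carrier CA"
  "A \<in> carrier CA \<Longrightarrow> cone_scale q n m c A \<in> carrier CA"
  "A \<in> carrier CA \<Longrightarrow> cone_star q n m A \<in> carrier CA"
  by (auto simp: cone_carrier cc_add cc_mult cone_scale_cls cone_star_cls star_CF)

lemma RC_off: "i \<notin> Bh \<Longrightarrow> RC A v i = 0"
  by (simp add: RC_def)

lemma RC_vadd: "RC A (\<lambda>k. u k + v k) i = RC A u i + RC A v i"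
  and RC_vscale: "RC A (\<lambda>k. c * v k) i = c * RC A v i"
  by (simp_all add: RC_def Rop_vadd Rop_vscale)

lemma RC_vdiff: "RC A (\<lambda>k. u k - v k) i = RC A u i - RC A v i"
  using RC_vadd[of A u "\<lambda>k. (-1) * v k" i] by (simp only: RC_vscale) simp

lemma RC_add: "A \<in> carrier CA \<Longrightarrow> B \<in> carrier CA \<Longrightarrow> RC (A \<oplus>\<^bsub>CA\<^esub> B) v i = RC A v i + RC B v i"
  by (auto simp: cone_carrier cc_add RC_cls Rop_add)

lemma RC_scale: "A \<in> carrier CA \<Longrightarrow> RC (cone_scale q n m c A) v i = c * RC A v i"
  by (auto simp: cone_carrier cone_scale_cls RC_cls Rop_scal_mult)

lemma RC_cong: "A \<in> carrier CA \<Longrightarrow> (\<And>k. k \<in> Bh \<Longrightarrow> u k = v k) \<Longrightarrow> RC A u i = RC A v i"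
  by (auto simp: cone_carrier RC_cls) (rule Rop_cong; blast)

lemma RC_mult:
  assumes "A \<in> carrier CA" "B \<in> carrier CA"
  shows "RC (A \<otimes>\<^bsub>CA\<^esub> B) v i = RC B (RC A v) i"
  using assms by (auto simp: cone_carrier cc_mult RC_cls Rop_mult intro!: Rop_cong)

lemma RC_star: "A \<in> carrier CA \<Longrightarrow> i \<in> Bh \<Longrightarrow> k \<in> Bh \<Longrightarrow>
    RC (cone_star q n m A) (dl i) k = cnj (RC A (dl k) i)"
  by (auto simp: cone_carrier cone_star_cls RC_cls star_CF Rop_star)

end

section \<open>The sesquilinear form\<close>

locale cone_form = cone +
  fixes const :: real and l :: int
  assumes const: "0 < const"
begin

subsection \<open>Translations along the additional coordinate\<close>

definition pr :: "(nat \<Rightarrow> int) \<Rightarrow> nat \<Rightarrow> int" where "pr i = i(N := 0)"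
definition tr :: "int \<Rightarrow> (nat \<Rightarrow> int) \<Rightarrow> nat \<Rightarrow> int" where "tr d i = i(N := i N + d)"

lemma pr_tr [simp]: "pr (tr d i) = pr i" "pr (pr i) = pr i"
  by (simp_all add: pr_def tr_def)

lemma pr_id: "i N = 0 \<Longrightarrow> pr i = i"
  by (auto simp: pr_def)

lemma pr_upd: "i N = 0 \<Longrightarrow> j \<noteq> N \<Longrightarrow> pr (i(j := a)) = i(j := a)" "i N = 0 \<Longrightarrow> pr (i(N := a)) = i"
  by (auto simp: pr_def fun_eq_iff)

lemma tr_Bh [simp]: "tr d i \<in> Bh \<longleftrightarrow> i \<in> Bh" and pr_Bh: "i \<in> Bh \<Longrightarrow> pr i \<in> Bh"
  using n m by (auto simp: tr_def pr_def Bh_def)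

lemma idx_sum_N: "k \<le> N \<Longrightarrow> idx_sum k (i(N := a)) = idx_sum k i"
  by (simp add: idx_sum_upd)

lemma C_N: "1 \<le> j \<Longrightarrow> j \<le> N \<Longrightarrow> C j (i(N := a)) = C j i"
  using N_ne by (auto simp: C_def idx_sum_N)

lemma cf_N:
  assumes "x \<in> CG" shows "cf x (i(N := a)) = cf x i"
proof (cases x)
  case (Ts j)
  show ?thesis
  proof (cases "j = N")
    case True
    then show ?thesis using assms C_N[of N i "a + 1"] C_N[of N i "i N + 1"] unfolding Ts by simp
  next
    case False
    then show ?thesis using assms C_N[of j "i(j := i j + 1)" a] unfolding Ts
      by (simp add: fun_upd_twist[of N j])
  qed
qed (use assms n m in \<open>simp_all add: C_N idx_sum_N\<close>)

lemma sft_tr: "sft x (tr d i) = tr d (sft x i)"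
  by (cases x) (auto simp: tr_def fun_eq_iff)

lemma pr_sft: "pr (sft x (pr i)) = pr (sft x i)"
  by (cases x) (auto simp: pr_def fun_eq_iff)

text \<open>The additional coordinate is shifted by the operators but enters none of their
  coefficients.\<close>

lemma Rop_tr:
  assumes "f \<in> CF"
  shows "Rop f v (tr d i) = Rop f (\<lambda>k. v (tr d k)) i"
  using assms
proof (induction f arbitrary: v i rule: free_alg_induct)
  case (gen x)
  then show ?case by (simp add: sft_tr) (simp add: tr_def cf_N)
next
  case (mult f g)
  then show ?case by (simp add: Rop_mult)
qed (simp_all add: Rop_add)

lemma RC_tr: "A \<in> carrier CA \<Longrightarrow> RC A v (tr d i) = RC A (\<lambda>k. v (tr d k)) i"
  by (auto simp: cone_carrier RC_cls Rop_tr)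

subsection \<open>The trace\<close>

definition Q :: "(nat \<Rightarrow> int) \<Rightarrow> real" where
  "Q i = const * q powi (2 * (\<Sum>j\<in>{1..N-1}. int (N - j) * i j))"

text \<open>The given representation is the enlarged one followed by forgetting coordinate
  \<open>N\<close>; this turns the shift by t_N into the identity.\<close>

lemma T0_basis_eq:
  assumes "x \<in> CG" "i N = 0"
  shows "T0_basis q n m x i = Poly_Mapping.single (pr (sft x i)) (cf x i)"
proof (cases x)
  case (Tg j)
  consider "j = 1" | "j \<noteq> 1" "j \<le> n" | "j \<noteq> 1" "n < j" "j < N" | "j = N" "j \<noteq> 1" "n < j"
    using assms(1) N_ne unfolding Tg by fastforce
  then show ?thesis
    using assms N_ne unfolding Tg by cases (auto simp: C_def pr_upd)
next
  case (Ts j)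
  consider "j = 1" | "j \<noteq> 1" "j \<le> n" | "j \<noteq> 1" "n < j" "j < N" | "j = N" "j \<noteq> 1" "n < j"
    using assms(1) N_ne unfolding Ts by fastforce
  then show ?thesis
    using assms N_ne unfolding Ts by cases (auto simp: C_def pr_upd idx_sum_upd)
next
  case (Fn g)
  then show ?thesis using assms by (simp add: pr_id)
qed

lemma T0_gen_single:
  assumes "x \<in> CG" "i N = 0"
  shows "T0_gen q n m x (Poly_Mapping.single i c) = Poly_Mapping.single (pr (sft x i)) (c * cf x i)"
  by (cases "c = 0") (simp_all add: T0_gen_def T0_basis_eq[where x=x and i=i, OF assms])

lemma foldr_T0_gen:
  assumes "set w \<subseteq> CG" "i N = 0"
  shows "foldr (T0_gen q n m) w (Poly_Mapping.single i c) = Poly_Mapping.single (pr (sfw w i)) (c * cfw w i)"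
  using assms
proof (induction w)
  case Nil
  then show ?case by (simp add: pr_id)
next
  case (Cons x w)
  have "pr (sfw w i) N = 0" "cf x (pr (sfw w i)) = cf x (sfw w i)"
    using Cons.prems cf_N[of x "sfw w i" 0] by (simp_all add: pr_def)
  then show ?case
    using Cons T0_gen_single[of x "pr (sfw w i)" "c * cfw w i"]
    by (simp add: pr_sft mult.assoc)
qed

text \<open>A diagonal entry collects all words that end anywhere above \<open>i\<close>, so the
  test function is the indicator of a fibre of \<open>pr\<close>.\<close>

lemma lookup_T0:
  assumes "f \<in> CF" "i N = 0"
  shows "Poly_Mapping.lookup (T0 q n m f (Poly_Mapping.single i c)) i = c * Rop f (\<lambda>k. dl i (pr k)) i"
proof -
  have "T0 q n m f (Poly_Mapping.single i c) = (\<Sum>w\<in>Poly_Mapping.keys f.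
      Poly_Mapping.single (pr (sfw (letters w) i)) (Poly_Mapping.lookup f w * (c * cfw (letters w) i)))"
    unfolding T0_def
  proof (rule sum.cong[OF refl])
    fix w assume "w \<in> Poly_Mapping.keys f"
    then have "set (letters w) \<subseteq> CG" using assms(1) by (simp add: mem_free_alg)
    then show "Poly_Mapping.map ((*) (Poly_Mapping.lookup f w)) (foldr (T0_gen q n m) (letters w) (Poly_Mapping.single i c)) =
      Poly_Mapping.single (pr (sfw (letters w) i)) (Poly_Mapping.lookup f w * (c * cfw (letters w) i))"
      by (simp add: foldr_T0_gen assms(2))
  qed
  then have "Poly_Mapping.lookup (T0 q n m f (Poly_Mapping.single i c)) i = (\<Sum>w\<in>Poly_Mapping.keys f.
      Poly_Mapping.lookup f w * (c * cfw (letters w) i) * dl i (pr (sfw (letters w) i)))"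
    by (simp add: lookup_sum lookup_single dl_def when_def)
      (intro sum.cong; simp)
  then show ?thesis
    by (simp add: Rop_def sum_distrib_left algebra_simps)
qed

lemma basis_idx_eq: "basis_idx n m = {i\<in>Bh. i N = 0}"
proof -
  have "j \<notin> {1..N-1} \<longleftrightarrow> j \<notin> {1..N} \<or> j = N" for j
    using N_ne by auto
  then show ?thesis
    unfolding basis_idx_def Bh_def by blast
qed

lemma trace_TQ_eq:
  assumes "f \<in> CF"
  shows "trace_TQ q n m const f = infsum (\<lambda>i. of_real (Q i) * Rop f (\<lambda>k. dl i (pr k)) i) {i\<in>Bh. i N = 0}"
  unfolding trace_TQ_def basis_idx_eq
  by (rule infsum_cong) (simp add: Q0_basis_def lookup_T0 assms Q_def)

text \<open>Elements of the ideal act as 0 on \<open>Bh\<close>, hence the trace takes a single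
  value on a coset.\<close>

lemma nu0_cls:
  assumes "f \<in> CF"
  shows "nu0 q n m const (cc f) = trace_TQ q n m const f"
proof -
  have "trace_TQ q n m const g = trace_TQ q n m const f" if g: "g \<in> cc f" for g
  proof -
    have g': "g \<in> CF" "g - f \<in> ker"
      using g assms Idl_ker by (auto simp: cone_cls_eq P.mem_cls)
    show ?thesis
      unfolding trace_TQ_eq[OF assms] trace_TQ_eq[OF g'(1)]
      by (rule infsum_cong) (use g'(2) in \<open>simp add: ker_def Rop_diff\<close>)
  qed
  then have "trace_TQ q n m const ` cc f = (\<lambda>_. trace_TQ q n m const f) ` cc f"
    by (rule image_cong[OF refl])
  also have "\<dots> = {trace_TQ q n m const f}"
    using P.self_mem_cls[OF assms] by (simp only: image_constant cone_cls_eq)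
  finally show ?thesis by (simp add: nu0_def)
qed

text \<open>The factor \<open>fn (chi l)\<close> stands rightmost, so it acts first and restricts
  the trace to level \<open>l\<close>.\<close>

lemma b_form_eq:
  assumes "A \<in> carrier CA" "B \<in> carrier CA"
  shows "b_form q n m const l A B =
    infsum (\<lambda>i. of_real (Q i) * RC A (RC (cone_star q n m B) (\<lambda>k. dl i (pr k))) i)
      {i\<in>Bh. i N = 0 \<and> idx_sum (n + 1) i = l}"
proof -
  from assms obtain f g where f: "f \<in> CF" "A = cc f" and g: "g \<in> CF" "B = cc g"
    by (auto simp: cone_carrier)
  have "b_form q n m const l A B = trace_TQ q n m const (star g * f * fn (chi l))"
    unfolding b_form_def b_int_def f(2) g(2) using f(1) g(1)
    by (simp add: cone_star_cls cc_mult star_CF nu0_cls)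
  also have "\<dots> = infsum (\<lambda>i. of_real (Q i) * Rop (star g * f * fn (chi l)) (\<lambda>k. dl i (pr k)) i) {i\<in>Bh. i N = 0}"
    using f(1) g(1) by (intro trace_TQ_eq) (simp add: star_CF)
  also have "\<dots> = infsum (\<lambda>i. of_real (Q i) * RC A (RC (cone_star q n m B) (\<lambda>k. dl i (pr k))) i)
      {i\<in>Bh. i N = 0 \<and> idx_sum (n + 1) i = l}"
  proof (rule infsum_cong_neutral)
    fix i assume "i \<in> {i\<in>Bh. i N = 0} \<inter> {i\<in>Bh. i N = 0 \<and> idx_sum (n + 1) i = l}"
    moreover have "Rop f (Rop (star g) v) i = RC A (RC (cone_star q n m B) v) i" if "i \<in> Bh" for v
      using that unfolding f(2) g(2) RC_cls[OF f(1)] cone_star_cls[OF g(1)] RC_cls[OF star_CF[OF g(1)]]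
      by (simp, intro Rop_cong f(1)) simp_all
    ultimately show "of_real (Q i) * Rop (star g * f * fn (chi l)) (\<lambda>k. dl i (pr k)) i =
      of_real (Q i) * RC A (RC (cone_star q n m B) (\<lambda>k. dl i (pr k))) i"
      by (simp add: Rop_mult chi_def)
  qed (auto simp: Rop_mult chi_def)
  finally show ?thesis .
qed

subsection \<open>Elements of degree zero\<close>

definition tot :: "(nat \<Rightarrow> int) \<Rightarrow> int" where "tot = idx_sum (N + 1)"

text \<open>Degree zero, formulated as commutation with multiplication by functions of the total. By
  \<open>D0_dl\<close> and \<open>D0_I\<close> this amounts to the vanishing of matrix entries
  between different totals.\<close>

definition D0 :: "cgen fa set \<Rightarrow> bool" where
  "D0 A \<longleftrightarrow> (\<forall>v \<tau>. \<forall>i\<in>Bh. RC A (\<lambda>k. \<tau> (tot k) * v k) i = \<tau> (tot i) * RC A v i)"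

lemma D0_D: "D0 A \<Longrightarrow> i \<in> Bh \<Longrightarrow> RC A (\<lambda>k. \<tau> (tot k) * v k) i = \<tau> (tot i) * RC A v i"
  unfolding D0_def by blast

definition X :: "(nat \<Rightarrow> int) set" where
  "X = {i\<in>Bh. tot i = 0 \<and> idx_sum (n + 1) i = l}"

text \<open>Chosen so that \<open>RC A (row B i) i\<close> is the inner product of A e(i) and B
  e(i), a finite sum.\<close>

definition row :: "cgen fa set \<Rightarrow> (nat \<Rightarrow> int) \<Rightarrow> (nat \<Rightarrow> int) \<Rightarrow> complex" where
  "row A i = (\<lambda>k. cnj (RC A (dl k) i))"

lemma RC_expand:
  assumes "A \<in> carrier CA"
  obtains F where "finite F" "F \<subseteq> Bh" "\<And>v. RC A v i = (\<Sum>k\<in>F. RC A (dl k) i * v k)"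
proof -
  from assms obtain f where f: "f \<in> CF" "A = cc f" by (auto simp: cone_carrier)
  show thesis
  proof (cases "i \<in> Bh")
    case False
    then show thesis using that[of "{}"] by (simp add: RC_off)
  next
    case True
    have 0: "RC A (dl k) i = 0" if "k \<notin> Bh" for k
    proof -
      have "RC A (dl k) i = RC A (\<lambda>_. 0 * 0) i"
        using that by (intro RC_cong assms) (auto simp: dl_def)
      then show ?thesis by (simp only: RC_vscale) simp
    qed
    have *: "RC A v i = (\<Sum>k\<in>reach f i \<inter> Bh. RC A (dl k) i * v k)" for v
    proof -
      have "RC A v i = (\<Sum>k\<in>reach f i. RC A (dl k) i * v k)"
        using True Rop_expand[OF order_refl finite_reach, of f v i] by (simp add: f RC_cls)
      also have "\<dots> = (\<Sum>k\<in>reach f i \<inter> Bh. RC A (dl k) i * v k)"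
        by (rule sum.mono_neutral_right) (auto simp: 0)
      finally show ?thesis .
    qed
    show thesis
      by (rule that[OF _ _ *]) simp_all
  qed
qed

lemma D0_dl:
  assumes "D0 A" "A \<in> carrier CA" "i \<in> Bh" "tot k \<noteq> tot i"
  shows "RC A (dl k) i = 0"
proof -
  have "RC A (dl k) i = dl (tot i) (tot i) * RC A (dl k) i" by simp
  also have "\<dots> = RC A (\<lambda>j. dl (tot i) (tot j) * dl k j) i"
    by (rule D0_D[OF assms(1,3), symmetric])
  also have "\<dots> = RC A (\<lambda>j. 0 * 0) i"
    using assms(4) by (intro RC_cong assms) (auto simp: dl_def)
  finally show ?thesis by (simp only: RC_vscale) simp
qed

lemma D0_I:
  assumes "A \<in> carrier CA" "\<And>i k. i \<in> Bh \<Longrightarrow> k \<in> Bh \<Longrightarrow> tot k \<noteq> tot i \<Longrightarrow> RC A (dl k) i = 0"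
  shows "D0 A"
  unfolding D0_def
proof safe
  fix v :: "(nat \<Rightarrow> int) \<Rightarrow> complex" and \<tau> i assume i: "i \<in> Bh"
  obtain F where F: "finite F" "F \<subseteq> Bh" "\<And>v. RC A v i = (\<Sum>k\<in>F. RC A (dl k) i * v k)"
    using RC_expand[OF assms(1)] by metis
  have "(\<Sum>k\<in>F. RC A (dl k) i * (\<tau> (tot k) * v k)) = (\<Sum>k\<in>F. \<tau> (tot i) * (RC A (dl k) i * v k))"
  proof (rule sum.cong[OF refl])
    fix k assume "k \<in> F"
    then show "RC A (dl k) i * (\<tau> (tot k) * v k) = \<tau> (tot i) * (RC A (dl k) i * v k)"
      using assms(2)[of i k] i F(2) by (cases "tot k = tot i") auto
  qed
  then show "RC A (\<lambda>k. \<tau> (tot k) * v k) i = \<tau> (tot i) * RC A v i"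
    by (simp only: F(3)[of "\<lambda>k. \<tau> (tot k) * v k"] F(3)[of v] sum_distrib_left)
qed

lemma D0_star:
  assumes "D0 A" "A \<in> carrier CA"
  shows "D0 (cone_star q n m A)"
  by (rule D0_I) (use assms D0_dl[OF assms] in \<open>auto simp: RC_star\<close>)

lemma tot_tr: "tot (tr d i) = tot i + d"
  using N_ne by (simp add: tot_def tr_def idx_sum_upd)

lemma idx_sum_tr: "k \<le> N \<Longrightarrow> idx_sum k (tr d i) = idx_sum k i"
  by (simp add: tr_def idx_sum_upd)

lemma Q_tr: "Q (tr d i) = Q i"
proof -
  have "(\<Sum>j\<in>{1..N-1}. int (N - j) * tr d i j) = (\<Sum>j\<in>{1..N-1}. int (N - j) * i j)"
    using N_ne by (intro sum.cong) (auto simp: tr_def)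
  then show ?thesis by (simp add: Q_def)
qed

definition Phi :: "cgen fa set \<Rightarrow> cgen fa set \<Rightarrow> complex" where
  "Phi A B = infsum (\<lambda>i. of_real (Q i) * RC A (row B i) i) X"

text \<open>Each index with last coordinate 0 has exactly one translate of total 0. Passing to it
  changes nothing by \<open>RC_tr\<close>, and degree zero reduces the fibre of \<open>pr\<close> to
  this single point.\<close>

lemma b_form_Phi:
  assumes A: "A \<in> carrier CA" "D0 A" and B: "B \<in> carrier CA" "D0 B"
  shows "b_form q n m const l A B = Phi A B"
proof -
  let ?Y = "{i\<in>Bh. i N = 0 \<and> idx_sum (n + 1) i = l}"
  have "RC A (RC (cone_star q n m B) (\<lambda>k. dl i (pr k))) i = RC A (row B (tr (- tot i) i)) (tr (- tot i) i)"
    if i: "i \<in> Bh" "i N = 0" for i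
  proof -
    define h where "h = tr (- tot i) i"
    let ?w = "\<lambda>k. dl i (pr k)" and ?S = "cone_star q n m B"
    have h: "h \<in> Bh" "tot h = 0" "pr h = i"
      using i by (simp_all add: h_def tot_tr pr_id)
    have S: "?S \<in> carrier CA" "D0 ?S" using B D0_star by simp_all
    have "RC A (RC ?S ?w) h = RC A (\<lambda>k. RC ?S ?w (tr (- tot i) k)) i"
      unfolding h_def by (rule RC_tr[OF A(1)])
    also have "\<dots> = RC A (RC ?S ?w) i"
      using RC_tr[OF S(1), of ?w] by simp
    finally have "RC A (RC ?S ?w) i = RC A (RC ?S ?w) h" ..
    also have "\<dots> = dl 0 (tot h) * RC A (RC ?S ?w) h"
      using h by simp
    also have "\<dots> = RC A (\<lambda>k. dl 0 (tot k) * RC ?S ?w k) h"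
      by (rule D0_D[OF A(2) h(1), symmetric])
    also have "\<dots> = RC A (row B h) h"
    proof (rule RC_cong[OF A(1)])
      fix k assume k: "k \<in> Bh"
      have "dl 0 (tot k) * RC ?S ?w k = RC ?S (\<lambda>j. dl 0 (tot j) * ?w j) k"
        by (rule D0_D[OF S(2) k, symmetric])
      \<comment> \<open>An index is determined by its projection together with its total.\<close>
      also have "(\<lambda>j. dl 0 (tot j) * ?w j) = dl h"
      proof
        fix j
        have "j = h" if "tot j = 0" "pr j = i"
        proof -
          have *: "j x = h x" if "x \<noteq> N" for x
            using fun_cong[OF trans[OF \<open>pr j = i\<close> \<open>pr h = i\<close>[symmetric]], of x] that by (simp add: pr_def)
          have "idx_sum N j = idx_sum N h"
            unfolding idx_sum_def by (intro sum.cong) (auto simp: *)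
          moreover have "idx_sum (N + 1) j = idx_sum (N + 1) h"
            using that h by (simp add: tot_def)
          ultimately have "j N = h N"
            using idx_sum_Suc[OF N_ne(7), of j] idx_sum_Suc[OF N_ne(7), of h] by linarith
          show ?thesis
          proof
            fix x show "j x = h x"
              using * \<open>j N = h N\<close> by (cases "x = N") simp_all
          qed
        qed
        then have "tot j = 0 \<and> pr j = i \<longleftrightarrow> j = h"
          using h by blast
        moreover have "dl 0 (tot j) * ?w j = (if tot j = 0 \<and> pr j = i then 1 else 0)"
          by (simp add: dl_def)
        ultimately show "dl 0 (tot j) * ?w j = dl h j"
          by (simp only: dl_def)
      qed
      finally show "dl 0 (tot k) * RC ?S ?w k = row B h k"
        using RC_star[OF B(1) h(1) k] by (simp add: row_def)
    qed
    finally show ?thesis by (simp add: h_def)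
  qed
  then have "b_form q n m const l A B =
    infsum (\<lambda>i. of_real (Q i) * RC A (row B (tr (- tot i) i)) (tr (- tot i) i)) ?Y"
    unfolding b_form_eq[OF A(1) B(1)] by (intro infsum_cong) auto
  also have "\<dots> = Phi A B"
    unfolding Phi_def
  proof (rule infsum_reindex_bij_witness[where i = pr and j = "\<lambda>i. tr (- tot i) i"])
    fix i assume "i \<in> X"
    then have i: "i \<in> Bh" "tot i = 0" "idx_sum (n + 1) i = l" by (auto simp: X_def)
    have pri: "pr i = tr (- i N) i" by (simp add: pr_def tr_def)
    show "tr (- tot (pr i)) (pr i) = i"
      unfolding pri by (simp add: tot_tr i) (simp add: tr_def)
    show "pr i \<in> ?Y"
      using i N_ne m by (simp add: pr_Bh) (simp add: pri idx_sum_tr, simp add: tr_def)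
  next
    fix i assume "i \<in> ?Y"
    then show "pr (tr (- tot i) i) = i" "tr (- tot i) i \<in> X"
      using m by (auto simp: X_def tot_tr idx_sum_tr pr_id)
  qed (simp add: Q_tr)
  finally show ?thesis .
qed

end

section \<open>Growth estimates and absolute convergence\<close>

lemma summable_on_powi_int:
  fixes q :: real
  assumes "0 < q" "q < 1"
  shows "(\<lambda>z::int. q powi \<bar>z\<bar>) summable_on UNIV"
proof -
  have s: "(\<lambda>n. q ^ n) summable_on (UNIV :: nat set)"
    by (rule norm_summable_imp_summable_on) (use assms in \<open>simp add: summable_geometric\<close>)
  have "(\<lambda>z::int. q powi \<bar>z\<bar>) summable_on range int"
    using s by (subst summable_on_reindex) (auto simp: comp_def)
  moreover have "(\<lambda>z::int. q powi \<bar>z\<bar>) summable_on range (\<lambda>n. - int (Suc n))"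
  proof (subst summable_on_reindex)
    have "(\<lambda>n. q * q ^ n) summable_on (UNIV :: nat set)"
      using s by (rule summable_on_cmult_right)
    moreover have "q powi \<bar>- int (Suc n)\<bar> = q * q ^ n" for n
      by (simp only: abs_minus_cancel abs_of_nat power_int_of_nat power_Suc)
    ultimately show "((\<lambda>z::int. q powi \<bar>z\<bar>) \<circ> (\<lambda>n. - int (Suc n))) summable_on UNIV"
      by (simp only: comp_def)
  qed (auto intro!: injI)
  ultimately have "(\<lambda>z::int. q powi \<bar>z\<bar>) summable_on (range int \<union> range (\<lambda>n. - int (Suc n)))"
    by (rule summable_on_Un_disjoint) auto
  moreover have "range int \<union> range (\<lambda>n. - int (Suc n)) = UNIV"
  proof -
    have "z \<in> range int \<union> range (\<lambda>n. - int (Suc n))" for z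
      by (cases z rule: int_cases) auto
    then show ?thesis by blast
  qed
  ultimately show ?thesis by simp
qed

lemma summable_on_powi_PiE:
  fixes q :: real
  assumes "0 < q" "q < 1" "finite A"
  shows "(\<lambda>h. \<Prod>k\<in>A. q powi \<bar>h k\<bar>) summable_on (PiE A (\<lambda>_. UNIV :: int set))"
proof -
  have "Infinite_Sum.abs_summable_on (\<lambda>z::int. q powi \<bar>z\<bar>) UNIV"
    using summable_on_powi_int[OF assms(1,2)] assms by simp
  then have "Infinite_Sum.abs_summable_on (\<lambda>h. \<Prod>k\<in>A. q powi \<bar>h k\<bar>) (PiE A (\<lambda>_. UNIV :: int set))"
    unfolding abs_summable_equivalent
    by (intro abs_summable_on_prod_PiE assms) auto
  then show ?thesis
    by (rule Infinite_Sum.abs_summable_summable)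
qed

context cone
begin

abbreviation "lev \<equiv> idx_sum (n + 1)"

text \<open>Coordinates 1 and \<open>N\<close> are left out because level and total determine them
  from the others.\<close>

definition nrm :: "(nat \<Rightarrow> int) \<Rightarrow> int" where "nrm i = (\<Sum>k\<in>{2..N-1}. \<bar>i k\<bar>)"

lemma nrm_nonneg [simp]: "0 \<le> nrm i"
  by (simp add: nrm_def sum_nonneg)

lemma nrm_upd: "nrm (i(j := a)) \<le> nrm i + \<bar>a - i j\<bar>"
proof -
  have "nrm (i(j := a)) \<le> (\<Sum>k\<in>{2..N-1}. \<bar>i k\<bar> + (if k = j then \<bar>a - i j\<bar> else 0))"
    unfolding nrm_def by (intro sum_mono) auto
  also have "\<dots> \<le> nrm i + \<bar>a - i j\<bar>"
    by (simp add: nrm_def sum.distrib sum.delta)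
  finally show ?thesis .
qed

lemma idx_sum_split: "1 \<le> a \<Longrightarrow> a \<le> b \<Longrightarrow> idx_sum b i = idx_sum a i + (\<Sum>k\<in>{a..<b}. i k)"
  unfolding idx_sum_def by (simp add: sum.atLeastLessThan_concat)

lemma idx_sum_2: "idx_sum 2 i = i 1"
  by (simp add: idx_sum_def numeral_2_eq_2)

text \<open>The sign conditions in \<open>Bh\<close> make the partial sums fall weakly from 2 to n +
  1 and rise from there to \<open>N\<close>, so their minimum is the level.\<close>

lemma idx_sum_bounds:
  assumes i: "i \<in> Bh" and j: "2 \<le> j" "j \<le> N"
  shows "lev i \<le> idx_sum j i" "idx_sum j i \<le> lev i + nrm i"
proof -
  have "lev i \<le> idx_sum j i \<and> idx_sum j i \<le> lev i + nrm i"
  proof (cases "j \<le> n + 1")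
    case True
    have s: "lev i = idx_sum j i + (\<Sum>k\<in>{j..<n+1}. i k)"
      using True j by (intro idx_sum_split) auto
    have "(\<Sum>k\<in>{j..<n+1}. i k) \<le> 0"
      using Bh_D(1)[OF i] j by (intro sum_nonpos) auto
    moreover have "- (\<Sum>k\<in>{j..<n+1}. i k) \<le> (\<Sum>k\<in>{j..<n+1}. \<bar>i k\<bar>)"
      unfolding sum_negf[symmetric] by (intro sum_mono) auto
    moreover have "(\<Sum>k\<in>{j..<n+1}. \<bar>i k\<bar>) \<le> nrm i"
      unfolding nrm_def using j m by (intro sum_mono2) auto
    ultimately show ?thesis using s by linarith
  next
    case False
    have s: "idx_sum j i = lev i + (\<Sum>k\<in>{n+1..<j}. i k)"
      using False j by (intro idx_sum_split) auto
    have "0 \<le> (\<Sum>k\<in>{n+1..<j}. i k)"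
    proof (rule sum_nonneg)
      fix k assume "k \<in> {n+1..<j}"
      then show "0 \<le> i k" using Bh_D(2)[OF i, of k] j by auto
    qed
    moreover have "(\<Sum>k\<in>{n+1..<j}. i k) \<le> (\<Sum>k\<in>{n+1..<j}. \<bar>i k\<bar>)"
      by (intro sum_mono) auto
    moreover have "(\<Sum>k\<in>{n+1..<j}. \<bar>i k\<bar>) \<le> nrm i"
      unfolding nrm_def using j n by (intro sum_mono2) auto
    ultimately show ?thesis using s by linarith
  qed
  then show "lev i \<le> idx_sum j i" "idx_sum j i \<le> lev i + nrm i" by auto
qed

lemma powi_mono: "a \<le> b \<Longrightarrow> q powi b \<le> q powi a"
  using powi_le_1[of "b - a"] by (simp add: powi_diff divide_le_eq)

text \<open>In \<open>C_sq\<close> the two terms have opposite signs. Dropping the negative one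
  gives the bounds by partial sums, and these sums are at least the level.\<close>

lemma C_bound:
  assumes i: "i \<in> Bh" and k: "k \<in> {1..N}"
  shows "\<bar>C k i\<bar> \<le> q powi (lev i - 1)"
    and "n < k \<Longrightarrow> \<bar>C k i\<bar> \<le> q powi idx_sum k i"
    and "k \<le> n \<Longrightarrow> \<bar>C k i\<bar> \<le> q powi (idx_sum (k + 1) i - 1)"
proof -
  have xx: "xx j i \<ge> 0" for j by (simp add: xx_def less_imp_le)
  show hi: "\<bar>C k i\<bar> \<le> q powi idx_sum k i" if "n < k"
  proof -
    have "(C k i)\<^sup>2 \<le> xx k i"
      using C_sq[OF i k] that xx[of "k+1"] by (simp add: eps_def)
    also have "\<dots> \<le> (q powi idx_sum k i)\<^sup>2"
      by (simp add: xx_def powi_double)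
    finally have "\<bar>C k i\<bar> \<le> \<bar>q powi idx_sum k i\<bar>"
      by (simp only: abs_le_square_iff)
    then show ?thesis by simp
  qed
  show lo: "\<bar>C k i\<bar> \<le> q powi (idx_sum (k + 1) i - 1)" if "k \<le> n"
  proof -
    have "(C k i)\<^sup>2 \<le> xx (k + 1) i / q\<^sup>2"
      using C_sq[OF i k] that xx[of k] by (simp add: eps_def)
    also have "\<dots> \<le> (q powi (idx_sum (k + 1) i - 1))\<^sup>2"
      by (simp add: xx_def powi_double powi_diff power_divide)
    finally have "\<bar>C k i\<bar> \<le> \<bar>q powi (idx_sum (k + 1) i - 1)\<bar>"
      by (simp only: abs_le_square_iff)
    then show ?thesis by simp
  qed
  show "\<bar>C k i\<bar> \<le> q powi (lev i - 1)"
  proof (cases "k \<le> n")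
    case True
    have "lev i \<le> idx_sum (k + 1) i"
      using True k m by (intro idx_sum_bounds i) auto
    then have "q powi (idx_sum (k + 1) i - 1) \<le> q powi (lev i - 1)"
      by (intro powi_mono) simp
    with lo[OF True] show ?thesis by linarith
  next
    case False
    have "lev i \<le> idx_sum k i"
      using False k n by (intro idx_sum_bounds i) auto
    then have "q powi (idx_sum k i) \<le> q powi (lev i - 1)"
      by (intro powi_mono) simp
    with hi False show ?thesis by linarith
  qed
qed

lemma C_up_0:
  assumes "i \<in> Bh" "k \<in> {1..N}" "i(k := i k + 1) \<notin> Bh"
  shows "C k (i(k := i k + 1)) = 0"
  using sft_Bh[of "Ts k" i] assms by auto

lemma lev_sft: "\<bar>lev (sft x i) - lev i\<bar> \<le> 1"
  by (cases x) (simp_all add: idx_sum_upd)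

lemma nrm_sft: "nrm (sft x i) \<le> nrm i + 1"
proof (cases x)
  case (Tg j)
  then show ?thesis using nrm_upd[of i j "i j - 1"] by simp
next
  case (Ts j)
  then show ?thesis using nrm_upd[of i j "i j + 1"] by simp
qed simp

lemma cf_bound:
  assumes "x \<in> CG"
  obtains M where "0 \<le> M" "\<And>i. i \<in> Bh \<Longrightarrow> \<bar>lev i\<bar> \<le> r \<Longrightarrow> norm (cf x i) \<le> M"
proof (cases x)
  case (Tg j)
  show thesis
  proof (rule that)
    fix i assume i: "i \<in> Bh" "\<bar>lev i\<bar> \<le> r"
    have "\<bar>C j i\<bar> \<le> q powi (lev i - 1)"
      using assms i by (intro C_bound) (auto simp: Tg)
    also have "\<dots> \<le> q powi (- r - 1)"
      using i by (intro powi_mono) auto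
    finally show "norm (cf x i) \<le> q powi (- r - 1)" by (simp add: Tg)
  qed (simp add: less_imp_le)
next
  case (Ts j)
  show thesis
  proof (rule that)
    fix i assume i: "i \<in> Bh" "\<bar>lev i\<bar> \<le> r"
    let ?k = "i(j := i j + 1)"
    \<comment> \<open>By \<open>lev_sft\<close> the level at the target is at least -r - 1, and
      \<open>C_bound\<close> costs one more.\<close>
    have "\<bar>C j ?k\<bar> \<le> q powi (- r - 2)"
    proof (cases "?k \<in> Bh")
      case True
      have "\<bar>C j ?k\<bar> \<le> q powi (lev ?k - 1)"
        using assms True by (intro C_bound) (auto simp: Ts)
      also have "\<dots> \<le> q powi (- r - 2)"
        using i lev_sft[of x i] unfolding Ts sft.simps by (intro powi_mono) linarith
      finally show ?thesis .
    next
      case False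
      then show ?thesis using C_up_0[of i j] assms i by (simp add: Ts less_imp_le)
    qed
    then show "norm (cf x i) \<le> q powi (- r - 2)" by (simp add: Ts)
  qed (simp add: less_imp_le)
next
  case (Fn g)
  show thesis
  proof (rule that)
    fix i assume i: "i \<in> Bh" "\<bar>lev i\<bar> \<le> r"
    have "norm (g (lev i)) \<le> (\<Sum>s\<in>{-r..r}. norm (g s))"
      using i by (intro member_le_sum) auto
    then show "norm (cf x i) \<le> (\<Sum>s\<in>{-r..r}. norm (g s))" by (simp add: Fn)
  qed (simp add: sum_nonneg)
qed

definition near :: "int \<Rightarrow> (nat \<Rightarrow> int) \<Rightarrow> (nat \<Rightarrow> int) \<Rightarrow> bool" where
  "near L i k \<longleftrightarrow> \<bar>lev k - lev i\<bar> \<le> L \<and> nrm k \<le> nrm i + L"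

lemma near_mono: "near L i k \<Longrightarrow> L \<le> L' \<Longrightarrow> near L' i k"
  by (auto simp: near_def)

lemma near_trans: "near L i j \<Longrightarrow> near L' j k \<Longrightarrow> near (L + L') i k"
  by (auto simp: near_def)

text \<open>On a fixed range of the level the operators are bounded, uniformly in the other
  coordinates.\<close>

definition tame_at :: "cgen fa set \<Rightarrow> int \<Rightarrow> real \<Rightarrow> int \<Rightarrow> bool" where
  "tame_at A r M L \<longleftrightarrow> 0 \<le> M \<and> 0 \<le> L \<and> (\<forall>i\<in>Bh. \<bar>lev i\<bar> \<le> r \<longrightarrow>
     (\<forall>v b. 0 \<le> b \<longrightarrow> (\<forall>k\<in>Bh. near L i k \<longrightarrow> norm (v k) \<le> b) \<longrightarrow> norm (RC A v i) \<le> M * b))"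

lemma tame_atD:
  assumes "tame_at A r M L" "i \<in> Bh" "\<bar>lev i\<bar> \<le> r" "0 \<le> b" "\<And>k. k \<in> Bh \<Longrightarrow> near L i k \<Longrightarrow> norm (v k) \<le> b"
  shows "norm (RC A v i) \<le> M * b"
  using assms unfolding tame_at_def by blast

text \<open>The range \<open>r\<close> is kept free in the induction: in a product the right factor
  acts first and may change the level by L', so the left factor must be controlled on the wider
  range r + L'.\<close>

lemma tame:
  assumes "A \<in> carrier CA"
  shows "\<exists>M L. tame_at A r M L"
proof -
  from assms have "A \<in> carrier P.PA" by (simp add: cone_alg_eq)
  then show ?thesis
  proof (induction A arbitrary: r rule: P.presented_induct)
    case (scal c)
    have "RC (P.cl (scal c)) v i = c * v i" if "i \<in> Bh" for v i
      using that RC_cls[of "scal c" v i] by (simp add: cone_cls_eq)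
    then have "tame_at (P.cl (scal c)) r (norm c) 0"
      by (auto simp: tame_at_def near_def norm_mult intro!: mult_left_mono)
    then show ?case by blast
  next
    case (gen x)
    obtain M where M: "0 \<le> M" "\<And>i. i \<in> Bh \<Longrightarrow> \<bar>lev i\<bar> \<le> r \<Longrightarrow> norm (cf x i) \<le> M"
      using cf_bound[OF gen] by metis
    have "tame_at (P.cl (gen x)) r M 1"
      unfolding tame_at_def
    proof (intro conjI ballI impI allI)
      fix i b and v :: "(nat \<Rightarrow> int) \<Rightarrow> complex" assume i: "i \<in> Bh" "\<bar>lev i\<bar> \<le> r" and b: "(0::real) \<le> b"
        "\<forall>k\<in>Bh. near 1 i k \<longrightarrow> norm (v k) \<le> b"
      have "norm (cf x i * v (sft x i)) \<le> M * b"
      proof (cases "cf x i = 0")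
        case False
        then have "sft x i \<in> Bh" by (intro sft_Bh gen i)
        then have "norm (v (sft x i)) \<le> b"
          using b(2) lev_sft[of x i] nrm_sft[of x i] by (auto simp: near_def)
        then show ?thesis
          unfolding norm_mult using M i b by (intro mult_mono) auto
      qed (use M b in simp)
      then show "norm (RC (P.cl (gen x)) v i) \<le> M * b"
        using i(1) gen RC_cls[of "gen x" v i] by (simp add: cone_cls_eq)
    qed (use M in auto)
    then show ?case by blast
  next
    case (add A B)
    then obtain M L M' L' where t: "tame_at A r M L" "tame_at B r M' L'" by meson
    have "tame_at (A \<oplus>\<^bsub>P.PA\<^esub> B) r (M + M') (max L L')"
      unfolding tame_at_def
    proof (intro conjI ballI impI allI)
      fix i b and v :: "(nat \<Rightarrow> int) \<Rightarrow> complex" assume i: "i \<in> Bh" "\<bar>lev i\<bar> \<le> r" and b: "(0::real) \<le> b"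
        "\<forall>k\<in>Bh. near (max L L') i k \<longrightarrow> norm (v k) \<le> b"
      have "norm (RC A v i) \<le> M * b"
        by (rule tame_atD[OF t(1) i b(1)]) (use b(2) near_mono in force)
      moreover have "norm (RC B v i) \<le> M' * b"
        by (rule tame_atD[OF t(2) i b(1)]) (use b(2) near_mono in force)
      ultimately show "norm (RC (A \<oplus>\<^bsub>P.PA\<^esub> B) v i) \<le> (M + M') * b"
        using norm_triangle_ineq[of "RC A v i" "RC B v i"] add(1,2) RC_add[of A B v i]
        by (simp add: cone_alg_eq distrib_right)
    qed (use t in \<open>auto simp: tame_at_def\<close>)
    then show ?case by blast
  next
    case (mult A B)
    then obtain M' L' where t': "tame_at B r M' L'" by meson
    from mult obtain M L where t: "tame_at A (r + L') M L" by meson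
    have "tame_at (A \<otimes>\<^bsub>P.PA\<^esub> B) r (M' * M) (L' + L)"
      unfolding tame_at_def
    proof (intro conjI ballI impI allI)
      fix i b and v :: "(nat \<Rightarrow> int) \<Rightarrow> complex" assume i: "i \<in> Bh" "\<bar>lev i\<bar> \<le> r" and b: "(0::real) \<le> b"
        "\<forall>k\<in>Bh. near (L' + L) i k \<longrightarrow> norm (v k) \<le> b"
      have "norm (RC A v k) \<le> M * b" if k: "k \<in> Bh" "near L' i k" for k
      proof (rule tame_atD[OF t k(1) _ b(1)])
        show "\<bar>lev k\<bar> \<le> r + L'" using k i by (auto simp: near_def)
        fix j assume "j \<in> Bh" "near L k j"
        then show "norm (v j) \<le> b" using b(2) near_trans[OF k(2)] by blast
      qed
      then have "norm (RC B (RC A v) i) \<le> M' * (M * b)"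
        using t b by (intro tame_atD[OF t' i]) (auto simp: tame_at_def)
      then show "norm (RC (A \<otimes>\<^bsub>P.PA\<^esub> B) v i) \<le> M' * M * b"
        using mult(1,2) RC_mult[of A B v i] by (simp add: cone_alg_eq mult.assoc)
    qed (use t t' in \<open>auto simp: tame_at_def\<close>)
    then show ?case by blast
  qed
qed

end

context cone_form
begin

lemma X_D: "i \<in> X \<Longrightarrow> i \<in> Bh" "i \<in> X \<Longrightarrow> tot i = 0" "i \<in> X \<Longrightarrow> lev i = l"
  by (auto simp: X_def)

lemma Q_pos: "0 < Q i"
  using const by (simp add: Q_def)

text \<open>Eliminating coordinate 1 by means of the level, the exponent of the weight becomes a sum
  over the inner coordinates with factor -(j - 1) for j \<le> n and N - j for j > n. By the sign
  conditions each term is at least the absolute value of the coordinate.\<close>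

lemma Q_bound:
  assumes "i \<in> X"
  shows "Q i \<le> const * q powi (2 * (int (N - 1) * l)) * q powi (2 * nrm i)"
proof -
  have i: "i \<in> Bh" "lev i = l" using assms X_D by auto
  have "lev i = i 1 + (\<Sum>j\<in>{2..<n+1}. i j)"
    using idx_sum_split[of 2 "n+1" i] n by (simp add: idx_sum_2)
  moreover have "(\<Sum>j\<in>{2..<n+1}. i j) = (\<Sum>j\<in>{2..N-1}. if j \<le> n then i j else 0)"
    using m by (intro sum.mono_neutral_cong_left) auto
  ultimately have i1: "i 1 = l - (\<Sum>j\<in>{2..N-1}. if j \<le> n then i j else 0)"
    using i by simp
  have "{1..N-1} = insert 1 {2..N-1}"
    using N_ne by auto
  then have "(\<Sum>j\<in>{1..N-1}. int (N - j) * i j) = int (N - 1) * i 1 + (\<Sum>j\<in>{2..N-1}. int (N - j) * i j)"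
    by simp
  also have "\<dots> = int (N - 1) * l + (\<Sum>j\<in>{2..N-1}. int (N - j) * i j - int (N - 1) * (if j \<le> n then i j else 0))"
    unfolding i1 by (simp add: algebra_simps sum_subtractf sum_distrib_left)
  also have "\<dots> \<ge> int (N - 1) * l + nrm i"
    unfolding nrm_def
  proof (intro add_left_mono sum_mono)
    fix j assume j: "j \<in> {2..N-1}"
    show "\<bar>i j\<bar> \<le> int (N - j) * i j - int (N - 1) * (if j \<le> n then i j else 0)"
    proof (cases "j \<le> n")
      case True
      then have "i j \<le> 0" using Bh_D(1)[OF i(1), of j] j by auto
      moreover have "int (N - j) * i j - int (N - 1) * i j = int (j - 1) * (- i j)"
      proof -
        have "int (N - j) = int N - int j" "int (N - 1) = int N - 1" "int (j - 1) = int j - 1"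
          using j by auto
        moreover have "(a - b) * x - (a - 1) * x = (b - 1) * (- x)" for a b x :: int
          by (simp add: algebra_simps)
        ultimately show ?thesis by metis
      qed
      moreover have "int (j - 1) * (- i j) \<ge> 1 * (- i j)"
        using j \<open>i j \<le> 0\<close> by (intro mult_right_mono) auto
      ultimately show ?thesis using True by simp
    next
      case False
      then have "1 \<le> i j" using Bh_D(2)[OF i(1), of j] j by auto
      moreover have "int (N - j) * i j \<ge> 1 * i j"
        using j \<open>1 \<le> i j\<close> by (intro mult_right_mono) auto
      ultimately show ?thesis using False by simp
    qed
  qed
  finally have "q powi (2 * (\<Sum>j\<in>{1..N-1}. int (N - j) * i j)) \<le> q powi (2 * (int (N - 1) * l + nrm i))"
    by (intro powi_mono) simp
  also have "\<dots> = q powi (2 * (int (N - 1) * l)) * q powi (2 * nrm i)"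
    by (simp add: powi_add distrib_left)
  finally show ?thesis
    using const by (simp add: Q_def mult.assoc)
qed

text \<open>Restriction to the inner coordinates is injective on \<open>X\<close>, which reduces the
  claim to a product of geometric series.\<close>

lemma summable_nrm: "(\<lambda>i. q powi nrm i) summable_on X"
proof -
  let ?h = "\<lambda>i. restrict i {2..N-1}"
  have inj: "inj_on ?h X"
  proof (rule inj_onI)
    fix i j assume ij: "i \<in> X" "j \<in> X" and eq: "?h i = ?h j"
    have mid: "i k = j k" if "2 \<le> k" "k \<le> N - 1" for k
      using fun_cong[OF eq, of k] that by simp
    have "lev i = i 1 + (\<Sum>k\<in>{2..<n+1}. i k)" for i
      using idx_sum_split[of 2 "n+1" i] n by (simp add: idx_sum_2)
    moreover have "(\<Sum>k\<in>{2..<n+1}. i k) = (\<Sum>k\<in>{2..<n+1}. j k)"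
      using m by (intro sum.cong mid) auto
    ultimately have one: "i 1 = j 1"
      using X_D(3)[OF ij(1)] X_D(3)[OF ij(2)] by simp
    have "idx_sum N i = idx_sum N j"
      unfolding idx_sum_def
    proof (rule sum.cong[OF refl])
      fix k assume "k \<in> {1..<N}"
      then show "i k = j k" using mid[of k] one by (cases "k = 1") auto
    qed
    then have "i N = j N"
      using X_D(2)[OF ij(1)] X_D(2)[OF ij(2)] idx_sum_Suc[OF N_ne(7), of i] idx_sum_Suc[OF N_ne(7), of j]
      unfolding tot_def by linarith
    show "i = j"
    proof
      fix k
      consider "k = 1" | "2 \<le> k" "k \<le> N - 1" | "k = N" | "k \<notin> {1..N}"
        by fastforce
      then show "i k = j k"
        using X_D(1)[OF ij(1)] X_D(1)[OF ij(2)] one mid \<open>i N = j N\<close> by cases (auto simp: Bh_def)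
    qed
  qed
  have "(\<lambda>h. \<Prod>k\<in>{2..N-1}. q powi \<bar>h k\<bar>) summable_on ?h ` X"
    by (rule summable_on_subset[OF summable_on_powi_PiE]) (use q in auto)
  then have "((\<lambda>h. \<Prod>k\<in>{2..N-1}. q powi \<bar>h k\<bar>) \<circ> ?h) summable_on X"
    using summable_on_reindex[OF inj] by blast
  moreover have "(\<lambda>h. \<Prod>k\<in>{2..N-1}. q powi \<bar>h k\<bar>) \<circ> ?h = (\<lambda>i. q powi nrm i)"
  proof
    fix i
    have "(\<Prod>k\<in>A. q powi \<bar>i k\<bar>) = q powi (\<Sum>k\<in>A. \<bar>i k\<bar>)" for A :: "nat set"
      by (induction A rule: infinite_finite_induct) (simp_all add: powi_add)
    then show "((\<lambda>h. \<Prod>k\<in>{2..N-1}. q powi \<bar>h k\<bar>) \<circ> ?h) i = q powi nrm i"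
      by (simp add: nrm_def)
  qed
  ultimately show ?thesis by simp
qed

text \<open>Half of the decay of the weight is spent on the integrand, the other half gives
  convergence. The allowed growth is that of \<open>ycoef_bound\<close>.\<close>

lemma summable_Q:
  assumes "\<And>i. i \<in> X \<Longrightarrow> norm (g i) \<le> K * q powi (- nrm i)"
  shows "(\<lambda>i. of_real (Q i) * (g i :: complex)) summable_on X"
proof -
  let ?K = "const * q powi (2 * (int (N - 1) * l))"
  have "(\<lambda>i. norm (of_real (Q i) * (g i :: complex))) summable_on X"
  proof (rule Infinite_Sum.abs_summable_on_comparison_test')
    show "(\<lambda>i. ?K * K * q powi nrm i) summable_on X"
      by (intro summable_on_cmult_right summable_nrm)
    fix i assume i: "i \<in> X"
    have "norm (of_real (Q i) * g i) \<le> (?K * q powi (2 * nrm i)) * (K * q powi (- nrm i))"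
      unfolding norm_mult using Q_bound[OF i] Q_pos[of i] assms[OF i] const
      by (intro mult_mono) auto
    also have "\<dots> = ?K * K * (q powi (2 * nrm i) * q powi (- nrm i))"
      by (simp only: mult_ac)
    also have "q powi (2 * nrm i) * q powi (- nrm i) = q powi (2 * nrm i + - nrm i)"
      by (simp only: powi_add)
    finally show "norm (of_real (Q i) * g i) \<le> ?K * K * q powi nrm i" by simp
  qed
  then show ?thesis by (rule Infinite_Sum.abs_summable_summable)
qed

lemma row_bound:
  assumes "B \<in> carrier CA"
  obtains M where "0 \<le> M" "\<And>i k. i \<in> Bh \<Longrightarrow> \<bar>lev i\<bar> \<le> r \<Longrightarrow> norm (row B i k) \<le> M"
proof -
  obtain M L where t: "tame_at B r M L" using tame[OF assms] by blast
  show thesis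
  proof (rule that)
    fix i k assume "i \<in> Bh" "\<bar>lev i\<bar> \<le> r"
    then have "norm (RC B (dl k) i) \<le> M * 1"
      by (intro tame_atD[OF t]) (auto simp: dl_def)
    then show "norm (row B i k) \<le> M" by (simp add: row_def)
  qed (use t in \<open>simp add: tame_at_def\<close>)
qed

lemma summable_Phi:
  assumes "A \<in> carrier CA" "B \<in> carrier CA"
  shows "(\<lambda>i. of_real (Q i) * RC A (row B i) i) summable_on X"
proof -
  obtain M where M: "0 \<le> M" "\<And>i k. i \<in> Bh \<Longrightarrow> \<bar>lev i\<bar> \<le> \<bar>l\<bar> \<Longrightarrow> norm (row B i k) \<le> M"
    using row_bound[OF assms(2)] by metis
  obtain M' L where t: "tame_at A \<bar>l\<bar> M' L" using tame[OF assms(1)] by blast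
  show ?thesis
  proof (rule summable_Q)
    fix i assume "i \<in> X"
    then have i: "i \<in> Bh" "\<bar>lev i\<bar> \<le> \<bar>l\<bar>" using X_D by auto
    have "norm (RC A (row B i) i) \<le> M' * M"
      by (rule tame_atD[OF t i M(1)]) (use M(2)[OF i] in simp)
    also have "\<dots> \<le> M' * M * q powi (- nrm i)"
      using mult_left_mono[OF powi_ge_1[of "- nrm i"], of "M' * M"] M(1) t
      by (simp add: tame_at_def)
    finally show "norm (RC A (row B i) i) \<le> M' * M * q powi (- nrm i)" .
  qed
qed

subsection \<open>Sesquilinearity, symmetry and positivity\<close>

lemma row_add: "A \<in> carrier CA \<Longrightarrow> B \<in> carrier CA \<Longrightarrow> row (A \<oplus>\<^bsub>CA\<^esub> B) i = (\<lambda>k. row A i k + row B i k)"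
  by (simp add: row_def RC_add)

lemma row_scale: "A \<in> carrier CA \<Longrightarrow> row (cone_scale q n m c A) i = (\<lambda>k. cnj c * row A i k)"
  by (simp add: row_def RC_scale)

lemma Phi_add_left:
  assumes "A \<in> carrier CA" "B \<in> carrier CA" "D \<in> carrier CA"
  shows "Phi (A \<oplus>\<^bsub>CA\<^esub> B) D = Phi A D + Phi B D"
  unfolding Phi_def by (simp add: RC_add assms distrib_left infsum_add summable_Phi)

lemma Phi_add_right:
  assumes "A \<in> carrier CA" "B \<in> carrier CA" "D \<in> carrier CA"
  shows "Phi D (A \<oplus>\<^bsub>CA\<^esub> B) = Phi D A + Phi D B"
  unfolding Phi_def by (simp add: row_add RC_vadd assms distrib_left infsum_add summable_Phi)

lemma Phi_scale_left: "A \<in> carrier CA \<Longrightarrow> Phi (cone_scale q n m c A) D = c * Phi A D"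
  unfolding Phi_def by (simp add: RC_scale mult.left_commute[of _ c] infsum_cmult_right')

lemma Phi_scale_right: "A \<in> carrier CA \<Longrightarrow> Phi D (cone_scale q n m c A) = cnj c * Phi D A"
  unfolding Phi_def by (simp add: row_scale RC_vscale mult.left_commute[of _ "cnj c"] infsum_cmult_right')

text \<open>With a common finite support the inner product can be read in either order; this is what
  \<open>Phi_cnj\<close> needs.\<close>

lemma RC_expand2:
  assumes "A \<in> carrier CA" "B \<in> carrier CA"
  shows "\<exists>F. finite F \<and> (\<forall>v. RC A v i = (\<Sum>k\<in>F. RC A (dl k) i * v k)) \<and>
    (\<forall>v. RC B v i = (\<Sum>k\<in>F. RC B (dl k) i * v k))"
proof -
  obtain F where F: "finite F" "\<And>v. RC A v i = (\<Sum>k\<in>F. RC A (dl k) i * v k)"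
    using RC_expand[OF assms(1)] by metis
  obtain F' where F': "finite F'" "\<And>v. RC B v i = (\<Sum>k\<in>F'. RC B (dl k) i * v k)"
    using RC_expand[OF assms(2)] by metis
  have z: "RC A (dl k) i = 0" if "k \<notin> F" for k
    by (subst F(2), rule sum.neutral) (use that in \<open>auto simp: dl_def\<close>)
  have z': "RC B (dl k) i = 0" if "k \<notin> F'" for k
    by (subst F'(2), rule sum.neutral) (use that in \<open>auto simp: dl_def\<close>)
  have "RC A v i = (\<Sum>k\<in>F \<union> F'. RC A (dl k) i * v k)" for v
    by (subst F(2), rule sum.mono_neutral_left) (use F(1) F'(1) z in auto)
  moreover have "RC B v i = (\<Sum>k\<in>F \<union> F'. RC B (dl k) i * v k)" for v
    by (subst F'(2), rule sum.mono_neutral_left) (use F(1) F'(1) z' in auto)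
  ultimately show ?thesis
    using F(1) F'(1) by blast
qed

lemma Phi_cnj:
  assumes "A \<in> carrier CA" "B \<in> carrier CA"
  shows "Phi A B = cnj (Phi B A)"
proof -
  have *: "RC A (row B i) i = cnj (RC B (row A i) i)" for i
  proof -
    obtain F where F: "finite F" "\<And>v. RC A v i = (\<Sum>k\<in>F. RC A (dl k) i * v k)"
      "\<And>v. RC B v i = (\<Sum>k\<in>F. RC B (dl k) i * v k)"
      using RC_expand2[OF assms, of i] by blast
    show ?thesis
      unfolding F(2)[of "row B i"] F(3)[of "row A i"] by (simp add: row_def mult.commute)
  qed
  show ?thesis
    unfolding Phi_def infsum_cnj[symmetric]
  proof (rule infsum_cong)
    fix i
    show "of_real (Q i) * RC A (row B i) i = cnj (of_real (Q i) * RC B (row A i) i)"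
      by (subst *) simp
  qed
qed

lemma Phi_pos:
  assumes A: "A \<in> carrier CA"
  shows "Phi A A \<in> \<real>" "0 \<le> Re (Phi A A)"
    and "Re (Phi A A) = 0 \<Longrightarrow> i \<in> X \<Longrightarrow> RC A v i = 0"
proof -
  \<comment> \<open>A support is selected for every index at once, because the summand
    \<open>g\<close> below must be a function of the index.\<close>
  define F where "F i = (SOME F. finite F \<and> (\<forall>v. RC A v i = (\<Sum>k\<in>F. RC A (dl k) i * v k)))" for i
  have "\<exists>F. finite F \<and> (\<forall>v. RC A v i = (\<Sum>k\<in>F. RC A (dl k) i * v k))" for i
    using RC_expand2[OF A A, of i] by blast
  then have *: "finite (F i) \<and> (\<forall>v. RC A v i = (\<Sum>k\<in>F i. RC A (dl k) i * v k))" for i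
    unfolding F_def by (rule someI_ex)
  have F: "finite (F i)" "RC A v i = (\<Sum>k\<in>F i. RC A (dl k) i * v k)" for i v
    using * by blast+
  define g where "g i = Q i * (\<Sum>k\<in>F i. (norm (RC A (dl k) i))\<^sup>2)" for i
  have g: "of_real (Q i) * RC A (row A i) i = of_real (g i)" for i
    unfolding g_def F(2)[of "row A i" i] by (simp add: row_def complex_norm_square[symmetric] del: of_real_power)
  have g0: "0 \<le> g i" for i
    using Q_pos[of i] by (simp add: g_def sum_nonneg)
  have "(\<lambda>i. of_real (g i) :: complex) summable_on X"
    using summable_Phi[OF A A] by (simp only: g)
  then have summ: "g summable_on X"
    using summable_on_Re[of "\<lambda>i. of_real (g i)"] by simp
  have Phi: "Phi A A = of_real (infsum g X)"
    unfolding Phi_def g by (rule infsumI) (simp add: has_sum_of_real_iff has_sum_infsum[OF summ])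
  then show "Phi A A \<in> \<real>" by simp
  show "0 \<le> Re (Phi A A)"
    unfolding Phi using g0 by (simp add: infsum_nonneg)
  assume z: "Re (Phi A A) = 0" and i: "i \<in> X"
  have "g i = 0"
    using summ z g0 i unfolding Phi by (intro nonneg_infsum_le_0D[of g X]) auto
  then have z: "\<forall>k\<in>F i. RC A (dl k) i = 0"
    using Q_pos[of i] F(1)[of i] by (simp add: g_def sum_nonneg_eq_0_iff)
  show "RC A v i = 0"
    unfolding F(2)[of v i] by (rule sum.neutral) (use z in simp)
qed

end

section \<open>The action of the quantum group\<close>

context cone
begin

definition sg :: "nat \<Rightarrow> (nat \<Rightarrow> int) \<Rightarrow> nat \<Rightarrow> int" where
  "sg j i = i(j := i j - 1, j + 1 := i (j + 1) + 1)"
definition sgi :: "nat \<Rightarrow> (nat \<Rightarrow> int) \<Rightarrow> nat \<Rightarrow> int" where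
  "sgi j i = i(j := i j + 1, j + 1 := i (j + 1) - 1)"

lemma sg_sgi [simp]: "sg j (sgi j i) = i" "sgi j (sg j i) = i"
  by (auto simp: sg_def sgi_def fun_eq_iff)

text \<open>\<open>ycoef j\<close> is the matrix coefficient of $t_jt_{j+1}^*\xi_{j+1}^{-1}$. The twisted commutator
  with this element implements $E_j$, the twisted commutator with its adjoint implements $F_j$.\<close>

definition ycoef :: "nat \<Rightarrow> (nat \<Rightarrow> int) \<Rightarrow> real" where
  "ycoef j i = C (j + 1) (i(j + 1 := i (j + 1) + 1)) * C j i / xx (j + 1) i"

text \<open>By \<open>kap_sft\<close> a letter x changes this number by q to the power
  \<open>weight j x\<close>. For j = N - 1 that requires a coordinate moved by t_N.\<close>

definition kap :: "nat \<Rightarrow> (nat \<Rightarrow> int) \<Rightarrow> real" where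
  "kap j i = q powi (i (j + 1) - i j)"

text \<open>The transposes of y_j and of its adjoint. The coefficients are real, so the adjoint uses
  the same number read at the other end of the step.\<close>

definition Yop :: "nat \<Rightarrow> ((nat \<Rightarrow> int) \<Rightarrow> complex) \<Rightarrow> (nat \<Rightarrow> int) \<Rightarrow> complex" where
  "Yop j v i = (if i \<in> Bh then of_real (ycoef j i) * v (sg j i) else 0)"
definition Zop :: "nat \<Rightarrow> ((nat \<Rightarrow> int) \<Rightarrow> complex) \<Rightarrow> (nat \<Rightarrow> int) \<Rightarrow> complex" where
  "Zop j v i = (if i \<in> Bh then of_real (ycoef j (sgi j i)) * v (sgi j i) else 0)"

text \<open>The constants are fixed by E_j t_(j+1) = q^(-1/2) t_j and F_j t_j = q^(1/2) t_(j+1). The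
  denominator cancels the factor left by the commutators \<open>bb'\<close> and \<open>aa'\<close>
  below, and the signs are those of \<open>C_sq\<close>.\<close>

definition cE :: "nat \<Rightarrow> real" where
  "cE j = eps (j + 1) * q powr (-1/2) / (1 - 1 / q\<^sup>2)"
definition cF :: "nat \<Rightarrow> real" where
  "cF j = eps j * q powr (3/2) / (1 - 1 / q\<^sup>2)"

lemma kap_pos [simp]: "0 < kap j i" "kap j i \<noteq> 0"
  by (simp_all add: kap_def)

lemma xx_pos: "2 \<le> k \<Longrightarrow> k \<le> N \<Longrightarrow> 0 < xx k i"
  by (simp add: xx_def)

lemma powi_1 [simp]: "q powi (- 1) = 1 / q" "q powi (- 2) = 1 / q\<^sup>2"
  by (simp_all add: power_int_minus field_simps)

lemma q_powr:
  "q powr (-3/2) = q powr (-1/2) / q" "q powr (1/2) = q powr (-1/2) * q"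
  "q powr (3/2) = q powr (-1/2) * q\<^sup>2"
proof -
  have "q powr (-1/2) = q powr (-3/2) * q powr 1" "q powr (1/2) = q powr (-1/2) * q powr 1"
    "q powr (3/2) = q powr (-1/2) * q powr 2"
    unfolding powr_add[symmetric] by simp_all
  then show "q powr (-3/2) = q powr (-1/2) / q" "q powr (1/2) = q powr (-1/2) * q"
    "q powr (3/2) = q powr (-1/2) * q\<^sup>2"
    using q by (simp_all add: powr_numeral)
qed

lemma q_powr': "q powr - (3/2) = q powr - (1/2) / q"
  using q_powr(1) by simp

lemma q2_ne: "1 - 1 / q\<^sup>2 \<noteq> 0"
proof -
  have "q\<^sup>2 < 1" using q abs_square_less_1[of q] by simp
  then have "q\<^sup>2 \<noteq> 1" by linarith
  then show ?thesis by simp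
qed

lemma C_upd2:
  assumes "k \<in> {1..N}" "l \<in> {1..N}" "l \<noteq> k"
  shows "C k (i(l := a, k := b)) = q powi (if l < k then a - i l else 0) * C k (i(k := b))"
  using C_upd[OF assms, of "i(k := b)" a] assms(3) by (simp add: fun_upd_twist)

text \<open>A coordinate before \<open>j\<close> scales both factors \<open>C\<close> by the same
  power of q and the denominator by its square; a coordinate after \<open>j + 1\<close> enters none
  of them.\<close>

lemma ycoef_upd:
  assumes "1 \<le> j" "j < N" "k \<in> {1..N}" "k \<noteq> j" "k \<noteq> j + 1"
  shows "ycoef j (i(k := a)) = ycoef j i"
proof (cases "k < j")
  case True
  have "ycoef j (i(k := a)) = q powi (a - i k) * q powi (a - i k) / q powi (2 * (a - i k)) * ycoef j i"
    using assms True unfolding ycoef_def by (simp add: C_upd C_upd2 xx_upd)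
  moreover have "q powi d * q powi d / q powi (2 * d) = 1" for d
    by (simp add: powi_double power2_eq_square)
  ultimately show ?thesis by (simp only: mult_1)
next
  case False
  then show ?thesis
    using assms unfolding ycoef_def by (simp add: C_upd C_upd2 xx_upd)
qed

lemma C_sg:
  assumes "1 \<le> j" "j < N" "k \<in> {1..N}" "k \<noteq> j" "k \<noteq> j + 1"
  shows "C k (sg j i) = C k i" "C k (sgi j i) = C k i"
  using assms unfolding sg_def sgi_def by (auto simp: C_upd)

lemma lev_sg:
  assumes "1 \<le> j"
  shows "lev (sg j i) = (if j = n then lev i - 1 else lev i)"
    "lev (sgi j i) = (if j = n then lev i + 1 else lev i)"
  using assms by (auto simp: sg_def sgi_def idx_sum_upd)

lemma sg_sft: "sg j (sft x i) = sft x (sg j i)" "sgi j (sft x i) = sft x (sgi j i)"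
  by (cases x; auto simp: sg_def sgi_def fun_eq_iff)+

lemma ycoef_sgi:
  assumes "1 \<le> j" "j < N"
  shows "ycoef j (sgi j i) = C (j + 1) i * C j (i(j := i j + 1)) / (q * xx (j + 1) i)"
  using assms unfolding ycoef_def sgi_def
  by (simp add: C_upd C_upd2 xx_upd power2_eq_square)

text \<open>The shift is made of two generator steps, and \<open>sft_Bh\<close> applies to each of
  them.\<close>

lemma ycoef_0:
  assumes "1 \<le> j" "j < N" "i \<in> Bh" "sg j i \<notin> Bh"
  shows "ycoef j i = 0"
proof (rule ccontr)
  assume "ycoef j i \<noteq> 0"
  then have c: "C (j + 1) (i(j + 1 := i (j + 1) + 1)) \<noteq> 0" "C j i \<noteq> 0"
    by (auto simp: ycoef_def)
  have "sft (Tg j) i \<in> Bh"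
    using assms c by (intro sft_Bh) auto
  then have "i(j := i j - 1) \<in> Bh" by simp
  moreover have "cf (Ts (j + 1)) (i(j := i j - 1)) \<noteq> 0"
    using c assms by (simp add: C_upd2)
  ultimately have "sft (Ts (j + 1)) (i(j := i j - 1)) \<in> Bh"
    using assms by (intro sft_Bh) auto
  then show False using assms(4) by (simp add: sg_def)
qed

lemma ycoef_sgi_0:
  assumes "1 \<le> j" "j < N" "i \<in> Bh" "sgi j i \<notin> Bh"
  shows "ycoef j (sgi j i) = 0"
proof (rule ccontr)
  assume "ycoef j (sgi j i) \<noteq> 0"
  then have c: "C (j + 1) i \<noteq> 0" "C j (i(j := i j + 1)) \<noteq> 0"
    using assms by (auto simp: ycoef_sgi)
  have "sft (Ts j) i \<in> Bh"
    using assms c by (intro sft_Bh) auto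
  then have "i(j := i j + 1) \<in> Bh" by simp
  moreover have "cf (Tg (j + 1)) (i(j := i j + 1)) \<noteq> 0"
    using c assms by (simp add: C_upd)
  ultimately have "sft (Tg (j + 1)) (i(j := i j + 1)) \<in> Bh"
    using assms by (intro sft_Bh) auto
  then show False using assms(4) by (simp add: sgi_def)
qed

text \<open>Read without transposition this is E_j x = c (y_j x - (K_j x) y_j), with c =
  \<open>cE j\<close>, for a generator x. The primed letters are the coefficients at raised indices,
  so their squares are eigenvalues of t_k t_k^* and the unprimed squares those of t_k^* t_k.\<close>

lemma comm_E:
  assumes j: "1 \<le> j" "j < N" and i: "i \<in> Bh" and x: "x \<in> CG"
  shows "Rop (action_val q n (Eg j) x) v i =
    of_real (cE j) * (cf x i * of_real (ycoef j (sft x i))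
      - of_real (q powi weight j x * ycoef j i) * cf x (sg j i)) * v (sg j (sft x i))"
proof -
  define w where "w = xx (j + 1) i"
  have w: "w > 0" using j by (auto simp: w_def intro: xx_pos)
  have j1: "j \<in> {1..N}" "j + 1 \<in> {1..N}" "j + 1 \<noteq> j" "j < j + 1" using j by auto
  define a where "a = C j i"
  define b where "b = C (j + 1) i"
  define a' where "a' = C j (i(j := i j + 1))"
  define b' where "b' = C (j + 1) (i(j + 1 := i (j + 1) + 1))"
  have aa: "a * a = eps j * (xx j i - w / q\<^sup>2)" "a' * a' = eps j * (xx j i - w)"
    using C_sq[OF i j1(1)] C_sq_up[OF i j1(1)] by (simp_all add: a_def a'_def w_def power2_eq_square)
  have bb: "b * b = eps (j + 1) * (w - xx (j + 2) i / q\<^sup>2)" "b' * b' = eps (j + 1) * (w - xx (j + 2) i)"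
    using C_sq[OF i j1(2)] C_sq_up[OF i j1(2)] by (simp_all add: b_def b'_def w_def power2_eq_square)
  have y: "ycoef j i = b' * a / w"
    by (simp add: ycoef_def a_def b'_def w_def)
  define d where "d = 1 - 1 / q\<^sup>2"
  have d: "d \<noteq> 0" using q2_ne by (simp add: d_def)
  \<comment> \<open>Both combinations are multiples of \<open>w\<close>, the eigenvalue of
    \<xi>_(j+1), and cancel the inverse contained in y_j.\<close>
  have aa': "a * a - a' * a' = eps j * (w * d)" and bb': "b * b - b' * b' / q\<^sup>2 = eps (j + 1) * (w * d)"
    unfolding aa bb d_def by (simp_all add: algebra_simps diff_divide_distrib)
  note upd = C_upd C_upd2 xx_upd inverse_eq_divide
  define p where "p = q powr (-1/2)"
  have cE: "cE j = eps (j + 1) * p / d" by (simp add: cE_def p_def d_def)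
  \<comment> \<open>The sign changes across \<open>n\<close> only; this produces the exceptional
    sign in the action on t_n^*.\<close>
  have ee: "eps (j + 1) = (if j = n then - eps j else eps j)" by (auto simp: eps_def)
  show ?thesis
  proof (cases x)
    case (Tg k)
    then have k: "k \<in> {1..N}" using x by auto
    consider "k = j" | "k = j + 1" | "k \<noteq> j" "k \<noteq> j + 1" by blast
    then show ?thesis
    proof cases
      case 1
      have "ycoef j (i(j := i j - 1)) = q * b' * C j (i(j := i j - 1)) / w"
        unfolding ycoef_def using j1 by (simp add: upd b'_def w_def power2_eq_square)
      moreover have "C j (sg j i) = C j (i(j := i j - 1))"
        unfolding sg_def using j1 by (simp add: upd)
      ultimately show ?thesis
        by (simp add: inverse_eq_divide Tg 1 y a_def)
    next
      case 2
      have y': "ycoef j (i(j + 1 := i (j + 1) - 1)) = b * a / w"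
        unfolding ycoef_def using j1 by (simp add: upd a_def b_def w_def)
      have C': "C (j + 1) (sg j i) = b' / q"
        unfolding sg_def using j1 by (simp add: upd b'_def)
      have "cE j * (b * (b * a / w) - 1 / q * (b' * a / w) * (b' / q))
          = cE j * a / w * (b * b - b' * b' / q\<^sup>2)"
        by (simp add: algebra_simps power2_eq_square diff_divide_distrib)
      also have "\<dots> = p * a"
        unfolding bb' cE using w d by (simp add: field_simps)
      finally have main: "cE j * (b * (b * a / w) - 1 / q * (b' * a / w) * (b' / q)) = p * a" .
      have "sg j (i(j + 1 := i (j + 1) - 1)) = i(j := i j - 1)"
        by (auto simp: sg_def fun_eq_iff)
      then have "of_real (cE j) * (cf x i * of_real (ycoef j (sft x i))
          - of_real (q powi weight j x * ycoef j i) * cf x (sg j i)) * v (sg j (sft x i))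
        = of_real (cE j * (b * (b * a / w) - 1 / q * (b' * a / w) * (b' / q))) * v (i(j := i j - 1))"
        using y' C' by (simp add: inverse_eq_divide Tg 2 y b_def)
      moreover have "Rop (action_val q n (Eg j) x) v i = of_real (p * a) * v (i(j := i j - 1))"
        by (simp add: inverse_eq_divide Tg 2 Rop_scal_mult p_def a_def)
      ultimately show ?thesis by (simp only: main)
    next
      case 3
      then show ?thesis
        using ycoef_upd[OF j k 3, of i "i k - 1"] C_sg(1)[OF j k 3, of i] by (simp add: inverse_eq_divide Tg)
    qed
  next
    case (Ts k)
    then have k: "k \<in> {1..N}" using x by auto
    consider "k = j" | "k = j + 1" | "k \<noteq> j" "k \<noteq> j + 1" by blast
    then show ?thesis
    proof cases
      case 1
      have y': "ycoef j (i(j := i j + 1)) = b' * a' / (q * w)"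
        unfolding ycoef_def using j1 by (simp add: upd a'_def b'_def w_def power2_eq_square)
      have C': "C j ((sg j i)(j := sg j i j + 1)) = a"
        unfolding sg_def using j1 by (simp add: upd a_def fun_upd_twist[of j "Suc j"])
      have "cE j * (a' * (b' * a' / (q * w)) - 1 / q * (b' * a / w) * a)
          = - (cE j * b' / (q * w) * (a * a - a' * a'))"
        by (simp add: algebra_simps diff_divide_distrib)
      also have "\<dots> = (if j = n then 1 else - 1) * (p / q) * b'"
        unfolding aa' cE ee using w d by (simp add: field_simps)
      finally have main: "cE j * (a' * (b' * a' / (q * w)) - 1 / q * (b' * a / w) * a)
         = (if j = n then 1 else - 1) * (p / q) * b'" .
      have s: "sg j (i(j := i j + 1)) = i(j + 1 := i (j + 1) + 1)"
        by (auto simp: sg_def fun_eq_iff)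
      then have "of_real (cE j) * (cf x i * of_real (ycoef j (sft x i))
          - of_real (q powi weight j x * ycoef j i) * cf x (sg j i)) * v (sg j (sft x i))
        = of_real (cE j * (a' * (b' * a' / (q * w)) - 1 / q * (b' * a / w) * a)) * v (i(j + 1 := i (j + 1) + 1))"
        using y' C' by (simp add: inverse_eq_divide Ts 1 y a'_def)
      moreover have "Rop (action_val q n (Eg j) x) v i =
          of_real ((if j = n then 1 else - 1) * (p / q) * b') * v (i(j + 1 := i (j + 1) + 1))"
        by (simp add: inverse_eq_divide Ts 1 Rop_scal_mult p_def b'_def q_powr')
      ultimately show ?thesis by (simp only: main)
    next
      case 2
      have "ycoef j (i(j + 1 := i (j + 1) + 1)) = C (j + 1) (i(j + 1 := 2 + i (j + 1))) * a / w"
        unfolding ycoef_def using j1 by (simp add: upd a_def w_def)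
      moreover have "C (j + 1) ((sg j i)(j + 1 := sg j i (j + 1) + 1)) = C (j + 1) (i(j + 1 := 2 + i (j + 1))) / q"
        unfolding sg_def using j1 by (simp add: upd)
      ultimately show ?thesis
        by (simp add: inverse_eq_divide Ts 2 y b'_def)
    next
      case 3
      have "C k ((sg j i)(k := sg j i k + 1)) = C k (sg j (i(k := i k + 1)))"
        using sg_sft(1)[of j "Ts k" i] by simp
      then show ?thesis
        using ycoef_upd[OF j k 3, of i "i k + 1"] C_sg(1)[OF j k 3, of "i(k := i k + 1)"] 3 by (simp add: inverse_eq_divide Ts)
    qed
  next
    case (Fn g)
    show ?thesis
    proof (cases "j = n")
      case False
      then show ?thesis using lev_sg(1)[OF j(1), of i] by (simp add: inverse_eq_divide Fn)
    next
      case True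
      have w': "w = q powi (2 * lev i)"
        using True j by (simp add: w_def xx_def)
      \<comment> \<open>For j = n the denominator of y_j is \<xi>_(n+1) itself, so the commutator
        with a function of it becomes the difference quotient.\<close>
      have qd: "qdiff q g (lev i) = (g (lev i) - g (lev i - 1)) * of_real (1 / (w * d))"
      proof -
        have "q powi (2 * (lev i - 1)) - q powi (2 * lev i) = - (w * d)"
          unfolding w' d_def by (simp add: powi_diff right_diff_distrib powi_double power_divide)
        then show ?thesis
          by (simp only: qdiff_def) (simp add: divide_inverse algebra_simps)
      qed
      have "lev (i(n + 1 := i (n + 1) + 1)) = lev i" by (simp add: idx_sum_upd)
      moreover have "C n (i(n + 1 := i (n + 1) + 1)) = a"
        unfolding a_def using True j1 n by (simp add: upd)
      moreover have "(i(n + 1 := i (n + 1) + 1))(n := (i(n + 1 := i (n + 1) + 1)) n - 1) = sg n i"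
        by (auto simp: sg_def fun_eq_iff)
      ultimately have R: "Rop (action_val q n (Eg j) x) v i = of_real p * of_real a * qdiff q g (lev i) * of_real b' * v (sg n i)"
        by (simp add: inverse_eq_divide Fn True Rop_mult Rop_scal_mult p_def b'_def mult_ac)
      have yn: "ycoef n i = b' * a / w" and cn: "cE n = p / d" and lv: "lev (sg n i) = lev i - 1"
        using y cE lev_sg(1)[OF j(1), of i] by (simp_all add: True eps_def)
      show ?thesis
        unfolding R qd unfolding Fn True weight.simps cf.simps sft.simps yn cn lv
        by (simp add: algebra_simps diff_divide_distrib)
    qed
  qed
qed

text \<open>With z_j the adjoint of y_j, this is F_j x = c (z_j (K_j^(-1) x) - x z_j), with c =
  \<open>cF j\<close>, for a generator x. The cases follow \<open>comm_E\<close>.\<close>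

lemma comm_F:
  assumes j: "1 \<le> j" "j < N" and i: "i \<in> Bh" and x: "x \<in> CG"
  shows "Rop (action_val q n (Fg j) x) v i =
    of_real (cF j) * (of_real (q powi (- weight j x)) * cf x i * of_real (ycoef j (sgi j (sft x i)))
      - of_real (ycoef j (sgi j i)) * cf x (sgi j i)) * v (sgi j (sft x i))"
proof -
  define w where "w = xx (j + 1) i"
  have w: "w > 0" using j by (auto simp: w_def intro: xx_pos)
  have j1: "j \<in> {1..N}" "j + 1 \<in> {1..N}" "j + 1 \<noteq> j" "j < j + 1" using j by auto
  define a where "a = C j i"
  define b where "b = C (j + 1) i"
  define a' where "a' = C j (i(j := i j + 1))"
  define b' where "b' = C (j + 1) (i(j + 1 := i (j + 1) + 1))"
  have aa: "a * a = eps j * (xx j i - w / q\<^sup>2)" "a' * a' = eps j * (xx j i - w)"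
    using C_sq[OF i j1(1)] C_sq_up[OF i j1(1)] by (simp_all add: a_def a'_def w_def power2_eq_square)
  have bb: "b * b = eps (j + 1) * (w - xx (j + 2) i / q\<^sup>2)" "b' * b' = eps (j + 1) * (w - xx (j + 2) i)"
    using C_sq[OF i j1(2)] C_sq_up[OF i j1(2)] by (simp_all add: b_def b'_def w_def power2_eq_square)
  have y: "ycoef j (sgi j i) = b * a' / (q * w)"
    using ycoef_sgi[OF j] by (simp add: a'_def b_def w_def)
  define d where "d = 1 - 1 / q\<^sup>2"
  have d: "d \<noteq> 0" using q2_ne by (simp add: d_def)
  have aa': "a * a - a' * a' = eps j * (w * d)" and bb': "b * b - b' * b' / q\<^sup>2 = eps (j + 1) * (w * d)"
    unfolding aa bb d_def by (simp_all add: algebra_simps diff_divide_distrib)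
  note upd = C_upd C_upd2 xx_upd inverse_eq_divide
  define p where "p = q powr (-1/2)"
  have cF: "cF j = eps j * (p * q\<^sup>2) / d" by (simp add: cF_def p_def d_def q_powr(3))
  have ee: "eps (j + 1) = (if j = n then - eps j else eps j)" by (auto simp: eps_def)
  show ?thesis
  proof (cases x)
    case (Tg k)
    then have k: "k \<in> {1..N}" using x by auto
    consider "k = j" | "k = j + 1" | "k \<noteq> j" "k \<noteq> j + 1" by blast
    then show ?thesis
    proof cases
      case 1
      have y': "ycoef j (sgi j (i(j := i j - 1))) = b * a / w"
        unfolding ycoef_sgi[OF j] using j1 by (simp add: upd a_def b_def w_def power2_eq_square)
      have C': "C j (sgi j i) = a'"
        unfolding sgi_def using j1 by (simp add: upd a'_def)
      have "cF j * (1 / q * a * (b * a / w) - b * a' / (q * w) * a') = cF j * b / (q * w) * (a * a - a' * a')"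
        by (simp add: algebra_simps diff_divide_distrib)
      also have "\<dots> = p * q * b"
        unfolding aa' cF using w d by (simp add: field_simps power2_eq_square)
      finally have main: "cF j * (1 / q * a * (b * a / w) - b * a' / (q * w) * a') = p * q * b" .
      have "sgi j (i(j := i j - 1)) = i(j + 1 := i (j + 1) - 1)"
        by (auto simp: sgi_def fun_eq_iff)
      then have "of_real (cF j) * (of_real (q powi (- weight j x)) * cf x i * of_real (ycoef j (sgi j (sft x i)))
          - of_real (ycoef j (sgi j i)) * cf x (sgi j i)) * v (sgi j (sft x i))
        = of_real (cF j * (1 / q * a * (b * a / w) - b * a' / (q * w) * a')) * v (i(j + 1 := i (j + 1) - 1))"
        using y' C' by (simp add: inverse_eq_divide Tg 1 y a_def)
      moreover have "Rop (action_val q n (Fg j) x) v i = of_real (p * q * b) * v (i(j + 1 := i (j + 1) - 1))"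
        by (simp add: inverse_eq_divide Tg 1 Rop_scal_mult p_def b_def q_powr(2))
      ultimately show ?thesis by (simp only: main)
    next
      case 2
      have "ycoef j (sgi j (i(j + 1 := i (j + 1) - 1))) = C (j + 1) (i(j + 1 := i (j + 1) - 1)) * a' / (q * w)"
        unfolding ycoef_sgi[OF j] using j1 by (simp add: upd a'_def w_def)
      moreover have "C (j + 1) (sgi j i) = q * C (j + 1) (i(j + 1 := i (j + 1) - 1))"
        unfolding sgi_def using j1 by (simp add: upd)
      ultimately show ?thesis
        by (simp add: inverse_eq_divide Tg 2 y b_def)
    next
      case 3
      have "ycoef j (sgi j (i(k := i k - 1))) = ycoef j (sgi j i)"
        using ycoef_upd[OF j k 3, of "sgi j i"] sg_sft(2)[of j "Tg k" i] by simp
      then show ?thesis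
        using C_sg(2)[OF j k 3, of i] 3 by (simp add: inverse_eq_divide Tg)
    qed
  next
    case (Ts k)
    then have k: "k \<in> {1..N}" using x by auto
    consider "k = j" | "k = j + 1" | "k \<noteq> j" "k \<noteq> j + 1" by blast
    then show ?thesis
    proof cases
      case 1
      have "ycoef j (sgi j (i(j := i j + 1))) = b * C j (i(j := 2 + i j)) / (q\<^sup>2 * w)"
        unfolding ycoef_sgi[OF j] using j1 by (simp add: upd b_def w_def power2_eq_square mult.assoc)
      moreover have "C j ((sgi j i)(j := sgi j i j + 1)) = C j (i(j := 2 + i j))"
        unfolding sgi_def using j1 by (simp add: upd fun_upd_twist[of j "Suc j"])
      ultimately show ?thesis
        by (simp add: inverse_eq_divide Ts 1 y a'_def power2_eq_square)
    next
      case 2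
      have y': "ycoef j (sgi j (i(j + 1 := i (j + 1) + 1))) = b' * a' / (q * w)"
        unfolding ycoef_sgi[OF j] using j1 by (simp add: upd a'_def b'_def w_def)
      have C': "C (j + 1) ((sgi j i)(j + 1 := sgi j i (j + 1) + 1)) = q * b"
        unfolding sgi_def using j1 by (simp add: upd b_def)
      have "cF j * (1 / q * b' * (b' * a' / (q * w)) - b * a' / (q * w) * (q * b))
          = - (cF j * a' / w * (b * b - b' * b' / q\<^sup>2))"
        by (simp add: algebra_simps power2_eq_square diff_divide_distrib)
      also have "\<dots> = (if j = n then 1 else - 1) * (p * q\<^sup>2) * a'"
        unfolding bb' cF ee using w d by (simp add: field_simps)
      finally have main: "cF j * (1 / q * b' * (b' * a' / (q * w)) - b * a' / (q * w) * (q * b))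
         = (if j = n then 1 else - 1) * (p * q\<^sup>2) * a'" .
      have s: "sgi j (i(j + 1 := i (j + 1) + 1)) = i(j := i j + 1)"
        by (auto simp: sgi_def fun_eq_iff)
      then have "of_real (cF j) * (of_real (q powi (- weight j x)) * cf x i * of_real (ycoef j (sgi j (sft x i)))
          - of_real (ycoef j (sgi j i)) * cf x (sgi j i)) * v (sgi j (sft x i))
        = of_real (cF j * (1 / q * b' * (b' * a' / (q * w)) - b * a' / (q * w) * (q * b))) * v (i(j := i j + 1))"
        using y' C' by (simp add: inverse_eq_divide Ts 2 y b'_def)
      moreover have "Rop (action_val q n (Fg j) x) v i =
          of_real ((if j = n then 1 else - 1) * (p * q\<^sup>2) * a') * v (i(j := i j + 1))"
        by (simp add: inverse_eq_divide Ts 2 Rop_scal_mult p_def a'_def q_powr(3))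
      ultimately show ?thesis by (simp only: main)
    next
      case 3
      have "ycoef j (sgi j (i(k := i k + 1))) = ycoef j (sgi j i)"
        using ycoef_upd[OF j k 3, of "sgi j i"] sg_sft(2)[of j "Ts k" i] by simp
      moreover have "C k ((sgi j i)(k := sgi j i k + 1)) = C k (i(k := i k + 1))"
        using sg_sft(2)[of j "Ts k" i] C_sg(2)[OF j k 3, of "i(k := i k + 1)"] by simp
      ultimately show ?thesis
        using 3 by (simp add: inverse_eq_divide Ts)
    qed
  next
    case (Fn g)
    show ?thesis
    proof (cases "j = n")
      case False
      then show ?thesis using lev_sg(2)[OF j(1), of i] by (simp add: inverse_eq_divide Fn)
    next
      case True
      have w': "w = q powi (2 * lev i)"
        using True j by (simp add: w_def xx_def)
      \<comment> \<open>Here t_n^* acts before the function and raises the level, hence the quotient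
        is taken at \<open>lev i + 1\<close>.\<close>
      have qd: "qdiff q g (lev i + 1) = (g (lev i + 1) - g (lev i)) * of_real (1 / (q\<^sup>2 * w * d))"
      proof -
        have "q powi (2 * (lev i + 1 - 1)) - q powi (2 * (lev i + 1)) = - (q\<^sup>2 * w * d)"
          unfolding w' d_def by (simp add: powi_add right_diff_distrib distrib_left powi_double)
        then show ?thesis
          by (simp only: qdiff_def) (simp add: divide_inverse algebra_simps)
      qed
      have "lev (i(n := i n + 1)) = lev i + 1" using n by (simp add: idx_sum_upd)
      moreover have "C (n + 1) (i(n := i n + 1)) = q * b"
        unfolding b_def using True j1 n by (simp add: upd)
      moreover have "(i(n := i n + 1))(n + 1 := (i(n := i n + 1)) (n + 1) - 1) = sgi n i"
        by (auto simp: sgi_def fun_eq_iff)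
      ultimately have R: "Rop (action_val q n (Fg j) x) v i =
          of_real (p * q\<^sup>2) * of_real (q * b) * qdiff q g (lev i + 1) * of_real a' * v (sgi n i)"
        by (simp add: inverse_eq_divide Fn True Rop_mult Rop_scal_mult p_def q_powr(3) a'_def mult_ac)
      have yn: "ycoef n (sgi n i) = b * a' / (q * w)" and cn: "cF n = - (p * q\<^sup>2) / d"
        and lv: "lev (sgi n i) = lev i + 1"
        using y cF lev_sg(2)[OF j(1), of i] by (simp_all add: True eps_def)
      show ?thesis
        unfolding R qd unfolding Fn True weight.simps cf.simps sft.simps yn cn lv
        using w d by (simp add: field_simps power2_eq_square)
    qed
  qed
qed

lemma kap_sft: "kap j (sft x i) = q powi weight j x * kap j i"
proof -
  have "sft x i (j + 1) - sft x i j = weight j x + (i (j + 1) - i j)"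
    by (cases x) auto
  then show ?thesis by (simp only: kap_def powi_add)
qed

end

section \<open>The module algebra action expressed by operators\<close>

lemma tens_single: "Poly_Mapping.single u a \<otimes>\<^sub>t Poly_Mapping.single v b = Poly_Mapping.single (u, v) (a * b)"
  by (cases "a = 0"; cases "b = 0") (simp_all add: tens_def)

lemma one_single: "(1 :: 'g fa) = Poly_Mapping.single 0 1"
  by simp

lemma uq_comult_gen:
  "uq_comult (gen (Eg j)) = Poly_Mapping.single (Word [Eg j], 0) 1 + Poly_Mapping.single (Word [Kg j], Word [Eg j]) 1"
  "uq_comult (gen (Fg j)) = Poly_Mapping.single (Word [Fg j], Word [Ki j]) 1 + Poly_Mapping.single (0, Word [Fg j]) 1"
  "uq_comult (gen (Kg j)) = Poly_Mapping.single (Word [Kg j], Word [Kg j]) 1"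
  "uq_comult (gen (Ki j)) = Poly_Mapping.single (Word [Ki j], Word [Ki j]) 1"
  unfolding uq_comult_def lift_hom_gen ugen_comult.simps
  unfolding gen_def one_single tens_single by simp_all

lemma uq_counit_gen: "uq_counit (gen x) = ugen_counit x"
  by (simp add: uq_counit_def gen_def)

context cone
begin

abbreviation "UG \<equiv> uq_gens n m"
abbreviation "UR \<equiv> uq_rels q n m"
abbreviation "UF \<equiv> carrier (free_alg UG)"
abbreviation "UA \<equiv> uq_alg q n m"
abbreviation "uc \<equiv> uq_cls q n m"

lemma uq_gens_iff [simp]:
  "Eg j \<in> UG \<longleftrightarrow> j \<in> {1..N-1}" "Fg j \<in> UG \<longleftrightarrow> j \<in> {1..N-1}"
  "Kg j \<in> UG \<longleftrightarrow> j \<in> {1..N-1}" "Ki j \<in> UG \<longleftrightarrow> j \<in> {1..N-1}"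
  by (auto simp: uq_gens_def)

lemma serre_UF: "x \<in> UF \<Longrightarrow> y \<in> UF \<Longrightarrow> serre q x y \<in> UF"
  unfolding serre_def by (intro free_alg_closed)

lemma uq_rels_UF: "UR \<subseteq> UF"
proof
  fix r assume "r \<in> UR"
  then obtain i j where ij: "i \<in> {1..N-1}" "j \<in> {1..N-1}" and r: "r \<in>
     {gen (Kg i) * gen (Ki i) - 1, gen (Ki i) * gen (Kg i) - 1,
      gen (Kg i) * gen (Kg j) - gen (Kg j) * gen (Kg i),
      gen (Kg i) * gen (Eg j) - scal (of_real (q powi cartan i j)) * gen (Eg j) * gen (Kg i),
      gen (Kg i) * gen (Fg j) - scal (of_real (q powi (- cartan i j))) * gen (Fg j) * gen (Kg i),
      gen (Eg i) * gen (Fg j) - gen (Fg j) * gen (Eg i)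
        - (if i = j then scal (of_real (1 / (q - inverse q))) * (gen (Kg i) - gen (Ki i)) else 0)}
     \<union> (if cartan i j = -1 then
          {serre q (gen (Eg i)) (gen (Eg j)), serre q (gen (Fg i)) (gen (Fg j))}
        else if cartan i j = 0 then
          {gen (Eg i) * gen (Eg j) - gen (Eg j) * gen (Eg i),
           gen (Fg i) * gen (Fg j) - gen (Fg j) * gen (Fg i)}
        else {})"
    unfolding uq_rels_def UN_iff by blast
  have g: "gen (Kg i) \<in> UF" "gen (Ki i) \<in> UF" "gen (Kg j) \<in> UF" "gen (Eg i) \<in> UF" "gen (Eg j) \<in> UF"
    "gen (Fg i) \<in> UF" "gen (Fg j) \<in> UF"
    using ij by simp_all
  show "r \<in> UF"
    using r g by (auto split: if_splits intro!: free_alg_closed serre_UF)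
qed

sublocale u: presentation UG UR
  by unfold_locales (rule uq_rels_UF)

lemma uq_alg_eq: "uq_alg q n m = presented UG UR" and uq_cls_eq: "uq_cls q n m = cls UG UR"
  by (simp_all add: uq_alg_def uq_cls_def)

lemma uc_closed [simp]: "a \<in> UF \<Longrightarrow> uc a \<in> carrier UA"
  by (simp add: uq_alg_eq uq_cls_eq)

lemma uc_mult: "a \<in> UF \<Longrightarrow> b \<in> UF \<Longrightarrow> uc a \<otimes>\<^bsub>UA\<^esub> uc b = uc (a * b)"
  and uc_add: "a \<in> UF \<Longrightarrow> b \<in> UF \<Longrightarrow> uc a \<oplus>\<^bsub>UA\<^esub> uc b = uc (a + b)"
  by (simp_all add: uq_alg_eq uq_cls_eq u.cls_mult u.cls_add)

lemmas cone_induct [consumes 1, case_names scal gen add mult] =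
  P.presented_induct [folded cone_alg_eq cone_cls_eq]

lemma cone_scale_1: "A \<in> carrier CA \<Longrightarrow> cone_scale q n m 1 A = A"
  by (auto simp: cone_carrier cone_scale_cls)

lemma RC_cc: "f \<in> CF \<Longrightarrow> i \<in> Bh \<Longrightarrow> RC (cc f) v i = Rop f v i"
  by (simp add: RC_cls)

end

locale cone_action = cone_form +
  fixes act :: "ugen fa set \<Rightarrow> cgen fa set \<Rightarrow> cgen fa set"
  assumes act: "uq_action q n m act"
begin

lemma module_algebra: "uq_module_algebra q n m act"
  using act by (simp add: uq_action_def)

lemmas ma = module_algebra [unfolded uq_module_algebra_def Let_def]

lemma act_closed [simp]: "W \<in> carrier UA \<Longrightarrow> A \<in> carrier CA \<Longrightarrow> act W A \<in> carrier CA"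
  using conjunct1[OF ma] by blast

lemma act_add: "W \<in> carrier UA \<Longrightarrow> A \<in> carrier CA \<Longrightarrow> B \<in> carrier CA \<Longrightarrow>
    act W (A \<oplus>\<^bsub>CA\<^esub> B) = act W A \<oplus>\<^bsub>CA\<^esub> act W B"
  using conjunct1[OF conjunct2[OF ma]] by blast

lemma act_uadd: "a \<in> UF \<Longrightarrow> b \<in> UF \<Longrightarrow> A \<in> carrier CA \<Longrightarrow>
    act (uc (a + b)) A = act (uc a) A \<oplus>\<^bsub>CA\<^esub> act (uc b) A"
  using conjunct1[OF conjunct2[OF conjunct2[OF ma]]] uc_closed uc_add[of a b] by metis

lemma act_umult: "a \<in> UF \<Longrightarrow> b \<in> UF \<Longrightarrow> A \<in> carrier CA \<Longrightarrow>
    act (uc (a * b)) A = act (uc a) (act (uc b) A)"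
  using conjunct1[OF conjunct2[OF conjunct2[OF conjunct2[OF ma]]]] uc_closed uc_mult[of a b] by metis

lemma act_uscal: "A \<in> carrier CA \<Longrightarrow> act (uc (scal c)) A = cone_scale q n m c A"
  using conjunct1[OF conjunct2[OF conjunct2[OF conjunct2[OF conjunct2[OF ma]]]]] by blast

lemma act_u1: "A \<in> carrier CA \<Longrightarrow> act (uc 1) A = A"
  using act_uscal[of A 1] by (simp add: cone_scale_1)

lemma act_one: "a \<in> UF \<Longrightarrow> act (uc a) (cc 1) = cone_scale q n m (uq_counit a) (cc 1)"
  using conjunct1[OF conjunct2[OF conjunct2[OF conjunct2[OF conjunct2[OF conjunct2[OF ma]]]]]] P.cls_one by (simp add: cone_cls_eq cone_alg_eq)

lemma act_gen: "u \<in> UG \<Longrightarrow> x \<in> CG \<Longrightarrow> act (uc (gen u)) (cc (gen x)) = cc (action_val q n u x)"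
  using act by (simp add: uq_action_def)

lemma act_scale:
  assumes "a \<in> UF" "A \<in> carrier CA"
  shows "act (uc a) (cone_scale q n m c A) = cone_scale q n m c (act (uc a) A)"
  using act_umult[of a "scal c" A] act_umult[of "scal c" a A] assms
  by (simp add: act_uscal scal_central[of c a])

lemma act_scal:
  assumes "a \<in> UF"
  shows "act (uc a) (cc (scal c)) = cc (scal (c * uq_counit a))"
proof -
  have "cc (scal c) = cone_scale q n m c (cc 1)"
    by (simp add: cone_scale_cls)
  then show ?thesis
    using assms by (simp add: act_scale act_one) (simp add: cone_scale_cls)
qed

lemma cone_abelian: "abelian_monoid CA"
  using P.presented_ring unfolding cone_alg_eq by (simp add: ring.is_abelian_group abelian_group.axioms)

lemma act_mult_gen:
  assumes "a \<in> UF" "A \<in> carrier CA" "B \<in> carrier CA"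
  shows "act (uc a) (A \<otimes>\<^bsub>CA\<^esub> B) = finsum CA (\<lambda>(u, v). cone_scale q n m (Poly_Mapping.lookup (uq_comult a) (u, v))
        (act (uc (Poly_Mapping.single u 1)) A \<otimes>\<^bsub>CA\<^esub> act (uc (Poly_Mapping.single v 1)) B))
      (Poly_Mapping.keys (uq_comult a))"
  using bspec[OF bspec[OF bspec[OF conjunct2[OF conjunct2[OF conjunct2[OF conjunct2[OF conjunct2[OF conjunct2[OF ma]]]]]] assms(1)] assms(2)] assms(3)] .

text \<open>The two pairs of words are different, so no coefficients merge and the sum over the keys
  has exactly two terms.\<close>

lemma act_mult2:
  assumes a: "a \<in> UF" "uq_comult a = Poly_Mapping.single (u1, v1) 1 + Poly_Mapping.single (u2, v2) 1"
    and ne: "(u1, v1) \<noteq> (u2, v2)"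
    and U: "Poly_Mapping.single u1 1 \<in> UF" "Poly_Mapping.single v1 1 \<in> UF"
      "Poly_Mapping.single u2 1 \<in> UF" "Poly_Mapping.single v2 1 \<in> UF"
    and A: "A \<in> carrier CA" "B \<in> carrier CA"
  shows "act (uc a) (A \<otimes>\<^bsub>CA\<^esub> B) =
    (act (uc (Poly_Mapping.single u1 1)) A \<otimes>\<^bsub>CA\<^esub> act (uc (Poly_Mapping.single v1 1)) B) \<oplus>\<^bsub>CA\<^esub>
    (act (uc (Poly_Mapping.single u2 1)) A \<otimes>\<^bsub>CA\<^esub> act (uc (Poly_Mapping.single v2 1)) B)"
proof -
  have l: "Poly_Mapping.lookup (uq_comult a) k = (if k = (u1, v1) \<or> k = (u2, v2) then 1 else 0)" for k
    using ne unfolding a(2) by (auto simp: lookup_add lookup_single when_def)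
  have k: "Poly_Mapping.keys (uq_comult a) = {(u1, v1), (u2, v2)}"
    by (auto simp: in_keys_iff l split: if_splits)
  show ?thesis
    unfolding act_mult_gen[OF a(1) A] k using ne U A cone_abelian
    by (subst abelian_monoid.finsum_insert)
      (auto simp: l cone_scale_1 abelian_monoid.finsum_insert abelian_monoid.finsum_empty abelian_monoid.r_zero)
qed

lemma act_mult1:
  assumes a: "a \<in> UF" "uq_comult a = Poly_Mapping.single (u1, v1) 1"
    and U: "Poly_Mapping.single u1 1 \<in> UF" "Poly_Mapping.single v1 1 \<in> UF"
    and A: "A \<in> carrier CA" "B \<in> carrier CA"
  shows "act (uc a) (A \<otimes>\<^bsub>CA\<^esub> B) =
    act (uc (Poly_Mapping.single u1 1)) A \<otimes>\<^bsub>CA\<^esub> act (uc (Poly_Mapping.single v1 1)) B"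
  unfolding act_mult_gen[OF a(1) A] using a(2) U A cone_abelian
  by (auto simp: cone_scale_1 abelian_monoid.finsum_insert abelian_monoid.finsum_empty abelian_monoid.r_zero)

abbreviation "aE j \<equiv> act (uc (gen (Eg j)))"
abbreviation "aF j \<equiv> act (uc (gen (Fg j)))"
abbreviation "aK j \<equiv> act (uc (gen (Kg j)))"
abbreviation "aL j \<equiv> act (uc (gen (Ki j)))"

lemma act_gens_mult:
  assumes j: "1 \<le> j" "j < N" and A: "A \<in> carrier CA" "B \<in> carrier CA"
  shows "aE j (A \<otimes>\<^bsub>CA\<^esub> B) = (aE j A \<otimes>\<^bsub>CA\<^esub> B) \<oplus>\<^bsub>CA\<^esub> (aK j A \<otimes>\<^bsub>CA\<^esub> aE j B)"
    and "aF j (A \<otimes>\<^bsub>CA\<^esub> B) = (aF j A \<otimes>\<^bsub>CA\<^esub> aL j B) \<oplus>\<^bsub>CA\<^esub> (A \<otimes>\<^bsub>CA\<^esub> aF j B)"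
    and "aK j (A \<otimes>\<^bsub>CA\<^esub> B) = aK j A \<otimes>\<^bsub>CA\<^esub> aK j B"
    and "aL j (A \<otimes>\<^bsub>CA\<^esub> B) = aL j A \<otimes>\<^bsub>CA\<^esub> aL j B"
proof -
  have g: "Poly_Mapping.single (Word [x]) 1 = gen x" "Poly_Mapping.single 0 1 = (1 :: ugen fa)" for x :: ugen
    by (simp_all add: gen_def)
  have U: "gen (Eg j) \<in> UF" "gen (Fg j) \<in> UF" "gen (Kg j) \<in> UF" "gen (Ki j) \<in> UF" "1 \<in> UF"
    using j by simp_all
  have ne: "(Word [Eg j], 0) \<noteq> (Word [Kg j], Word [Eg j])" "(Word [Fg j], Word [Ki j]) \<noteq> (0, Word [Fg j])"
    by (simp_all add: zero_fmon_def)
  show "aE j (A \<otimes>\<^bsub>CA\<^esub> B) = (aE j A \<otimes>\<^bsub>CA\<^esub> B) \<oplus>\<^bsub>CA\<^esub> (aK j A \<otimes>\<^bsub>CA\<^esub> aE j B)"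
    using act_mult2[OF U(1) uq_comult_gen(1) ne(1) _ _ _ _ A] U by (simp only: g act_u1[OF A(2)])
  show "aF j (A \<otimes>\<^bsub>CA\<^esub> B) = (aF j A \<otimes>\<^bsub>CA\<^esub> aL j B) \<oplus>\<^bsub>CA\<^esub> (A \<otimes>\<^bsub>CA\<^esub> aF j B)"
    using act_mult2[OF U(2) uq_comult_gen(2) ne(2) _ _ _ _ A] U by (simp only: g act_u1[OF A(1)])
  show "aK j (A \<otimes>\<^bsub>CA\<^esub> B) = aK j A \<otimes>\<^bsub>CA\<^esub> aK j B"
    using act_mult1[OF U(3) uq_comult_gen(3) _ _ A] U by (simp only: g)
  show "aL j (A \<otimes>\<^bsub>CA\<^esub> B) = aL j A \<otimes>\<^bsub>CA\<^esub> aL j B"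
    using act_mult1[OF U(4) uq_comult_gen(4) _ _ A] U by (simp only: g)
qed

lemma act_gens_closed [simp]:
  assumes "1 \<le> j" "j < N" "A \<in> carrier CA"
  shows "aE j A \<in> carrier CA" "aF j A \<in> carrier CA" "aK j A \<in> carrier CA" "aL j A \<in> carrier CA"
  using assms by simp_all

lemma action_val_CF: "u \<in> UG \<Longrightarrow> x \<in> CG \<Longrightarrow> action_val q n u x \<in> CF"
  using n m by (cases u; cases x) auto

text \<open>Conjugation by a diagonal operator is multiplicative, as is a group-like element; hence
  it is enough to know the generators.\<close>

lemma RC_K:
  assumes j: "1 \<le> j" "j < N" and A: "A \<in> carrier CA" and i: "i \<in> Bh"
  shows "RC (aK j A) v i = RC A (\<lambda>k. of_real (kap j k) * v k) i / of_real (kap j i)"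
    and "RC (aL j A) v i = of_real (kap j i) * RC A (\<lambda>k. v k / of_real (kap j k)) i"
proof -
  have U: "gen (Kg j) \<in> UF" "gen (Ki j) \<in> UF" and j': "j \<in> {1..N-1}" using j by simp_all
  show "RC (aK j A) v i = RC A (\<lambda>k. of_real (kap j k) * v k) i / of_real (kap j i)"
    using A i
  proof (induction A arbitrary: v i rule: cone_induct)
    case (scal c)
    then show ?case by (simp add: act_scal U uq_counit_gen RC_cc)
  next
    case (gen x)
    then show ?case using j' by (simp add: act_gen RC_cc action_val_CF kap_sft Rop_scal_mult)
  next
    case (add A B)
    then show ?case using j by (simp add: act_add RC_add add_divide_distrib)
  next
    case (mult A B)
    have "RC (aK j (A \<otimes>\<^bsub>CA\<^esub> B)) v i = RC (aK j B) (RC (aK j A) v) i"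
      using j mult(1,2) by (simp add: act_gens_mult RC_mult)
    also have "\<dots> = RC B (\<lambda>k. of_real (kap j k) * RC (aK j A) v k) i / of_real (kap j i)"
      using mult by simp
    also have "RC B (\<lambda>k. of_real (kap j k) * RC (aK j A) v k) i = RC B (RC A (\<lambda>k. of_real (kap j k) * v k)) i"
      using mult by (intro RC_cong) simp_all
    finally show ?case using mult(1,2) by (simp add: RC_mult)
  qed
  show "RC (aL j A) v i = of_real (kap j i) * RC A (\<lambda>k. v k / of_real (kap j k)) i"
    using A i
  proof (induction A arbitrary: v i rule: cone_induct)
    case (scal c)
    then show ?case by (simp add: act_scal U uq_counit_gen RC_cc)
  next
    case (gen x)
    then show ?case using j' by (simp add: act_gen RC_cc action_val_CF kap_sft Rop_scal_mult power_int_minus field_simps)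
  next
    case (add A B)
    then show ?case using j by (simp add: act_add RC_add distrib_left)
  next
    case (mult A B)
    have "RC (aL j (A \<otimes>\<^bsub>CA\<^esub> B)) v i = RC (aL j B) (RC (aL j A) v) i"
      using j mult(1,2) by (simp add: act_gens_mult RC_mult)
    also have "\<dots> = of_real (kap j i) * RC B (\<lambda>k. RC (aL j A) v k / of_real (kap j k)) i"
      using mult by simp
    also have "RC B (\<lambda>k. RC (aL j A) v k / of_real (kap j k)) i = RC B (RC A (\<lambda>k. v k / of_real (kap j k))) i"
      using mult by (intro RC_cong) simp_all
    finally show ?case using mult(1,2) by (simp add: RC_mult)
  qed
qed

lemma Yop_vadd: "Yop j (\<lambda>k. u k + v k) i = Yop j u i + Yop j v i"
  and Zop_vadd: "Zop j (\<lambda>k. u k + v k) i = Zop j u i + Zop j v i"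
  and Yop_vscale: "Yop j (\<lambda>k. c * v k) i = c * Yop j v i"
  and Zop_vscale: "Zop j (\<lambda>k. c * v k) i = c * Zop j v i"
  by (simp_all add: Yop_def Zop_def algebra_simps)

lemma Yop_cong: "1 \<le> j \<Longrightarrow> j < N \<Longrightarrow> (\<And>k. k \<in> Bh \<Longrightarrow> u k = v k) \<Longrightarrow> Yop j u i = Yop j v i"
  unfolding Yop_def using ycoef_0 by (cases "sg j i \<in> Bh") auto

lemma Zop_cong: "1 \<le> j \<Longrightarrow> j < N \<Longrightarrow> (\<And>k. k \<in> Bh \<Longrightarrow> u k = v k) \<Longrightarrow> Zop j u i = Zop j v i"
  unfolding Zop_def using ycoef_sgi_0 by (cases "sgi j i \<in> Bh") auto

lemma cf_off: "x \<in> CG \<Longrightarrow> i \<in> Bh \<Longrightarrow> sft x i \<notin> Bh \<Longrightarrow> cf x i = 0"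
  using sft_Bh by blast

lemma RC_E:
  assumes j: "1 \<le> j" "j < N" and A: "A \<in> carrier CA" and i: "i \<in> Bh"
  shows "RC (aE j A) v i = of_real (cE j) * (RC A (Yop j v) i - Yop j (RC (aK j A) v) i)"
proof -
  have U: "gen (Kg j) \<in> UF" "gen (Eg j) \<in> UF" and j': "j \<in> {1..N-1}" using j by simp_all
  show ?thesis
    using A i
  proof (induction A arbitrary: v i rule: cone_induct)
    case (scal c)
    have "Yop j (RC (aK j (cc (scal c))) v) i = Yop j (\<lambda>k. c * v k) i"
      by (intro Yop_cong j) (simp add: act_scal U uq_counit_gen RC_cc)
    then show ?case using scal by (simp add: act_scal U uq_counit_gen RC_cc Yop_vscale)
  next
    case (gen x)
    have "Yop j (RC (aK j (cc (gen x))) v) i = Yop j (\<lambda>k. of_real (q powi weight j x) * (cf x k * v (sft x k))) i"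
      using j' gen by (intro Yop_cong j) (simp add: act_gen RC_cc action_val_CF Rop_scal_mult)
    also have "\<dots> = of_real (q powi weight j x * ycoef j i) * cf x (sg j i) * v (sg j (sft x i))"
      using gen by (simp add: Yop_def sg_sft)
    finally have K: "Yop j (RC (aK j (cc (gen x))) v) i =
      of_real (q powi weight j x * ycoef j i) * cf x (sg j i) * v (sg j (sft x i))" .
    have Y: "RC (cc (gen x)) (Yop j v) i = cf x i * of_real (ycoef j (sft x i)) * v (sg j (sft x i))"
      using gen cf_off[OF gen] by (cases "sft x i \<in> Bh") (simp_all add: RC_cc Yop_def)
    have "RC (aE j (cc (gen x))) v i = Rop (action_val q n (Eg j) x) v i"
      using gen j' by (simp add: act_gen RC_cc action_val_CF)
    then show ?case
      unfolding K Y comm_E[OF j gen(2) gen(1)] by (simp add: algebra_simps)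
  next
    case (add A B)
    have "Yop j (RC (aK j (A \<oplus>\<^bsub>CA\<^esub> B)) v) i = Yop j (\<lambda>k. RC (aK j A) v k + RC (aK j B) v k) i"
      using add(1,2) j by (intro Yop_cong j) (simp add: act_add RC_add)
    then show ?case using add j
      by (simp add: act_add RC_add Yop_vadd algebra_simps)
  next
    case (mult A B)
    note cl = mult(1,2) act_gens_closed[OF j mult(1)] act_gens_closed[OF j mult(2)]
    \<comment> \<open>With y for y_j and K for K_j the identity is y A B - K(A B) y = (y A - K(A) y)
      B + K(A) (y B - K(B) y); the two mixed terms cancel.\<close>
    have 1: "RC (aE j (A \<otimes>\<^bsub>CA\<^esub> B)) v i = RC B (RC (aE j A) v) i + RC (aE j B) (RC (aK j A) v) i"
      using cl by (simp only: act_gens_mult[OF j mult(1,2)] RC_add RC_mult cone_closed)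
    have "RC B (RC (aE j A) v) i = RC B (\<lambda>k. of_real (cE j) * (RC A (Yop j v) k - Yop j (RC (aK j A) v) k)) i"
      using mult(3) by (intro RC_cong cl) simp
    also have "\<dots> = of_real (cE j) * (RC B (RC A (Yop j v)) i - RC B (Yop j (RC (aK j A) v)) i)"
      by (simp only: RC_vscale RC_vdiff)
    finally have 2: "RC B (RC (aE j A) v) i = \<dots>" .
    have 3: "RC (aE j B) (RC (aK j A) v) i =
        of_real (cE j) * (RC B (Yop j (RC (aK j A) v)) i - Yop j (RC (aK j B) (RC (aK j A) v)) i)"
      by (rule mult(4)[OF mult(5)])
    have "RC (aK j (A \<otimes>\<^bsub>CA\<^esub> B)) v = RC (aK j B) (RC (aK j A) v)"
      using cl by (simp add: act_gens_mult[OF j mult(1,2)] RC_mult fun_eq_iff)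
    then show ?case
      unfolding 1 2 3 RC_mult[OF mult(1,2)] by (simp add: algebra_simps)
  qed
qed

lemma RC_F:
  assumes j: "1 \<le> j" "j < N" and A: "A \<in> carrier CA" and i: "i \<in> Bh"
  shows "RC (aF j A) v i = of_real (cF j) * (RC (aL j A) (Zop j v) i - Zop j (RC A v) i)"
proof -
  have U: "gen (Ki j) \<in> UF" "gen (Fg j) \<in> UF" and j': "j \<in> {1..N-1}" using j by simp_all
  show ?thesis
    using A i
  proof (induction A arbitrary: v i rule: cone_induct)
    case (scal c)
    have "Zop j (RC (cc (scal c)) v) i = Zop j (\<lambda>k. c * v k) i"
      by (intro Zop_cong j) (simp add: RC_cc)
    then show ?case using scal by (simp add: act_scal U uq_counit_gen RC_cc Zop_vscale)
  next
    case (gen x)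
    have "Zop j (RC (cc (gen x)) v) i = Zop j (\<lambda>k. cf x k * v (sft x k)) i"
      using gen by (intro Zop_cong j) (simp add: RC_cc)
    also have "\<dots> = of_real (ycoef j (sgi j i)) * cf x (sgi j i) * v (sgi j (sft x i))"
      using gen by (simp add: Zop_def sg_sft)
    finally have K: "Zop j (RC (cc (gen x)) v) i =
      of_real (ycoef j (sgi j i)) * cf x (sgi j i) * v (sgi j (sft x i))" .
    have Y: "RC (aL j (cc (gen x))) (Zop j v) i =
        of_real (q powi (- weight j x)) * cf x i * of_real (ycoef j (sgi j (sft x i))) * v (sgi j (sft x i))"
      using gen j' cf_off[OF gen]
      by (cases "sft x i \<in> Bh") (simp_all add: act_gen action_val_CF RC_cc Zop_def Rop_scal_mult)
    have "RC (aF j (cc (gen x))) v i = Rop (action_val q n (Fg j) x) v i"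
      using gen j' by (simp add: act_gen RC_cc action_val_CF)
    then show ?case
      unfolding K Y comm_F[OF j gen(2) gen(1)] by (simp add: algebra_simps)
  next
    case (add A B)
    have "Zop j (RC (A \<oplus>\<^bsub>CA\<^esub> B) v) i = Zop j (\<lambda>k. RC A v k + RC B v k) i"
      using add(1,2) j by (intro Zop_cong j) (simp add: RC_add)
    then show ?case using add j
      by (simp add: act_add RC_add Zop_vadd algebra_simps)
  next
    case (mult A B)
    note cl = mult(1,2) act_gens_closed[OF j mult(1)] act_gens_closed[OF j mult(2)]
    \<comment> \<open>With z the adjoint of y_j and L the action of K_j^(-1): z L(A B) - A B z = (z
      L(A) - A z) L(B) + A (z L(B) - B z).\<close>
    have 1: "RC (aF j (A \<otimes>\<^bsub>CA\<^esub> B)) v i = RC (aL j B) (RC (aF j A) v) i + RC (aF j B) (RC A v) i"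
      using cl by (simp only: act_gens_mult[OF j mult(1,2)] RC_add RC_mult cone_closed)
    have "RC (aL j B) (RC (aF j A) v) i = RC (aL j B) (\<lambda>k. of_real (cF j) * (RC (aL j A) (Zop j v) k - Zop j (RC A v) k)) i"
      using mult(3) by (intro RC_cong cl) simp
    also have "\<dots> = of_real (cF j) * (RC (aL j B) (RC (aL j A) (Zop j v)) i - RC (aL j B) (Zop j (RC A v)) i)"
      by (simp only: RC_vscale RC_vdiff)
    finally have 2: "RC (aL j B) (RC (aF j A) v) i = \<dots>" .
    have 3: "RC (aF j B) (RC A v) i =
        of_real (cF j) * (RC (aL j B) (Zop j (RC A v)) i - Zop j (RC B (RC A v)) i)"
      by (rule mult(4)[OF mult(5)])
    have 4: "RC (aL j (A \<otimes>\<^bsub>CA\<^esub> B)) (Zop j v) i = RC (aL j B) (RC (aL j A) (Zop j v)) i"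
      using cl by (simp add: act_gens_mult[OF j mult(1,2)] RC_mult)
    have 5: "RC (A \<otimes>\<^bsub>CA\<^esub> B) v = RC B (RC A v)"
      using cl by (simp add: RC_mult fun_eq_iff)
    show ?case
      unfolding 1 2 3 4 5 by (simp add: algebra_simps)
  qed
qed

section \<open>Invariance\<close>

lemma RC_vdiv: "RC A (\<lambda>k. v k / c) i = RC A v i / c"
  using RC_vscale[of A "1 / c" v i] by simp

lemma eps_sq_complex [simp]: "complex_of_real (eps k) * complex_of_real (eps k) = 1"
  "complex_of_real (eps k) * (complex_of_real (eps k) * z) = z"
  by (auto simp: eps_def)

text \<open>The eigenvalue equation for the automorphism, rewritten by \<open>Rop_gam\<close> as a
  property of the operators.\<close>

definition GU :: "complex \<Rightarrow> cgen fa set \<Rightarrow> bool" where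
  "GU c A \<longleftrightarrow> (\<forall>v. \<forall>i\<in>Bh. RC A v (U i) = c * RC A (\<lambda>k. v (U k)) i)"

text \<open>Membership in the eigenspace enters the computation of the form through these
  properties, and they are seen directly to pass from an element to its images under the
  action.\<close>

definition inV :: "complex \<Rightarrow> cgen fa set \<Rightarrow> bool" where
  "inV c A \<longleftrightarrow> A \<in> carrier CA \<and> D0 A \<and> GU c A"

lemma GU_D: "GU c A \<Longrightarrow> i \<in> Bh \<Longrightarrow> RC A v (U i) = c * RC A (\<lambda>k. v (U k)) i"
  by (simp add: GU_def)

lemma inV_D: "inV c A \<Longrightarrow> A \<in> carrier CA" "inV c A \<Longrightarrow> D0 A" "inV c A \<Longrightarrow> GU c A"
  by (simp_all add: inV_def)

lemma inV_add: "inV c A \<Longrightarrow> inV c B \<Longrightarrow> inV c (A \<oplus>\<^bsub>CA\<^esub> B)"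
  by (simp add: inV_def D0_def GU_def RC_add distrib_left)

lemma inV_scale: "inV c A \<Longrightarrow> inV c (cone_scale q n m d A)"
  by (simp add: inV_def D0_def GU_def RC_scale mult.left_commute)

text \<open>\<open>U\<close> moves only coordinates 1 and \<open>N\<close>, each by a fixed amount.
  The resulting constant cancels in a conjugation.\<close>

lemma kap_U:
  assumes "1 \<le> j" "j < N"
  shows "\<exists>s>0. \<forall>i. kap j (U i) = s * kap j i"
proof -
  define e :: int where "e = (if j + 1 = N then - 1 else 0) - (if j = 1 then 1 else 0)"
  have "U i (j + 1) - U i j = e + (i (j + 1) - i j)" for i
    using assms N_ne by (auto simp: U_def e_def)
  then have "kap j (U i) = q powi e * kap j i" for i
    by (simp only: kap_def powi_add)
  then show ?thesis
    using powi_pos by blast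
qed

lemma inV_K:
  assumes j: "1 \<le> j" "j < N" and A: "inV c A"
  shows "inV c (aK j A)" "inV c (aL j A)"
proof -
  note cl = inV_D(1)[OF A]
  obtain s where s: "s > 0" "\<And>i. kap j (U i) = s * kap j i" using kap_U[OF j] by blast
  show "inV c (aK j A)"
    unfolding inV_def D0_def GU_def
  proof (intro conjI allI ballI)
    show "aK j A \<in> carrier CA" using j cl by simp
    fix i assume i: "i \<in> Bh"
    show "RC (aK j A) (\<lambda>k. \<tau> (tot k) * v k) i = \<tau> (tot i) * RC (aK j A) v i" for \<tau> v
      using D0_D[OF inV_D(2)[OF A] i, of \<tau> "\<lambda>k. of_real (kap j k) * v k"]
      by (simp add: RC_K[OF j cl] i mult.left_commute)
    show "RC (aK j A) v (U i) = c * RC (aK j A) (\<lambda>k. v (U k)) i" for v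
      using GU_D[OF inV_D(3)[OF A] i, of "\<lambda>k. of_real (kap j k) * v k"] s(1)
        RC_vscale[of A "of_real s" "\<lambda>k. of_real (kap j k) * v (U k)" i]
      by (simp add: RC_K[OF j cl] i s(2) mult.assoc)
  qed
  show "inV c (aL j A)"
    unfolding inV_def D0_def GU_def
  proof (intro conjI allI ballI)
    show "aL j A \<in> carrier CA" using j cl by simp
    fix i assume i: "i \<in> Bh"
    show "RC (aL j A) (\<lambda>k. \<tau> (tot k) * v k) i = \<tau> (tot i) * RC (aL j A) v i" for \<tau> v
      using D0_D[OF inV_D(2)[OF A] i, of \<tau> "\<lambda>k. v k / of_real (kap j k)"]
      by (simp add: RC_K[OF j cl] i mult.left_commute)
    show "RC (aL j A) v (U i) = c * RC (aL j A) (\<lambda>k. v (U k)) i" for v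
      using GU_D[OF inV_D(3)[OF A] i, of "\<lambda>k. v k / of_real (kap j k)"] s(1)
        RC_vscale[of A "1 / of_real s" "\<lambda>k. v (U k) / of_real (kap j k)" i]
      by (simp add: RC_K[OF j cl] i s(2))
  qed
qed

lemma tot_sg: "1 \<le> j \<Longrightarrow> j < N \<Longrightarrow> tot (sg j i) = tot i" "1 \<le> j \<Longrightarrow> j < N \<Longrightarrow> tot (sgi j i) = tot i"
  by (simp_all add: tot_def sg_def sgi_def idx_sum_upd)

lemma sg_U: "sg j (U i) = U (sg j i)" "sgi j (U i) = U (sgi j i)"
  by (auto simp: sg_def sgi_def U_def fun_eq_iff)

text \<open>The automorphism fixes y_j: the factor q^2 of the two generators cancels against that of
  \<xi>_(j+1).\<close>

lemma ycoef_U: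
  assumes "1 \<le> j" "j < N"
  shows "ycoef j (U i) = ycoef j i"
proof -
  have "(U i)(j + 1 := U i (j + 1) + 1) = U (i(j + 1 := i (j + 1) + 1))"
    using sft_U[of "Ts (j + 1)" i] by simp
  moreover have "xx (j + 1) (U i) = q\<^sup>2 * xx (j + 1) i"
    using assms idx_sum_U[of "j + 1" i] by (simp add: xx_def powi_double powi_add power_mult_distrib)
  ultimately show ?thesis
    using assms by (simp add: ycoef_def C_U power2_eq_square)
qed

lemma YZ_U:
  assumes "1 \<le> j" "j < N"
  shows "Yop j v (U i) = Yop j (\<lambda>k. v (U k)) i" "Zop j v (U i) = Zop j (\<lambda>k. v (U k)) i"
  using ycoef_U[OF assms] by (simp_all add: Yop_def Zop_def sg_U)

lemma YZ_tot:
  assumes "1 \<le> j" "j < N"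
  shows "Yop j (\<lambda>k. \<tau> (tot k) * v k) i = \<tau> (tot i) * Yop j v i"
    "Zop j (\<lambda>k. \<tau> (tot k) * v k) i = \<tau> (tot i) * Zop j v i"
  using tot_sg[OF assms] by (simp_all add: Yop_def Zop_def)

text \<open>By \<open>RC_E\<close> the element is built from \<open>A\<close>, from its image under
  K_j and from y_j; the latter preserves totals and commutes with \<open>U\<close>.\<close>

lemma inV_E:
  assumes j: "1 \<le> j" "j < N" and A: "inV c A"
  shows "inV c (aE j A)"
  unfolding inV_def D0_def GU_def
proof (intro conjI allI ballI)
  note cl = inV_D(1)[OF A]
  note K = inV_K(1)[OF j A]
  show "aE j A \<in> carrier CA" using j cl by simp
  fix i assume i: "i \<in> Bh"
  show "RC (aE j A) (\<lambda>k. \<tau> (tot k) * v k) i = \<tau> (tot i) * RC (aE j A) v i" for \<tau> v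
  proof -
    have "RC A (Yop j (\<lambda>k. \<tau> (tot k) * v k)) i = \<tau> (tot i) * RC A (Yop j v) i"
      unfolding D0_D[OF inV_D(2)[OF A] i, symmetric] by (intro RC_cong cl YZ_tot j)
    moreover have "Yop j (RC (aK j A) (\<lambda>k. \<tau> (tot k) * v k)) i = \<tau> (tot i) * Yop j (RC (aK j A) v) i"
      unfolding YZ_tot(1)[OF j, symmetric] by (intro Yop_cong j D0_D inV_D(2)[OF K])
    ultimately show ?thesis
      by (simp add: RC_E[OF j cl i] algebra_simps)
  qed
  show "RC (aE j A) v (U i) = c * RC (aE j A) (\<lambda>k. v (U k)) i" for v
  proof -
    have "RC A (Yop j v) (U i) = c * RC A (Yop j (\<lambda>k. v (U k))) i"
      unfolding GU_D[OF inV_D(3)[OF A] i] YZ_U(1)[OF j] ..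
    moreover have "Yop j (RC (aK j A) v) (U i) = c * Yop j (RC (aK j A) (\<lambda>k. v (U k))) i"
      unfolding YZ_U(1)[OF j] Yop_vscale[symmetric] by (intro Yop_cong j GU_D inV_D(3)[OF K])
    moreover have "U i \<in> Bh" using i by simp
    ultimately show ?thesis
      by (simp add: RC_E[OF j cl] i algebra_simps)
  qed
qed

lemma inV_F:
  assumes j: "1 \<le> j" "j < N" and A: "inV c A"
  shows "inV c (aF j A)"
  unfolding inV_def D0_def GU_def
proof (intro conjI allI ballI)
  note cl = inV_D(1)[OF A]
  note L = inV_K(2)[OF j A]
  show "aF j A \<in> carrier CA" using j cl by simp
  fix i assume i: "i \<in> Bh"
  show "RC (aF j A) (\<lambda>k. \<tau> (tot k) * v k) i = \<tau> (tot i) * RC (aF j A) v i" for \<tau> v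
  proof -
    have "RC (aL j A) (Zop j (\<lambda>k. \<tau> (tot k) * v k)) i = \<tau> (tot i) * RC (aL j A) (Zop j v) i"
      unfolding D0_D[OF inV_D(2)[OF L] i, symmetric] by (intro RC_cong inV_D(1)[OF L] YZ_tot j)
    moreover have "Zop j (RC A (\<lambda>k. \<tau> (tot k) * v k)) i = \<tau> (tot i) * Zop j (RC A v) i"
      unfolding YZ_tot(2)[OF j, symmetric] by (intro Zop_cong j D0_D inV_D(2)[OF A])
    ultimately show ?thesis
      by (simp add: RC_F[OF j cl i] algebra_simps)
  qed
  show "RC (aF j A) v (U i) = c * RC (aF j A) (\<lambda>k. v (U k)) i" for v
  proof -
    have "RC (aL j A) (Zop j v) (U i) = c * RC (aL j A) (Zop j (\<lambda>k. v (U k))) i"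
      unfolding GU_D[OF inV_D(3)[OF L] i] YZ_U(2)[OF j] ..
    moreover have "Zop j (RC A v) (U i) = c * Zop j (RC A (\<lambda>k. v (U k))) i"
      unfolding YZ_U(2)[OF j] Zop_vscale[symmetric] by (intro Zop_cong j GU_D inV_D(3)[OF A])
    moreover have "U i \<in> Bh" using i by simp
    ultimately show ?thesis
      by (simp add: RC_F[OF j cl] i algebra_simps)
  qed
qed

lemma inV_act:
  assumes "a \<in> UF" "inV c A"
  shows "inV c (act (uc a) A)"
  using assms
proof (induction a arbitrary: A rule: free_alg_induct)
  case (scal d)
  then show ?case by (simp add: act_uscal inV_D inV_scale)
next
  case (gen x)
  then show ?case by (cases x) (auto intro: inV_E inV_F inV_K)
next
  case (add a b)
  then show ?case by (simp add: act_uadd inV_D inV_add)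
next
  case (mult a b)
  then show ?case by (simp add: act_umult inV_D)
qed

subsection \<open>Invariance under the generators\<close>

text \<open>The matrix entry from \<open>i\<close> to \<open>k\<close> is multiplied by a quotient
  of values of \<open>kap\<close>, which is real and can therefore be moved to the other
  argument.\<close>

lemma Phi_K:
  assumes j: "1 \<le> j" "j < N" and A: "A \<in> carrier CA" and B: "B \<in> carrier CA"
  shows "Phi (aK j A) B = Phi A (aK j B)" "Phi (aL j A) B = Phi A (aL j B)"
proof -
  show "Phi (aK j A) B = Phi A (aK j B)"
    unfolding Phi_def
  proof (rule infsum_cong)
    fix i assume "i \<in> X"
    then have i: "i \<in> Bh" by (rule X_D)
    have "row (aK j B) i = (\<lambda>k. (1 / of_real (kap j i)) * (of_real (kap j k) * row B i k))"
    proof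
      fix k
      have "(\<lambda>x. of_real (kap j x) * dl k x) = (\<lambda>x. of_real (kap j k) * dl k x)"
        by (auto simp: dl_def)
      then show "row (aK j B) i k = (1 / of_real (kap j i)) * (of_real (kap j k) * row B i k)"
        by (simp add: row_def RC_K[OF j B i] RC_vscale)
    qed
    then show "of_real (Q i) * RC (aK j A) (row B i) i = of_real (Q i) * RC A (row (aK j B) i) i"
      by (simp only: RC_vscale RC_K[OF j A i]) simp
  qed
  show "Phi (aL j A) B = Phi A (aL j B)"
    unfolding Phi_def
  proof (rule infsum_cong)
    fix i assume "i \<in> X"
    then have i: "i \<in> Bh" by (rule X_D)
    have "row (aL j B) i = (\<lambda>k. of_real (kap j i) * (row B i k / of_real (kap j k)))"
    proof
      fix k
      have "(\<lambda>x. dl k x / complex_of_real (kap j x)) = (\<lambda>x. dl k x / of_real (kap j k))"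
        by (auto simp: dl_def)
      then show "row (aL j B) i k = of_real (kap j i) * (row B i k / of_real (kap j k))"
        by (simp add: row_def RC_K[OF j B i] RC_vdiv)
    qed
    then show "of_real (Q i) * RC (aL j A) (row B i) i = of_real (Q i) * RC A (row (aL j B) i) i"
      by (simp only: RC_vscale RC_K[OF j A i])
  qed
qed

lemma kap_sg: "kap j (sg j i) = q\<^sup>2 * kap j i"
proof -
  have "sg j i (j + 1) - sg j i j = 2 + (i (j + 1) - i j)"
    by (simp add: sg_def)
  then show ?thesis by (simp only: kap_def powi_add) simp
qed

lemma kap_sgi: "q\<^sup>2 * kap j (sgi j i) = kap j i"
  using kap_sg[of j "sgi j i"] by simp

text \<open>Conjugation by \<open>kap\<close> multiplies the adjoint of y_j by q^(-2), so K_j F_j is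
  a twisted commutator of the same shape as E_j with y_j replaced by its adjoint. The constants
  differ by a sign that is -1 exactly for j = n, the sign in the involution.\<close>

lemma RC_Estar:
  assumes j: "1 \<le> j" "j < N" and B: "B \<in> carrier CA" and i: "i \<in> Bh"
  shows "RC (aK j (aF j B)) v i =
    of_real (eps j * eps (j + 1) * cE j) * (RC B (Zop j v) i - Zop j (RC (aK j B) v) i)"
proof -
  let ?w = "\<lambda>k. of_real (kap j k) * v k"
  have FB: "aF j B \<in> carrier CA" using j B by simp
  have "(\<lambda>k. Zop j ?w k / of_real (kap j k)) = (\<lambda>k. of_real (1 / q\<^sup>2) * Zop j v k)"
  proof
    fix k
    show "Zop j ?w k / of_real (kap j k) = of_real (1 / q\<^sup>2) * Zop j v k"
      by (simp add: Zop_def kap_sgi[of j k, symmetric])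
  qed
  then have 1: "RC B (\<lambda>k. Zop j ?w k / of_real (kap j k)) i = of_real (1 / q\<^sup>2) * RC B (Zop j v) i"
    by (simp only: RC_vscale)
  have 2: "Zop j (RC B ?w) i = of_real (kap j i / q\<^sup>2) * Zop j (RC (aK j B) v) i"
  proof -
    have "Zop j (RC B ?w) i = Zop j (\<lambda>k. of_real (kap j k) * RC (aK j B) v k) i"
      by (intro Zop_cong j) (simp add: RC_K[OF j B])
    also have "\<dots> = of_real (kap j i / q\<^sup>2) * Zop j (RC (aK j B) v) i"
      by (simp add: Zop_def kap_sgi[of j i, symmetric])
    finally show ?thesis .
  qed
  have c: "cF j / q\<^sup>2 = eps j * eps (j + 1) * cE j"
    by (simp add: cF_def cE_def q_powr(3))
  have "RC (aK j (aF j B)) v i = of_real (cF j) * (RC (aL j B) (Zop j ?w) i - Zop j (RC B ?w) i) / of_real (kap j i)"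
    by (simp add: RC_K[OF j FB i] RC_F[OF j B i])
  also have "\<dots> = of_real (cF j) * (of_real (kap j i) * (of_real (1 / q\<^sup>2) * RC B (Zop j v) i)
      - of_real (kap j i / q\<^sup>2) * Zop j (RC (aK j B) v) i) / of_real (kap j i)"
    unfolding RC_K(2)[OF j B i] 1 2 ..
  also have "\<dots> = of_real (cF j / q\<^sup>2) * (RC B (Zop j v) i - Zop j (RC (aK j B) v) i)"
    by (simp add: field_simps)
  finally show ?thesis unfolding c .
qed

text \<open>The denominator is q^(2s) with s the partial sum up to \<open>j\<close>, the numerator
  at most q^(s + lev - 1), and s exceeds the level by at most \<open>nrm i\<close>.\<close>

lemma ycoef_bound:
  assumes j: "1 \<le> j" "j < N" and i: "i \<in> Bh"
  shows "\<bar>ycoef j i\<bar> \<le> q powi (- 1) * q powi (- nrm i)"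
proof (cases "i(j + 1 := i (j + 1) + 1) \<in> Bh")
  case False
  then show ?thesis using C_up_0[OF i, of "j + 1"] j by (simp add: ycoef_def less_imp_le)
next
  case True
  define u where "u = i(j + 1 := i (j + 1) + 1)"
  have u: "u \<in> Bh" using True by (simp add: u_def)
  define s where "s = idx_sum (j + 1) i"
  have x: "xx (j + 1) i = q powi s * q powi s"
    using j by (simp add: xx_def s_def powi_double power2_eq_square)
  have su: "idx_sum (j + 1) u = s" "j + 1 \<le> n \<Longrightarrow> lev u = lev i + 1"
    using j by (simp_all add: u_def s_def idx_sum_upd)
  have s: "lev i \<le> s" "s \<le> lev i + nrm i"
    using idx_sum_bounds[OF i, of "j + 1"] j by (simp_all add: s_def)
  \<comment> \<open>One factor is estimated through s, the other through the level; their roles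
    depend on the side of \<open>n\<close>.\<close>
  have "\<bar>C (j + 1) u\<bar> * \<bar>C j i\<bar> \<le> q powi (s + lev i - 1)"
  proof (cases "j < n")
    case True
    have "\<bar>C (j + 1) u\<bar> \<le> q powi (lev i)"
      using C_bound(1)[OF u, of "j + 1"] su(2) True j by simp
    moreover have "\<bar>C j i\<bar> \<le> q powi (s - 1)"
      using C_bound(3)[OF i, of j] True j by (simp add: s_def)
    ultimately have "\<bar>C (j + 1) u\<bar> * \<bar>C j i\<bar> \<le> q powi (lev i) * q powi (s - 1)"
      by (intro mult_mono) (auto simp: less_imp_le)
    also have "\<dots> = q powi (s + lev i - 1)"
      by (simp flip: powi_add add: algebra_simps)
    finally show ?thesis .
  next
    case False
    have "\<bar>C (j + 1) u\<bar> \<le> q powi s"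
      using C_bound(2)[OF u, of "j + 1"] su(1) False j by simp
    moreover have "\<bar>C j i\<bar> \<le> q powi (lev i - 1)"
      using C_bound(1)[OF i, of j] j by simp
    ultimately have "\<bar>C (j + 1) u\<bar> * \<bar>C j i\<bar> \<le> q powi s * q powi (lev i - 1)"
      by (intro mult_mono) (auto simp: less_imp_le)
    also have "\<dots> = q powi (s + lev i - 1)"
      by (simp flip: powi_add add: algebra_simps)
    finally show ?thesis .
  qed
  then have "\<bar>ycoef j i\<bar> \<le> q powi (s + lev i - 1) / (q powi s * q powi s)"
    unfolding ycoef_def x u_def[symmetric] by (simp add: abs_mult divide_right_mono)
  also have "\<dots> = q powi (s + lev i - 1 - s - s)"
    by (simp only: powi_diff[of _ s]) simp
  also have "\<dots> \<le> q powi (- 1 + - nrm i)"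
    using s by (intro powi_mono) simp
  also have "\<dots> = q powi (- 1) * q powi (- nrm i)"
    by (rule powi_add)
  finally show ?thesis .
qed

text \<open>The weights of neighbouring coordinates differ by one. For j + 1 = N the second weight
  is 0, in agreement with the additional coordinate having none.\<close>

lemma Q_sg:
  assumes j: "1 \<le> j" "j < N"
  shows "Q (sg j i) = Q i / q\<^sup>2"
proof -
  have "(\<Sum>k\<in>{1..N-1}. int (N - k) * sg j i k) = (\<Sum>k\<in>{1..N-1}. int (N - k) * i k
      + ((if k = j then - int (N - j) else 0) + (if k = j + 1 then int (N - (j + 1)) else 0)))"
    by (intro sum.cong) (auto simp: sg_def algebra_simps)
  also have "\<dots> = (\<Sum>k\<in>{1..N-1}. int (N - k) * i k) - 1"
    using j by (auto simp: sum.distrib sum.delta)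
  finally have "Q (sg j i) = const * q powi (2 * (\<Sum>k\<in>{1..N-1}. int (N - k) * i k) - 2)"
    by (simp add: Q_def right_diff_distrib)
  then show ?thesis by (simp add: Q_def powi_diff)
qed

lemma Q_U: "Q (U i) = q ^ (2 * (N - 1)) * Q i"
proof -
  have "(\<Sum>k\<in>{1..N-1}. int (N - k) * U i k) = (\<Sum>k\<in>{1..N-1}. int (N - k) * i k
      + (if k = 1 then int (N - 1) else 0))"
    using N_ne by (intro sum.cong) (auto simp: U_def algebra_simps)
  also have "\<dots> = int (N - 1) + (\<Sum>k\<in>{1..N-1}. int (N - k) * i k)"
    using N_ne by (simp add: sum.distrib sum.delta)
  finally have "Q (U i) = const * (q powi (2 * int (N - 1)) * q powi (2 * (\<Sum>k\<in>{1..N-1}. int (N - k) * i k)))"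
    by (simp add: Q_def distrib_left powi_add)
  moreover have "q powi (2 * int (N - 1)) = q ^ (2 * (N - 1))"
    by (metis of_nat_mult of_nat_numeral power_int_of_nat)
  ultimately show ?thesis by (simp add: Q_def)
qed

text \<open>Write z for the adjoint of y_j. Then \<open>S i\<close>, \<open>T i\<close> and
  \<open>T' i\<close> are the inner products of y A e(i) with B e(i), of (K_j A) y e(i) with B e(i),
  and of A e(i) with (K_j B) z e(i). \<open>S\<close> is common to both sides, so what remains is
  the equality of the weighted sums of \<open>T\<close> and \<open>T'\<close>.\<close>

lemma Phi_E:
  assumes j: "1 \<le> j" "j < N" and A: "inV c A" and B: "inV c B"
    and c: "c * cnj c * of_real (q ^ (2 * (N - 1))) = 1"
  shows "Phi (aE j A) B = Phi A (cone_scale q n m (of_real (eps j * eps (j + 1))) (aK j (aF j B)))"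
proof -
  note cA = inV_D(1)[OF A] and cB = inV_D(1)[OF B]
  let ?B' = "cone_scale q n m (of_real (eps j * eps (j + 1))) (aK j (aF j B))"
  have cl: "aE j A \<in> carrier CA" "aK j A \<in> carrier CA" "aK j B \<in> carrier CA" "?B' \<in> carrier CA"
    using j cA cB by simp_all
  define S where "S i = RC A (Yop j (row B i)) i" for i
  define T where "T i = Yop j (RC (aK j A) (row B i)) i" for i
  define T' where "T' i = of_real (ycoef j (sgi j i)) * RC A (row (aK j B) (sgi j i)) i" for i
  have left: "RC (aE j A) (row B i) i = of_real (cE j) * (S i - T i)" if "i \<in> Bh" for i
    unfolding S_def T_def by (rule RC_E[OF j cA that])
  have Y: "RC B (Zop j (dl k)) i = of_real (ycoef j k) * RC B (dl (sg j k)) i" for i k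
  proof -
    have "RC B (Zop j (dl k)) i = RC B (\<lambda>x. of_real (ycoef j k) * dl (sg j k) x) i"
    proof (rule RC_cong[OF cB])
      fix x assume "x \<in> Bh"
      moreover have "sgi j x = k \<longleftrightarrow> x = sg j k" by (metis sg_sgi)
      ultimately show "Zop j (dl k) x = of_real (ycoef j k) * dl (sg j k) x"
        by (auto simp: Zop_def dl_def)
    qed
    then show ?thesis by (simp only: RC_vscale)
  qed
  have right: "RC A (row ?B' i) i = of_real (cE j) * (S i - T' i)" if i: "i \<in> Bh" for i
  proof -
    have "row ?B' i k = of_real (cE j) * (Yop j (row B i) k - of_real (ycoef j (sgi j i)) * row (aK j B) (sgi j i) k)"
      if k: "k \<in> Bh" for k
      using i k j cB by (simp add: row_def RC_scale RC_Estar Y) (simp add: Yop_def Zop_def mult.left_commute)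
    then have "RC A (row ?B' i) i =
      RC A (\<lambda>k. of_real (cE j) * (Yop j (row B i) k - of_real (ycoef j (sgi j i)) * row (aK j B) (sgi j i) k)) i"
      by (intro RC_cong cA)
    also have "\<dots> = of_real (cE j) * (S i - T' i)"
      by (simp only: RC_vscale RC_vdiff S_def T'_def)
    finally show ?thesis .
  qed
  obtain M where M: "0 \<le> M" "\<And>i k. i \<in> Bh \<Longrightarrow> \<bar>lev i\<bar> \<le> \<bar>l\<bar> \<Longrightarrow> norm (row B i k) \<le> M"
    using row_bound[OF cB] by metis
  have sumS: "(\<lambda>i. of_real (Q i) * S i) summable_on X"
  proof -
    obtain M' L where t: "tame_at A \<bar>l\<bar> M' L" using tame[OF cA] by blast
    show ?thesis
    proof (rule summable_Q)
      fix i assume "i \<in> X"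
      then have i: "i \<in> Bh" "\<bar>lev i\<bar> \<le> \<bar>l\<bar>" using X_D by auto
      let ?b = "(q powi (- 1) * q powi (- L) * M) * q powi (- nrm i)"
      have "norm (S i) \<le> M' * ?b"
        unfolding S_def
      proof (rule tame_atD[OF t i])
        show "0 \<le> ?b" using M(1) by (simp add: less_imp_le)
        fix k assume k: "k \<in> Bh" "near L i k"
        have "norm (Yop j (row B i) k) = \<bar>ycoef j k\<bar> * norm (row B i (sg j k))"
          using k by (simp add: Yop_def norm_mult)
        also have "\<dots> \<le> (q powi (- 1) * q powi (- nrm k)) * M"
          using ycoef_bound[OF j k(1)] M i by (intro mult_mono) (auto simp: less_imp_le)
        also have "q powi (- nrm k) \<le> q powi (- L + - nrm i)"
          using k(2) by (intro powi_mono) (simp add: near_def)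
        then have "(q powi (- 1) * q powi (- nrm k)) * M \<le> (q powi (- 1) * q powi (- L + - nrm i)) * M"
          using M(1) by (intro mult_right_mono mult_left_mono) (auto simp: less_imp_le)
        also have "\<dots> = ?b"
          unfolding powi_add by simp
        finally show "norm (Yop j (row B i) k) \<le> ?b" .
      qed
      then show "norm (S i) \<le> (M' * (q powi (- 1) * q powi (- L) * M)) * q powi (- nrm i)"
        by (simp only: mult.assoc)
    qed
  qed
  have sumT: "(\<lambda>i. of_real (Q i) * T i) summable_on X"
  proof -
    \<comment> \<open>\<open>T\<close> evaluates the operator at \<open>sg j i\<close>, whose level
      is one lower when j = n.\<close>
    obtain M' L where t: "tame_at (aK j A) (\<bar>l\<bar> + 1) M' L" using tame[OF cl(2)] by blast
    show ?thesis
    proof (rule summable_Q)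
      fix i assume "i \<in> X"
      then have i: "i \<in> Bh" "\<bar>lev i\<bar> \<le> \<bar>l\<bar>" using X_D by auto
      show "norm (T i) \<le> (q powi (- 1) * (M' * M)) * q powi (- nrm i)"
      proof (cases "sg j i \<in> Bh")
        case True
        have "norm (RC (aK j A) (row B i) (sg j i)) \<le> M' * M"
          using i lev_sg(1)[OF j(1), of i] M by (intro tame_atD[OF t True]) (auto split: if_splits)
        then have "norm (T i) \<le> (q powi (- 1) * q powi (- nrm i)) * (M' * M)"
          unfolding T_def using ycoef_bound[OF j i(1)] i
          by (simp add: Yop_def norm_mult del: powi_1) (intro mult_mono, auto simp: less_imp_le)
        then show ?thesis by (simp only: mult_ac)
      next
        case False
        then have "T i = 0" using i ycoef_0[OF j i(1)] by (simp add: T_def Yop_def)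
        moreover have "0 \<le> M'" using t by (simp add: tame_at_def)
        ultimately show ?thesis using M(1) by (simp add: less_imp_le)
      qed
    qed
  qed
  have cE: "cE j \<noteq> 0" using q2_ne by (simp add: cE_def eps_def)
  \<comment> \<open>\<open>T'\<close> is not estimated directly: by \<open>right\<close> it is
    \<open>S\<close> minus the summand of the form divided by \<open>cE j\<close>, and both are
    summable.\<close>
  have sumT': "(\<lambda>i. of_real (Q i) * T' i) summable_on X"
  proof -
    have "(\<lambda>i. of_real (Q i) * S i + (- 1 / of_real (cE j)) * (of_real (Q i) * RC A (row ?B' i) i)) summable_on X"
      by (intro summable_on_add sumS summable_on_cmult_right summable_Phi cA cl)
    moreover have "of_real (Q i) * S i + (- 1 / of_real (cE j)) * (of_real (Q i) * RC A (row ?B' i) i)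
        = of_real (Q i) * T' i" if "i \<in> X" for i
      unfolding right[OF X_D(1)[OF that]] using cE by (simp add: field_simps)
    ultimately show ?thesis
      by (metis (no_types, lifting) summable_on_cong)
  qed
  \<comment> \<open>The factor q^2 from \<open>kap_sg\<close> cancels the one from
    \<open>Q_sg\<close>.\<close>
  have TT: "of_real (Q i) * T i = of_real (Q (sg j i)) * T' (sg j i)" if i: "i \<in> Bh" "sg j i \<in> Bh" for i
  proof -
    have "row (aK j B) i = (\<lambda>k. (1 / of_real (kap j i)) * (of_real (kap j k) * row B i k))"
    proof
      fix k
      have "(\<lambda>x. of_real (kap j x) * dl k x) = (\<lambda>x. of_real (kap j k) * dl k x)"
        by (auto simp: dl_def)
      then show "row (aK j B) i k = (1 / of_real (kap j i)) * (of_real (kap j k) * row B i k)"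
        by (simp add: row_def RC_K[OF j cB i(1)] RC_vscale)
    qed
    then have "T' (sg j i) = of_real (ycoef j i) * (1 / of_real (kap j i) * RC A (\<lambda>k. of_real (kap j k) * row B i k) (sg j i))"
      by (simp only: T'_def sg_sgi RC_vscale)
    moreover have "T i = of_real (ycoef j i) * (RC A (\<lambda>k. of_real (kap j k) * row B i k) (sg j i) / of_real (q\<^sup>2 * kap j i))"
      using i by (simp add: T_def Yop_def RC_K[OF j cA] kap_sg)
    ultimately show ?thesis by (simp add: Q_sg[OF j])
  qed
  \<comment> \<open>Here the condition on \<open>c\<close> enters: A and K_j B contribute
    \<open>c\<close> and its conjugate, and the weight contributes q^(2(N-1)).\<close>
  have T'U: "of_real (Q (U i)) * T' (U i) = of_real (Q i) * T' i" if i: "i \<in> Bh" for i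
  proof (cases "sgi j i \<in> Bh")
    case False
    then show ?thesis
      using ycoef_sgi_0[OF j i] ycoef_U[OF j, of "sgi j i"] by (simp add: T'_def sg_U)
  next
    case True
    have "row (aK j B) (U (sgi j i)) (U k) = cnj c * row (aK j B) (sgi j i) k" for k
    proof -
      have "(\<lambda>x. dl (U k) (U x)) = dl k"
        unfolding dl_def by (metis UV(2))
      then show ?thesis
        using GU_D[OF inV_D(3)[OF inV_K(1)[OF j B]] True, of "dl (U k)"] by (simp add: row_def)
    qed
    then have "T' (U i) = c * cnj c * T' i"
      using GU_D[OF inV_D(3)[OF A] i, of "row (aK j B) (U (sgi j i))"]
      by (simp add: T'_def sg_U ycoef_U[OF j] RC_vscale)
    then have "of_real (Q (U i)) * T' (U i) = (c * cnj c * of_real (q ^ (2 * (N - 1)))) * (of_real (Q i) * T' i)"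
      by (simp add: Q_U)
    then show ?thesis unfolding c by simp
  qed
  \<comment> \<open>For j = n the shift lowers the level by one, and \<open>U\<close> brings the
    index back into \<open>X\<close> without changing the summand of \<open>T'\<close>.\<close>
  define \<phi> where "\<phi> i = (if j = n then U (sg j i) else sg j i)" for i
  define \<psi> where "\<psi> i = (if j = n then sgi j (V i) else sgi j i)" for i
  have lev_U: "lev (U i) = lev i + 1" "lev (V i) = lev i - 1" for i
  proof -
    show "lev (U i) = lev i + 1" for i using n m by (intro idx_sum_U) auto
    from this[of "V i"] show "lev (V i) = lev i - 1" by simp
  qed
  note lv = lev_U[folded Suc_eq_plus1] lev_sg[OF j(1), folded Suc_eq_plus1] lev_sg[OF n, folded Suc_eq_plus1]
  have tot_U: "tot (U i) = tot i" "tot (V i) = tot i" for i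
  proof -
    show "tot (U i) = tot i" for i using N_ne by (simp add: tot_def U_def idx_sum_upd)
    from this[of "V i"] show "tot (V i) = tot i" by simp
  qed
  have sg_V: "sgi k (V i) = V (sgi k i)" "sg k (V i) = V (sg k i)" for k i
    by (metis UV sg_U)+
  have "infsum (\<lambda>i. of_real (Q i) * T i) X = infsum (\<lambda>i. of_real (Q i) * T i) {i\<in>X. sg j i \<in> Bh}"
  proof (rule infsum_cong_neutral)
    fix i assume "i \<in> X - {i\<in>X. sg j i \<in> Bh}"
    then have "i \<in> Bh" "sg j i \<notin> Bh" using X_D by auto
    then show "of_real (Q i) * T i = 0"
      using ycoef_0[OF j] by (simp add: T_def Yop_def)
  qed auto
  also have "\<dots> = infsum (\<lambda>i. of_real (Q i) * T' i) {i\<in>X. sgi j i \<in> Bh}"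
  proof (rule infsum_reindex_bij_witness[where i = \<psi> and j = \<phi>])
    fix i assume i: "i \<in> {i\<in>X. sg j i \<in> Bh}"
    show "\<psi> (\<phi> i) = i" by (simp add: \<psi>_def \<phi>_def)
    show "\<phi> i \<in> {i\<in>X. sgi j i \<in> Bh}"
      using i X_D(1)[of i] j by (auto simp: \<phi>_def X_def lv tot_U sg_U tot_sg)
    show "of_real (Q (\<phi> i)) * T' (\<phi> i) = of_real (Q i) * T i"
      using i X_D(1)[of i] TT[of i] T'U[of "sg j i"] by (cases "j = n") (simp_all add: \<phi>_def)
  next
    fix i assume i: "i \<in> {i\<in>X. sgi j i \<in> Bh}"
    show "\<phi> (\<psi> i) = i" by (simp add: \<psi>_def \<phi>_def)
    show "\<psi> i \<in> {i\<in>X. sg j i \<in> Bh}"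
      using i X_D(1)[of i] j by (auto simp: \<psi>_def X_def lv tot_U sg_V tot_sg)
  qed
  also have "\<dots> = infsum (\<lambda>i. of_real (Q i) * T' i) X"
  proof (rule infsum_cong_neutral)
    fix i assume "i \<in> X - {i\<in>X. sgi j i \<in> Bh}"
    then have "i \<in> Bh" "sgi j i \<notin> Bh" using X_D by auto
    then show "of_real (Q i) * T' i = 0"
      using ycoef_sgi_0[OF j] by (simp add: T'_def)
  qed auto
  finally have main: "infsum (\<lambda>i. of_real (Q i) * T i) X = infsum (\<lambda>i. of_real (Q i) * T' i) X" .
  \<comment> \<open>The sum of a difference may be separated only because \<open>S\<close> and the
    other term are each summable.\<close>
  have split: "infsum (\<lambda>i. of_real (Q i) * (of_real (cE j) * (S i - R i))) X =
      of_real (cE j) * (infsum (\<lambda>i. of_real (Q i) * S i) X - infsum (\<lambda>i. of_real (Q i) * R i) X)"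
    if "(\<lambda>i. of_real (Q i) * R i) summable_on X" for R
  proof -
    have "infsum (\<lambda>i. of_real (Q i) * S i - of_real (Q i) * R i) X
        = infsum (\<lambda>i. of_real (Q i) * S i) X - infsum (\<lambda>i. of_real (Q i) * R i) X"
      using infsum_add[OF sumS summable_on_cmult_right[OF that, of "- 1"]]
        infsum_cmult_right'[of "- 1" "\<lambda>i. of_real (Q i) * R i" X] by simp
    moreover have "of_real (Q i) * (of_real (cE j) * (S i - R i)) =
       of_real (cE j) * (of_real (Q i) * S i - of_real (Q i) * R i)" for i
      by (simp add: algebra_simps)
    ultimately show ?thesis by (simp only: infsum_cmult_right')
  qed
  have "Phi (aE j A) B = infsum (\<lambda>i. of_real (Q i) * (of_real (cE j) * (S i - T i))) X"
    unfolding Phi_def by (rule infsum_cong) (simp add: left X_D)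
  also have "\<dots> = infsum (\<lambda>i. of_real (Q i) * (of_real (cE j) * (S i - T' i))) X"
    unfolding split[OF sumT] split[OF sumT'] main ..
  also have "\<dots> = Phi A ?B'"
    unfolding Phi_def by (rule infsum_cong) (simp only: right X_D)
  finally show ?thesis .
qed

end

section \<open>The involution of the quantum group\<close>

text \<open>In each of the three Serre words, moving the k's to the left of the f's produces one
  factor t and two factors r, whose product is 1. So a Serre polynomial in the products k f and k'
  f' is the commuting prefactor times the one in f and f'.\<close>

lemma (in Group.monoid) qcomm_words:
  assumes cl: "k \<in> carrier G" "f \<in> carrier G" "k' \<in> carrier G" "f' \<in> carrier G" "t \<in> carrier G" "r \<in> carrier G"
    and t: "k \<otimes> t = t \<otimes> k" "f \<otimes> t = t \<otimes> f" "k' \<otimes> t = t \<otimes> k'" "f' \<otimes> t = t \<otimes> f'"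
    and r: "k \<otimes> r = r \<otimes> k" "f \<otimes> r = r \<otimes> f" "k' \<otimes> r = r \<otimes> k'" "f' \<otimes> r = r \<otimes> f'" "r \<otimes> t = t \<otimes> r"
    and tr: "t \<otimes> (r \<otimes> r) = \<one>"
    and fk: "f \<otimes> k = t \<otimes> (k \<otimes> f)" "f \<otimes> k' = r \<otimes> (k' \<otimes> f)" "f' \<otimes> k = r \<otimes> (k \<otimes> f')"
  shows "(k \<otimes> f) \<otimes> (k \<otimes> f) \<otimes> (k' \<otimes> f') = (k \<otimes> k \<otimes> k') \<otimes> (f \<otimes> f \<otimes> f')"
    and "(k \<otimes> f) \<otimes> (k' \<otimes> f') \<otimes> (k \<otimes> f) = (k \<otimes> k' \<otimes> k) \<otimes> (f \<otimes> f' \<otimes> f)"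
    and "(k' \<otimes> f') \<otimes> (k \<otimes> f) \<otimes> (k \<otimes> f) = (k' \<otimes> k \<otimes> k) \<otimes> (f' \<otimes> f \<otimes> f)"
proof -
  have assoc: "x \<otimes> (y \<otimes> z) = u \<otimes> (w \<otimes> z)"
    if "x \<otimes> y = u \<otimes> w" "x \<in> carrier G" "y \<in> carrier G" "u \<in> carrier G" "w \<in> carrier G" "z \<in> carrier G"
    for x y u w z
    using that by (metis m_assoc)
  have assoc3: "x \<otimes> (y \<otimes> z) = s \<otimes> (u \<otimes> (w \<otimes> z))"
    if "x \<otimes> y = s \<otimes> (u \<otimes> w)" "x \<in> carrier G" "y \<in> carrier G" "u \<in> carrier G" "w \<in> carrier G"
      "z \<in> carrier G" "s \<in> carrier G" for x y u w z s
    using that by (metis m_assoc m_closed)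
  note rules = t r fk assoc[OF t(1)] assoc[OF t(2)] assoc[OF t(3)] assoc[OF t(4)]
    assoc[OF r(1)] assoc[OF r(2)] assoc[OF r(3)] assoc[OF r(4)] assoc[OF r(5)]
    assoc3[OF fk(1)] assoc3[OF fk(2)] assoc3[OF fk(3)]
  have trz: "t \<otimes> (r \<otimes> (r \<otimes> z)) = z" if "z \<in> carrier G" for z
  proof -
    have "t \<otimes> (r \<otimes> (r \<otimes> z)) = (t \<otimes> (r \<otimes> r)) \<otimes> z"
      using that cl by (simp add: m_assoc)
    then show ?thesis using tr that by simp
  qed
  show "(k \<otimes> f) \<otimes> (k \<otimes> f) \<otimes> (k' \<otimes> f') = (k \<otimes> k \<otimes> k') \<otimes> (f \<otimes> f \<otimes> f')"
    "(k \<otimes> f) \<otimes> (k' \<otimes> f') \<otimes> (k \<otimes> f) = (k \<otimes> k' \<otimes> k) \<otimes> (f \<otimes> f' \<otimes> f)"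
    "(k' \<otimes> f') \<otimes> (k \<otimes> f) \<otimes> (k \<otimes> f) = (k' \<otimes> k \<otimes> k) \<otimes> (f' \<otimes> f \<otimes> f)"
    using cl by (simp_all add: m_assoc rules trz)
qed

context cone
begin

abbreviation "ustar \<equiv> lift_star (ugen_star n)"

lemma uc_eq_iff: "a \<in> UF \<Longrightarrow> b \<in> UF \<Longrightarrow> uc a = uc b \<longleftrightarrow> a - b \<in> u.I"
  by (simp add: uq_cls_eq u.cls_eq_iff)

lemma uc_relI: "a \<in> UF \<Longrightarrow> b \<in> UF \<Longrightarrow> a - b \<in> UR \<Longrightarrow> uc a = uc b"
  by (simp add: uc_eq_iff u.Idl_rel)

lemma ugen_star_UF: "x \<in> UG \<Longrightarrow> ugen_star n x \<in> UF"
  by (cases x) auto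

lemma ustar_UF: "a \<in> UF \<Longrightarrow> ustar a \<in> UF"
  by (rule lift_star_closed) (simp_all add: ugen_star_UF)

lemma uq_monoid: "Group.monoid UA"
  using u.presented_ring unfolding uq_alg_eq by (simp add: ring.is_monoid)

lemma uc_mult_sym: "a \<in> UF \<Longrightarrow> b \<in> UF \<Longrightarrow> uc (a * b) = uc a \<otimes>\<^bsub>UA\<^esub> uc b"
  by (simp add: uc_mult)

lemma uc_scal_comm: "a \<in> UF \<Longrightarrow> uc a \<otimes>\<^bsub>UA\<^esub> uc (scal c) = uc (scal c) \<otimes>\<^bsub>UA\<^esub> uc a"
  by (simp add: uc_mult scal_central)

lemma UF_gens:
  assumes "i \<in> {1..N-1}"
  shows "gen (Eg i) \<in> UF" "gen (Fg i) \<in> UF" "gen (Kg i) \<in> UF" "gen (Ki i) \<in> UF"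
  using assms by simp_all

lemma uq_relI:
  assumes ij: "i \<in> {1..N-1}" "j \<in> {1..N-1}"
  shows "uc (gen (Kg i) * gen (Ki i)) = uc 1" "uc (gen (Ki i) * gen (Kg i)) = uc 1"
    "uc (gen (Kg i) * gen (Kg j)) = uc (gen (Kg j) * gen (Kg i))"
    "uc (gen (Kg i) * gen (Eg j)) = uc (scal (of_real (q powi cartan i j)) * gen (Eg j) * gen (Kg i))"
    "uc (gen (Kg i) * gen (Fg j)) = uc (scal (of_real (q powi (- cartan i j))) * gen (Fg j) * gen (Kg i))"
    "i \<noteq> j \<Longrightarrow> uc (gen (Eg i) * gen (Fg j)) = uc (gen (Fg j) * gen (Eg i))"
    "gen (Eg i) * gen (Fg i) - gen (Fg i) * gen (Eg i)
        - scal (of_real (1 / (q - inverse q))) * (gen (Kg i) - gen (Ki i)) \<in> u.I"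
    "cartan i j = - 1 \<Longrightarrow> serre q (gen (Eg i)) (gen (Eg j)) \<in> u.I"
    "cartan i j = - 1 \<Longrightarrow> serre q (gen (Fg i)) (gen (Fg j)) \<in> u.I"
    "cartan i j = 0 \<Longrightarrow> uc (gen (Eg i) * gen (Eg j)) = uc (gen (Eg j) * gen (Eg i))"
    "cartan i j = 0 \<Longrightarrow> uc (gen (Fg i) * gen (Fg j)) = uc (gen (Fg j) * gen (Fg i))"
proof -
  let ?S = "\<lambda>i j. {gen (Kg i) * gen (Ki i) - 1, gen (Ki i) * gen (Kg i) - 1,
      gen (Kg i) * gen (Kg j) - gen (Kg j) * gen (Kg i),
      gen (Kg i) * gen (Eg j) - scal (of_real (q powi cartan i j)) * gen (Eg j) * gen (Kg i),
      gen (Kg i) * gen (Fg j) - scal (of_real (q powi (- cartan i j))) * gen (Fg j) * gen (Kg i),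
      gen (Eg i) * gen (Fg j) - gen (Fg j) * gen (Eg i)
        - (if i = j then scal (of_real (1 / (q - inverse q))) * (gen (Kg i) - gen (Ki i)) else 0)}
     \<union> (if cartan i j = -1 then
          {serre q (gen (Eg i)) (gen (Eg j)), serre q (gen (Fg i)) (gen (Fg j))}
        else if cartan i j = 0 then
          {gen (Eg i) * gen (Eg j) - gen (Eg j) * gen (Eg i),
           gen (Fg i) * gen (Fg j) - gen (Fg j) * gen (Fg i)}
        else {})"
  have sub: "?S i j \<subseteq> UR" "?S i i \<subseteq> UR"
    unfolding uq_rels_def using ij by blast+
  note g = UF_gens[OF ij(1)] UF_gens[OF ij(2)]
  show "uc (gen (Kg i) * gen (Ki i)) = uc 1" "uc (gen (Ki i) * gen (Kg i)) = uc 1"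
    "uc (gen (Kg i) * gen (Kg j)) = uc (gen (Kg j) * gen (Kg i))"
    "uc (gen (Kg i) * gen (Eg j)) = uc (scal (of_real (q powi cartan i j)) * gen (Eg j) * gen (Kg i))"
    "uc (gen (Kg i) * gen (Fg j)) = uc (scal (of_real (q powi (- cartan i j))) * gen (Fg j) * gen (Kg i))"
    by (rule uc_relI; (intro free_alg_closed g)?; use sub(1) in blast)+
  show "uc (gen (Eg i) * gen (Fg j)) = uc (gen (Fg j) * gen (Eg i))" if "i \<noteq> j"
    by (rule uc_relI; (intro free_alg_closed g)?) (use sub(1) that in auto)
  show "gen (Eg i) * gen (Fg i) - gen (Fg i) * gen (Eg i)
        - scal (of_real (1 / (q - inverse q))) * (gen (Kg i) - gen (Ki i)) \<in> u.I"
    by (rule u.Idl_rel) (use sub(2) in auto)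
  show "serre q (gen (Eg i)) (gen (Eg j)) \<in> u.I" "serre q (gen (Fg i)) (gen (Fg j)) \<in> u.I" if "cartan i j = - 1"
    by (rule u.Idl_rel, use sub(1) that in auto)+
  show "uc (gen (Eg i) * gen (Eg j)) = uc (gen (Eg j) * gen (Eg i))"
    "uc (gen (Fg i) * gen (Fg j)) = uc (gen (Fg j) * gen (Fg i))" if "cartan i j = 0"
    by (rule uc_relI; (intro free_alg_closed g)?; use sub(1) that in auto)+
qed

lemma cartan_sym: "cartan i j = cartan j i"
  by (auto simp: cartan_def)

abbreviation "uE i \<equiv> uc (gen (Eg i))"
abbreviation "uF i \<equiv> uc (gen (Fg i))"
abbreviation "uK i \<equiv> uc (gen (Kg i))"
abbreviation "uL i \<equiv> uc (gen (Ki i))"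
abbreviation um (infixl \<open>\<odot>\<close> 70) where "x \<odot> y \<equiv> x \<otimes>\<^bsub>UA\<^esub> y"
abbreviation "us c \<equiv> uc (scal c)"

lemma us_mult: "us a \<odot> us b = us (a * b)"
  by (simp add: uc_mult)

lemma uq_comm:
  assumes ij: "i \<in> {1..N-1}" "j \<in> {1..N-1}"
  shows "uF j \<odot> uK i = us (of_real (q powi cartan i j)) \<odot> (uK i \<odot> uF j)"
    and "uL i \<odot> uE j = us (of_real (q powi (- cartan i j))) \<odot> (uE j \<odot> uL i)"
    and "uL i \<odot> uF j = us (of_real (q powi cartan i j)) \<odot> (uF j \<odot> uL i)"
    and "uE j \<odot> uK i = us (of_real (q powi (- cartan i j))) \<odot> (uK i \<odot> uE j)"
    and "uL i \<odot> uK j = uK j \<odot> uL i" "uL i \<odot> uL j = uL j \<odot> uL i" "uK i \<odot> uK j = uK j \<odot> uK i"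
    and "uK i \<odot> uL i = uc 1" "uL i \<odot> uK i = uc 1"
proof -
  interpret U: Group.monoid UA by (rule uq_monoid)
  note g = UF_gens[OF ij(1)] UF_gens[OF ij(2)]
  note c = g[THEN uc_closed] uc_closed[OF free_alg_scal]
  have one: "uc 1 = \<one>\<^bsub>UA\<^esub>"
    using u.cls_one by (simp add: uq_alg_eq uq_cls_eq)
  let ?p = "us (of_real (q powi cartan i j))" and ?m = "us (of_real (q powi (- cartan i j)))"
  have pm: "?p \<odot> ?m = \<one>\<^bsub>UA\<^esub>" "?m \<odot> ?p = \<one>\<^bsub>UA\<^esub>"
    unfolding us_mult one[symmetric] by (simp_all only: of_real_mult[symmetric] powi_add[symmetric]) simp_all
  have KL: "uK i \<odot> uL i = \<one>\<^bsub>UA\<^esub>" "uL i \<odot> uK i = \<one>\<^bsub>UA\<^esub>"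
    using uq_relI(1,2)[OF ij] g by (simp_all add: uc_mult_sym one)
  then show "uK i \<odot> uL i = uc 1" "uL i \<odot> uK i = uc 1" by (simp_all add: one)
  have KE: "uK i \<odot> uE j = ?p \<odot> (uE j \<odot> uK i)"
    using uq_relI(4)[OF ij] g by (simp add: uc_mult_sym U.m_assoc)
  have KF: "uK i \<odot> uF j = ?m \<odot> (uF j \<odot> uK i)"
    using uq_relI(5)[OF ij] g by (simp add: uc_mult_sym U.m_assoc)
  show KK: "uK i \<odot> uK j = uK j \<odot> uK i"
    using uq_relI(3)[OF ij] g by (simp add: uc_mult_sym)
  show "uF j \<odot> uK i = ?p \<odot> (uK i \<odot> uF j)"
    unfolding KF using c pm by (simp flip: U.m_assoc)
  show "uE j \<odot> uK i = ?m \<odot> (uK i \<odot> uE j)"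
    unfolding KE using c pm by (simp flip: U.m_assoc)
  \<comment> \<open>A commutation rule with K_i is multiplied by its inverse on both sides.\<close>
  have conj: "uL i \<odot> y = s \<odot> (y \<odot> uL i)"
    if y: "y \<in> carrier UA" and s: "s \<in> carrier UA" "uL i \<odot> s = s \<odot> uL i" and yK: "y \<odot> uK i = s \<odot> (uK i \<odot> y)" for y s
  proof -
    have "uL i \<odot> y = uL i \<odot> (y \<odot> uK i) \<odot> uL i"
      using c y KL by (simp add: U.m_assoc)
    also have "\<dots> = s \<odot> (uL i \<odot> uK i) \<odot> (y \<odot> uL i)"
      unfolding yK using c y s by (metis (no_types, lifting) U.m_assoc U.m_closed)
    also have "\<dots> = s \<odot> (y \<odot> uL i)"
      using c y s KL by simp
    finally show ?thesis .
  qed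
  show "uL i \<odot> uE j = ?m \<odot> (uE j \<odot> uL i)"
  proof (rule conj)
    show "uL i \<odot> ?m = ?m \<odot> uL i" using g by (simp add: uc_scal_comm)
    show "uE j \<odot> uK i = ?m \<odot> (uK i \<odot> uE j)" by fact
  qed (use c in simp_all)
  show "uL i \<odot> uF j = ?p \<odot> (uF j \<odot> uL i)"
  proof (rule conj)
    show "uL i \<odot> ?p = ?p \<odot> uL i" using g by (simp add: uc_scal_comm)
    show "uF j \<odot> uK i = ?p \<odot> (uK i \<odot> uF j)" by fact
  qed (use c in simp_all)
  show LK: "uL i \<odot> uK j = uK j \<odot> uL i"
    using conj[of "uK j" "\<one>\<^bsub>UA\<^esub>"] c KK by simp
  have KLj: "uK j \<odot> uL j = \<one>\<^bsub>UA\<^esub>" "uL j \<odot> uK j = \<one>\<^bsub>UA\<^esub>"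
    using uq_relI(1,2)[OF ij(2) ij(2)] g by (simp_all add: uc_mult_sym one)
  have "uL j \<odot> uK i = uK i \<odot> uL j"
  proof -
    have "uL j \<odot> uK i = uL j \<odot> (uK i \<odot> uK j) \<odot> uL j"
      using c KLj by (simp add: U.m_assoc)
    also have "\<dots> = (uL j \<odot> uK j) \<odot> uK i \<odot> uL j"
      unfolding KK using c by (simp add: U.m_assoc)
    finally show ?thesis using KLj c by simp
  qed
  then show "uL i \<odot> uL j = uL j \<odot> uL i"
    using conj[of "uL j" "\<one>\<^bsub>UA\<^esub>"] c by simp
qed

definition sn :: "nat \<Rightarrow> complex" where "sn j = (if j = n then - 1 else 1)"

lemma sn_sq [simp]: "sn j * sn j = 1" "sn j * (sn j * z) = z"
  by (simp_all add: sn_def)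

lemma ugen_star_sn:
  "ugen_star n (Eg j) = scal (sn j) * (gen (Kg j) * gen (Fg j))"
  "ugen_star n (Fg j) = scal (sn j) * (gen (Eg j) * gen (Ki j))"
  by (simp_all add: sn_def scal_uminus)

lemma scal_sandwich: "x * (scal s * y * scal c) = scal s * (scal c * (x * y))"
proof -
  have "scal s * y * scal c = scal (s * c) * y"
    by (simp add: scal_central[of c "scal s * y", symmetric] scal_assoc mult.commute)
  then show ?thesis
    by (simp only: mult_scal_left[of x] scal_assoc)
qed

lemma serre_scal: "serre q (scal a * x) (scal b * y) = scal (a * a * b) * serre q x y"
  unfolding serre_def scal_assoc scal_mult_mult
  by (simp add: right_diff_distrib distrib_left mult.assoc scal_assoc mult.commute mult.left_commute)

text \<open>The Serre polynomial has real coefficients and reads the same backwards.\<close>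

lemma serre_ustar: "ustar (serre q x y) = serre q (ustar x) (ustar y)"
  by (simp add: serre_def lift_simps algebra_simps mult_scal_left
      scal_central[symmetric, of _ "complex_of_real q + inverse (complex_of_real q)"])

text \<open>Lifts the word identities of \<open>qcomm_words\<close> to the Serre element: modulo the
  ideal it is a multiple, from both sides, of a Serre relation.\<close>

lemma serre_words:
  assumes cl: "x \<in> UF" "y \<in> UF" "x' \<in> UF" "y' \<in> UF" "a \<in> UF" "b \<in> UF"
    and e: "uc (x * x * y) = uc (a * (x' * x' * y') * b)" "uc (x * y * x) = uc (a * (x' * y' * x') * b)"
      "uc (y * x * x) = uc (a * (y' * x' * x') * b)"
    and s: "serre q x' y' \<in> u.I"
  shows "serre q x y \<in> u.I"
proof -
  let ?c = "complex_of_real (q + inverse q)"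
  have d: "x * x * y - a * (x' * x' * y') * b \<in> u.I" "x * y * x - a * (x' * y' * x') * b \<in> u.I"
    "y * x * x - a * (y' * x' * x') * b \<in> u.I"
    using e cl by (simp_all flip: uc_eq_iff)
  have 1: "serre q x y = x * x * y - scal ?c * (x * y * x) + y * x * x"
    by (simp only: serre_def mult.assoc)
  have 2: "a * serre q x' y' * b =
      a * (x' * x' * y') * b - scal ?c * (a * (x' * y' * x') * b) + a * (y' * x' * x') * b"
    unfolding serre_def by (simp only: mult.assoc distrib_left distrib_right right_diff_distrib left_diff_distrib mult_scal_left[of a])
  have "serre q x y = (x * x * y - a * (x' * x' * y') * b) - scal ?c * (x * y * x - a * (x' * y' * x') * b)
      + (y * x * x - a * (y' * x' * x') * b) + a * serre q x' y' * b"
    unfolding 1 2 right_diff_distrib by simp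
  also have "\<dots> \<in> u.I"
    by (intro u.Idl_add u.Idl_diff d u.Idl_mult(1)[OF d(2)] u.Idl_mult(2)[OF u.Idl_mult(1)[OF s]] free_alg_scal cl)
  finally show ?thesis .
qed

lemma serre_star_E:
  assumes ij: "i \<in> {1..N-1}" "j \<in> {1..N-1}" and c: "cartan i j = - 1"
  shows "ustar (serre q (gen (Eg i)) (gen (Eg j))) \<in> u.I"
proof -
  interpret U: Group.monoid UA by (rule uq_monoid)
  note g = UF_gens[OF ij(1)] UF_gens[OF ij(2)]
  note cl = g[THEN uc_closed] uc_closed[OF free_alg_scal]
  let ?K = "gen (Kg i)" and ?F = "gen (Fg i)" and ?K' = "gen (Kg j)" and ?F' = "gen (Fg j)"
  have cc: "cartan i i = 2" "cartan j i = - 1" using c by (auto simp: cartan_def split: if_splits)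
  have one: "us 1 = \<one>\<^bsub>UA\<^esub>"
    using u.cls_one by (simp add: uq_alg_eq uq_cls_eq)
  \<comment> \<open>The exponents are the Cartan entries 2 and -1 from moving K past F; their
    balance 2 - 1 - 1 = 0 gives \<open>tr\<close>.\<close>
  let ?t = "us (of_real (q powi 2))" and ?r = "us (of_real (q powi (- 1)))"
  have t: "uE i \<odot> ?t = ?t \<odot> uE i"
      "uF i \<odot> ?t = ?t \<odot> uF i"
      "uK i \<odot> ?t = ?t \<odot> uK i"
      "uL i \<odot> ?t = ?t \<odot> uL i"
      "uE j \<odot> ?t = ?t \<odot> uE j"
      "uF j \<odot> ?t = ?t \<odot> uF j"
      "uK j \<odot> ?t = ?t \<odot> uK j"
      "uL j \<odot> ?t = ?t \<odot> uL j"
    and r: "uE i \<odot> ?r = ?r \<odot> uE i"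
      "uF i \<odot> ?r = ?r \<odot> uF i"
      "uK i \<odot> ?r = ?r \<odot> uK i"
      "uL i \<odot> ?r = ?r \<odot> uL i"
      "uE j \<odot> ?r = ?r \<odot> uE j"
      "uF j \<odot> ?r = ?r \<odot> uF j"
      "uK j \<odot> ?r = ?r \<odot> uK j"
      "uL j \<odot> ?r = ?r \<odot> uL j"
    using g by (simp_all add: uc_scal_comm)
  have rt: "?r \<odot> ?t = ?t \<odot> ?r" by (simp only: us_mult mult.commute)
  have tr: "?t \<odot> (?r \<odot> ?r) = \<one>\<^bsub>UA\<^esub>"
    unfolding us_mult of_real_mult[symmetric] powi_add[symmetric] one[symmetric] by simp
  note W = U.qcomm_words[of "uK i" "uF i" "uK j" "uF j" ?t ?r, OF cl(3) cl(2) cl(7) cl(6) cl(9) cl(9) t(3) t(2) t(7) t(6) r(3) r(2) r(7) r(6) rt tr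
      uq_comm(1)[OF ij(1) ij(1), unfolded cc c] uq_comm(1)[OF ij(2) ij(1), unfolded cc c] uq_comm(1)[OF ij, unfolded cc c]]
  have KK: "uK j \<odot> uK i = uK i \<odot> uK j" using uq_comm(7)[OF ij] by simp
  have KKK: "uK i \<odot> uK j \<odot> uK i = uK i \<odot> uK i \<odot> uK j" "uK j \<odot> uK i \<odot> uK i = uK i \<odot> uK i \<odot> uK j"
    using cl KK by (simp_all add: U.m_assoc)
  have "serre q (?K * ?F) (?K' * ?F') \<in> u.I"
  proof (rule serre_words[where a = "?K * ?K * ?K'" and b = 1 and x' = ?F and y' = ?F'])
    show "serre q ?F ?F' \<in> u.I" by (rule uq_relI(9)[OF ij c])
  qed (use g W KKK in \<open>simp_all add: uc_mult_sym free_alg_closed\<close>)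
  then have "scal (sn i * sn i * sn j) * serre q (?K * ?F) (?K' * ?F') \<in> u.I"
    by (rule u.Idl_mult) simp
  then show ?thesis
    unfolding serre_ustar lift_star_gen ugen_star_sn serre_scal .
qed

lemma serre_star_F:
  assumes ij: "i \<in> {1..N-1}" "j \<in> {1..N-1}" and c: "cartan i j = - 1"
  shows "ustar (serre q (gen (Fg i)) (gen (Fg j))) \<in> u.I"
proof -
  interpret U: Group.monoid UA by (rule uq_monoid)
  note g = UF_gens[OF ij(1)] UF_gens[OF ij(2)]
  note cl = g[THEN uc_closed] uc_closed[OF free_alg_scal]
  let ?E = "gen (Eg i)" and ?L = "gen (Ki i)" and ?E' = "gen (Eg j)" and ?L' = "gen (Ki j)"
  have cc: "cartan i i = 2" "cartan j i = - 1" using c by (auto simp: cartan_def split: if_splits)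
  have one: "us 1 = \<one>\<^bsub>UA\<^esub>"
    using u.cls_one by (simp add: uq_alg_eq uq_cls_eq)
  \<comment> \<open>Now K^(-1) is moved past E, which inverts the factors; the prefactor
    \<open>?L * ?L * ?L'\<close> ends up on the right.\<close>
  let ?t = "us (of_real (q powi (- 2)))" and ?r = "us (of_real (q powi 1))"
  have fk: "uL i \<odot> uE i = ?t \<odot> (uE i \<odot> uL i)" "uL i \<odot> uE j = ?r \<odot> (uE j \<odot> uL i)" "uL j \<odot> uE i = ?r \<odot> (uE i \<odot> uL j)"
    using uq_comm(2)[OF ij(1) ij(1)] uq_comm(2)[OF ij] uq_comm(2)[OF ij(2) ij(1)] unfolding cc c by simp_all
  have t: "uE i \<odot> ?t = ?t \<odot> uE i"
      "uF i \<odot> ?t = ?t \<odot> uF i"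
      "uK i \<odot> ?t = ?t \<odot> uK i"
      "uL i \<odot> ?t = ?t \<odot> uL i"
      "uE j \<odot> ?t = ?t \<odot> uE j"
      "uF j \<odot> ?t = ?t \<odot> uF j"
      "uK j \<odot> ?t = ?t \<odot> uK j"
      "uL j \<odot> ?t = ?t \<odot> uL j"
    and r: "uE i \<odot> ?r = ?r \<odot> uE i"
      "uF i \<odot> ?r = ?r \<odot> uF i"
      "uK i \<odot> ?r = ?r \<odot> uK i"
      "uL i \<odot> ?r = ?r \<odot> uL i"
      "uE j \<odot> ?r = ?r \<odot> uE j"
      "uF j \<odot> ?r = ?r \<odot> uF j"
      "uK j \<odot> ?r = ?r \<odot> uK j"
      "uL j \<odot> ?r = ?r \<odot> uL j"
    using g by (simp_all add: uc_scal_comm)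
  have rt: "?r \<odot> ?t = ?t \<odot> ?r" by (simp only: us_mult mult.commute)
  have tr: "?t \<odot> (?r \<odot> ?r) = \<one>\<^bsub>UA\<^esub>"
    unfolding us_mult of_real_mult[symmetric] powi_add[symmetric] one[symmetric] by simp
  note W = U.qcomm_words[of "uE i" "uL i" "uE j" "uL j" ?t ?r, OF cl(1) cl(4) cl(5) cl(8) cl(9) cl(9) t(1) t(4) t(5) t(8) r(1) r(4) r(5) r(8) rt tr
      fk]
  have LL: "uL j \<odot> uL i = uL i \<odot> uL j" using uq_comm(6)[OF ij] by simp
  have LLL: "uL i \<odot> uL j \<odot> uL i = uL i \<odot> uL i \<odot> uL j" "uL j \<odot> uL i \<odot> uL i = uL i \<odot> uL i \<odot> uL j"
    using cl LL by (simp_all add: U.m_assoc)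
  have "serre q (?E * ?L) (?E' * ?L') \<in> u.I"
  proof (rule serre_words[where b = "?L * ?L * ?L'" and a = 1 and x' = ?E and y' = ?E'])
    show "serre q ?E ?E' \<in> u.I" by (rule uq_relI(8)[OF ij c])
  qed (use g W LLL in \<open>simp_all add: uc_mult_sym free_alg_closed\<close>)
  then have "scal (sn i * sn i * sn j) * serre q (?E * ?L) (?E' * ?L') \<in> u.I"
    by (rule u.Idl_mult) simp
  then show ?thesis
    unfolding serre_ustar lift_star_gen ugen_star_sn serre_scal .
qed

lemma ustar_relI:
  assumes "a \<in> UF" "b \<in> UF" "uc (ustar a) = uc (ustar b)"
  shows "ustar (a - b) \<in> u.I"
  using assms by (simp add: lift_star_diff ustar_UF flip: uc_eq_iff)

text \<open>With this, the involution prescribed on generators is well defined on cosets.\<close>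

lemma ustar_rel:
  assumes "r \<in> UR"
  shows "ustar r \<in> u.I"
proof -
  interpret U: Group.monoid UA by (rule uq_monoid)
  from assms obtain i j where ij: "i \<in> {1..N-1}" "j \<in> {1..N-1}" and r: "r \<in>
     {gen (Kg i) * gen (Ki i) - 1, gen (Ki i) * gen (Kg i) - 1,
      gen (Kg i) * gen (Kg j) - gen (Kg j) * gen (Kg i),
      gen (Kg i) * gen (Eg j) - scal (of_real (q powi cartan i j)) * gen (Eg j) * gen (Kg i),
      gen (Kg i) * gen (Fg j) - scal (of_real (q powi (- cartan i j))) * gen (Fg j) * gen (Kg i),
      gen (Eg i) * gen (Fg j) - gen (Fg j) * gen (Eg i)
        - (if i = j then scal (of_real (1 / (q - inverse q))) * (gen (Kg i) - gen (Ki i)) else 0)}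
     \<union> (if cartan i j = -1 then
          {serre q (gen (Eg i)) (gen (Eg j)), serre q (gen (Fg i)) (gen (Fg j))}
        else if cartan i j = 0 then
          {gen (Eg i) * gen (Eg j) - gen (Eg j) * gen (Eg i),
           gen (Fg i) * gen (Fg j) - gen (Fg j) * gen (Fg i)}
        else {})"
    unfolding uq_rels_def UN_iff by blast
  note g = UF_gens[OF ij(1)] UF_gens[OF ij(2)]
  note cl = g[THEN uc_closed] uc_closed[OF free_alg_scal]
  let ?K = "gen (Kg i)" and ?E = "gen (Eg i)" and ?F = "gen (Fg i)" and ?L = "gen (Ki i)"
  let ?K' = "gen (Kg j)" and ?E' = "gen (Eg j)" and ?F' = "gen (Fg j)" and ?L' = "gen (Ki j)"
  have KL: "ustar (?K * ?L - 1) \<in> u.I" "ustar (?L * ?K - 1) \<in> u.I"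
    using uq_relI(1,2)[OF ij] g by (intro ustar_relI; simp add: lift_star_mult)+
  have KK: "ustar (?K * ?K' - ?K' * ?K) \<in> u.I"
    using uq_relI(3)[OF ij] g by (intro ustar_relI; simp add: lift_star_mult)
  have one: "uc 1 = \<one>\<^bsub>UA\<^esub>"
    using u.cls_one by (simp add: uq_alg_eq uq_cls_eq)
  have lcomm: "uc x \<odot> (us c \<odot> y) = us c \<odot> (uc x \<odot> y)" if "x \<in> UF" "y \<in> carrier UA" for x y c
    using that by (metis U.m_assoc uc_closed free_alg_scal uc_scal_comm)
  note lc = lcomm[OF g(1)] lcomm[OF g(2)] lcomm[OF g(3)] lcomm[OF g(4)]
    lcomm[OF g(5)] lcomm[OF g(6)] lcomm[OF g(7)] lcomm[OF g(8)]
  let ?p = "us (of_real (q powi cartan i j))" and ?m = "us (of_real (q powi (- cartan i j)))"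
  have pm: "?p \<odot> (?m \<odot> y) = y" "?m \<odot> (?p \<odot> y) = y" if "y \<in> carrier UA" for y
  proof -
    have "?p \<odot> ?m = uc 1" "?m \<odot> ?p = uc 1"
      unfolding us_mult by (simp_all only: of_real_mult[symmetric] powi_add[symmetric]) simp_all
    then show "?p \<odot> (?m \<odot> y) = y" "?m \<odot> (?p \<odot> y) = y"
      using that cl(9) by (simp_all add: one flip: U.m_assoc)
  qed
  have KKz: "uK j \<odot> (uK i \<odot> y) = uK i \<odot> (uK j \<odot> y)" if "y \<in> carrier UA" for y
    using that cl uq_comm(7)[OF ij] by (simp flip: U.m_assoc)
  have b: "uE j \<odot> (uK i \<odot> y) = ?m \<odot> (uK i \<odot> (uE j \<odot> y))" if "y \<in> carrier UA" for y
  proof -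
    have "uE j \<odot> (uK i \<odot> y) = (uE j \<odot> uK i) \<odot> y" using cl that by (simp add: U.m_assoc)
    then show ?thesis unfolding uq_comm(4)[OF ij] using cl that by (simp add: U.m_assoc)
  qed
  have KE: "ustar (?K * ?E' - scal (of_real (q powi cartan i j)) * ?E' * ?K) \<in> u.I"
  proof (rule ustar_relI)
    have "uK j \<odot> (uF j \<odot> uK i) = ?p \<odot> (uK i \<odot> (uK j \<odot> uF j))"
      unfolding uq_comm(1)[OF ij] using cl by (simp add: lc KKz)
    then have "us (sn j) \<odot> (uK j \<odot> (uF j \<odot> uK i)) = us (sn j) \<odot> (?p \<odot> (uK i \<odot> (uK j \<odot> uF j)))"
      by simp
    then have "uc (scal (sn j) * (?K' * (?F' * ?K))) = uc (scal (sn j) * (scal (of_real (q powi cartan i j)) * (?K * (?K' * ?F'))))"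
      using g by (simp add: uc_mult_sym)
    then show "uc (ustar (?K * ?E')) = uc (ustar (scal (of_real (q powi cartan i j)) * ?E' * ?K))"
      unfolding lift_star_mult lift_star_gen lift_star_scal ugen_star_sn ugen_star.simps(3)
        complex_cnj_complex_of_real scal_sandwich
      by (simp only: mult.assoc)
  qed (use g in simp_all)
  have KF: "ustar (?K * ?F' - scal (of_real (q powi (- cartan i j))) * ?F' * ?K) \<in> u.I"
  proof (rule ustar_relI)
    have "uE j \<odot> (uL j \<odot> uK i) = ?m \<odot> (uK i \<odot> (uE j \<odot> uL j))"
      unfolding uq_comm(5)[OF ij(2) ij(1)] using cl by (simp add: b)
    then have "us (sn j) \<odot> (uE j \<odot> (uL j \<odot> uK i)) = us (sn j) \<odot> (?m \<odot> (uK i \<odot> (uE j \<odot> uL j)))"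
      by simp
    then have "uc (scal (sn j) * (?E' * (?L' * ?K))) = uc (scal (sn j) * (scal (of_real (q powi (- cartan i j))) * (?K * (?E' * ?L'))))"
      using g by (simp add: uc_mult_sym)
    then show "uc (ustar (?K * ?F')) = uc (ustar (scal (of_real (q powi (- cartan i j))) * ?F' * ?K))"
      unfolding lift_star_mult lift_star_gen lift_star_scal ugen_star_sn ugen_star.simps(3)
        complex_cnj_complex_of_real scal_sandwich
      by (simp only: mult.assoc)
  qed (use g in simp_all)
  have EF: "ustar (?E * ?F' - ?F' * ?E) \<in> u.I" if "i \<noteq> j"
  proof (rule ustar_relI)
    have a: "uL j \<odot> (uK i \<odot> uF i) = uK i \<odot> (uL j \<odot> uF i)"
      using cl uq_comm(5)[OF ij(2) ij(1)] by (simp flip: U.m_assoc)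
    have c: "uL j \<odot> uF i = ?p \<odot> (uF i \<odot> uL j)"
      using uq_comm(3)[OF ij(2) ij(1)] by (simp add: cartan_sym[of j i])
    have d: "uE j \<odot> (uF i \<odot> uL j) = uF i \<odot> (uE j \<odot> uL j)"
      using uq_relI(6)[OF ij(2) ij(1)] that g cl by (simp add: uc_mult_sym flip: U.m_assoc)
    have "uE j \<odot> (uL j \<odot> (uK i \<odot> uF i)) = uK i \<odot> (uF i \<odot> (uE j \<odot> uL j))"
      using cl by (simp add: a b c d lc pm[unfolded of_real_power_int])
    then have "us (sn i * sn j) \<odot> (uE j \<odot> (uL j \<odot> (uK i \<odot> uF i))) = us (sn i * sn j) \<odot> (uK i \<odot> (uF i \<odot> (uE j \<odot> uL j)))"
      by simp
    then have "uc (scal (sn i * sn j) * (?E' * (?L' * (?K * ?F)))) = uc (scal (sn i * sn j) * (?K * (?F * (?E' * ?L'))))"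
      using g by (simp add: uc_mult_sym)
    then show "uc (ustar (?E * ?F')) = uc (ustar (?F' * ?E))"
      unfolding lift_star_mult lift_star_gen lift_star_scal ugen_star_sn scal_mult_mult
      by (simp only: mult.assoc mult.commute[of "sn j"])
  qed (use g in simp_all)
  have EF': "ustar (?E * ?F - ?F * ?E - scal (of_real (1 / (q - inverse q))) * (?K - ?L)) \<in> u.I"
  proof -
    let ?x = "scal (complex_of_real (1 / (q - inverse q)))"
    let ?a = "us (of_real (q powi cartan i i))" and ?b = "us (of_real (q powi (- cartan i i)))"
    have ab: "?a \<odot> (?b \<odot> y) = y" if "y \<in> carrier UA" for y
    proof -
      have "?a \<odot> ?b = uc 1"
        unfolding us_mult by (simp only: of_real_mult[symmetric] powi_add[symmetric]) simp
      then show ?thesis using that cl(9) by (simp add: one flip: U.m_assoc)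
    qed
    note ii = ij(1) ij(1)
    have e1: "uc (?E * (?L * (?K * ?F))) = uc (?E * ?F)"
    proof -
      have "uL i \<odot> (uK i \<odot> uF i) = uF i"
        using cl uq_comm(9)[OF ii] by (simp add: one flip: U.m_assoc)
      then show ?thesis using g by (simp add: uc_mult_sym)
    qed
    have e2: "uc (?K * (?E * (?F * ?L))) = uc (?E * ?F)"
    proof -
      have "uK i \<odot> (uE i \<odot> y) = ?a \<odot> (uE i \<odot> (uK i \<odot> y))"
        "uK i \<odot> (uF i \<odot> y) = ?b \<odot> (uF i \<odot> (uK i \<odot> y))" if "y \<in> carrier UA" for y
      proof -
        have "uK i \<odot> uE i = ?a \<odot> (uE i \<odot> uK i)" "uK i \<odot> uF i = ?b \<odot> (uF i \<odot> uK i)"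
          using uq_relI(4,5)[OF ii] g by (simp_all add: uc_mult_sym U.m_assoc)
        then show "uK i \<odot> (uE i \<odot> y) = ?a \<odot> (uE i \<odot> (uK i \<odot> y))"
          "uK i \<odot> (uF i \<odot> y) = ?b \<odot> (uF i \<odot> (uK i \<odot> y))"
          using cl that U.m_assoc[of "uK i" "uE i" y] U.m_assoc[of "uK i" "uF i" y]
          by (simp_all add: U.m_assoc)
      qed
      then have "uK i \<odot> (uE i \<odot> (uF i \<odot> uL i)) = uE i \<odot> uF i"
        using cl uq_comm(8)[OF ii] by (simp add: lc ab[unfolded of_real_power_int] one)
      then show ?thesis using g by (simp add: uc_mult_sym)
    qed
    have e3: "uc (?K * (?K * ?L)) = uc ?K" "uc (?K * (?L * ?L)) = uc ?L"
    proof -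
      show "uc (?K * (?K * ?L)) = uc ?K"
        using g cl uq_comm(8)[OF ii] by (simp add: uc_mult_sym one)
      have "uK i \<odot> (uL i \<odot> uL i) = uL i"
        using cl uq_comm(8)[OF ii] by (simp add: one flip: U.m_assoc)
      then show "uc (?K * (?L * ?L)) = uc ?L"
        using g by (simp add: uc_mult_sym)
    qed
    have I: "?E * (?L * (?K * ?F)) - ?E * ?F \<in> u.I" "?K * (?E * (?F * ?L)) - ?E * ?F \<in> u.I"
      "?K * (?K * ?L) - ?K \<in> u.I" "?K * (?L * ?L) - ?L \<in> u.I"
      using e1 e2 e3 g by (simp_all flip: uc_eq_iff)
    \<comment> \<open>The star of E F - F E is K (E F - F E) K^(-1) up to K-commutations, so the
      relation is mapped to its own conjugate plus corrections in the ideal.\<close>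
    have "ustar (?E * ?F - ?F * ?E - ?x * (?K - ?L)) =
        (?E * (?L * (?K * ?F)) - ?E * ?F) - (?K * (?E * (?F * ?L)) - ?E * ?F)
        + ?K * (?E * ?F - ?F * ?E - ?x * (?K - ?L)) * ?L
        + ?x * ((?K * (?K * ?L) - ?K) - (?K * (?L * ?L) - ?L))"
    proof -
      have s: "ustar (?E * ?F) = ?E * (?L * (?K * ?F))" "ustar (?F * ?E) = ?K * (?F * (?E * ?L))"
        unfolding lift_star_mult lift_star_gen ugen_star_sn scal_mult_mult
        by (simp_all only: mult.assoc sn_sq scal_simps mult_1)
      have "ustar (?x * (?K - ?L)) = ?x * (?K - ?L)"
        unfolding lift_star_mult lift_star_diff lift_star_gen lift_star_scal ugen_star.simps
          complex_cnj_complex_of_real by (rule scal_central[symmetric])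
      then show ?thesis
        unfolding lift_star_diff s by (simp add: algebra_simps mult_scal_left[of ?K])
    qed
    also have "\<dots> \<in> u.I"
      by (intro u.Idl_add u.Idl_diff I u.Idl_mult(1)[OF u.Idl_diff[OF I(3,4)]]
          u.Idl_mult(2)[OF u.Idl_mult(1)[OF uq_relI(7)[OF ii]]] free_alg_scal g)
    finally show ?thesis .
  qed
  have z: "ustar (?E * ?E' - ?E' * ?E) \<in> u.I" "ustar (?F * ?F' - ?F' * ?F) \<in> u.I" if c: "cartan i j = 0"
  proof -
    have c': "cartan j i = 0" using c by (simp add: cartan_sym)
    have "us 1 = uc 1" by simp
    then have FK: "uF j \<odot> uK i = uK i \<odot> uF j" "uF i \<odot> uK j = uK j \<odot> uF i"
      "uL i \<odot> uE j = uE j \<odot> uL i" "uL j \<odot> uE i = uE i \<odot> uL j"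
      using uq_comm(1,2)[OF ij] uq_comm(1,2)[OF ij(2) ij(1)] cl by (simp_all add: c c' one)
    have sw: "(a \<odot> b) \<odot> (a' \<odot> b') = (a' \<odot> b') \<odot> (a \<odot> b)"
      if "a \<odot> a' = a' \<odot> a" "b \<odot> a' = a' \<odot> b" "b' \<odot> a = a \<odot> b'" "b \<odot> b' = b' \<odot> b"
        "a \<in> carrier UA" "b \<in> carrier UA" "a' \<in> carrier UA" "b' \<in> carrier UA" for a b a' b'
    proof -
      have "(a \<odot> b) \<odot> (a' \<odot> b') = a \<odot> (b \<odot> a') \<odot> b'" using that(5-8) by (simp add: U.m_assoc)
      also have "\<dots> = (a \<odot> a') \<odot> (b \<odot> b')" unfolding that(2) using that(5-8) by (simp add: U.m_assoc)
      also have "\<dots> = a' \<odot> (a \<odot> b') \<odot> b" unfolding that(1,4) using that(5-8) by (simp add: U.m_assoc)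
      also have "\<dots> = (a' \<odot> b') \<odot> (a \<odot> b)" unfolding that(3)[symmetric] using that(5-8) by (simp add: U.m_assoc)
      finally show ?thesis .
    qed
    have "(uK j \<odot> uF j) \<odot> (uK i \<odot> uF i) = (uK i \<odot> uF i) \<odot> (uK j \<odot> uF j)"
      using uq_relI(11)[OF ij c] uq_comm(7)[OF ij] FK g by (intro sw cl) (simp_all add: uc_mult_sym)
    then have "us (sn i * sn j) \<odot> ((uK j \<odot> uF j) \<odot> (uK i \<odot> uF i)) = us (sn i * sn j) \<odot> ((uK i \<odot> uF i) \<odot> (uK j \<odot> uF j))"
      by simp
    then have 1: "uc (scal (sn i * sn j) * ((?K' * ?F') * (?K * ?F))) = uc (scal (sn i * sn j) * ((?K * ?F) * (?K' * ?F')))"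
      using g by (simp add: uc_mult_sym)
    have "(uE j \<odot> uL j) \<odot> (uE i \<odot> uL i) = (uE i \<odot> uL i) \<odot> (uE j \<odot> uL j)"
      using uq_relI(10)[OF ij c] uq_comm(6)[OF ij] FK g by (intro sw cl) (simp_all add: uc_mult_sym)
    then have "us (sn i * sn j) \<odot> ((uE j \<odot> uL j) \<odot> (uE i \<odot> uL i)) = us (sn i * sn j) \<odot> ((uE i \<odot> uL i) \<odot> (uE j \<odot> uL j))"
      by simp
    then have 2: "uc (scal (sn i * sn j) * ((?E' * ?L') * (?E * ?L))) = uc (scal (sn i * sn j) * ((?E * ?L) * (?E' * ?L')))"
      using g by (simp add: uc_mult_sym)
    have "uc (ustar (?E * ?E')) = uc (ustar (?E' * ?E))"
      using 1 unfolding lift_star_mult lift_star_gen ugen_star_sn scal_mult_mult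
      by (simp only: mult.assoc mult.commute[of "sn j"])
    then show "ustar (?E * ?E' - ?E' * ?E) \<in> u.I" using g by (intro ustar_relI) simp_all
    have "uc (ustar (?F * ?F')) = uc (ustar (?F' * ?F))"
      using 2 unfolding lift_star_mult lift_star_gen ugen_star_sn scal_mult_mult
      by (simp only: mult.assoc mult.commute[of "sn j"])
    then show "ustar (?F * ?F' - ?F' * ?F) \<in> u.I" using g by (intro ustar_relI) simp_all
  qed
  show ?thesis
    using r KL KK KE KF EF EF' z serre_star_E[OF ij] serre_star_F[OF ij]
    by (auto split: if_splits)
qed

lemma uq_star_cls: "a \<in> UF \<Longrightarrow> uq_star q n m (uc a) = uc (ustar a)"
  unfolding uq_star_def uq_cls_eq
  by (rule u.cls_map_cls)
    (simp_all add: ustar_UF lift_star_diff u.lift_star_Idl[OF _ ugen_star_UF ustar_rel])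

end

section \<open>Invariance under the whole quantum group\<close>

context cone_action
begin

lemma sn_eps: "1 \<le> j \<Longrightarrow> of_real (eps j * eps (j + 1)) = sn j"
  by (auto simp: sn_def eps_def)

text \<open>F_j A is K_j^(-1) applied to K_j F_j A. Moving K_j^(-1) to the other argument and using
  Hermitian symmetry reduces the claim to \<open>Phi_E\<close>.\<close>

lemma Phi_F:
  assumes j: "1 \<le> j" "j < N" and A: "inV c A" and B: "inV c B"
    and c: "c * cnj c * of_real (q ^ (2 * (N - 1))) = 1"
  shows "Phi (aF j A) B = Phi A (cone_scale q n m (sn j) (aE j (aL j B)))"
proof -
  note cA = inV_D(1)[OF A] and cB = inV_D(1)[OF B]
  have ij: "j \<in> {1..N-1}" using j by simp
  note g = UF_gens[OF ij]
  let ?M = "aK j (aF j A)" and ?L = "aL j B"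
  have cl: "aF j A \<in> carrier CA" "?M \<in> carrier CA" "?L \<in> carrier CA" "aE j ?L \<in> carrier CA"
    using j cA cB by simp_all
  have "aF j A = aL j ?M"
    using cl(1) g uq_relI(2)[OF ij ij] act_umult[of "gen (Ki j)" "gen (Kg j)" "aF j A"] by (simp add: act_u1)
  then have "Phi (aF j A) B = Phi ?M ?L"
    using Phi_K(2)[OF j cl(2) cB] by simp
  also have "\<dots> = cnj (Phi ?L ?M)"
    by (rule Phi_cnj[OF cl(2,3)])
  also have "Phi ?L ?M = sn j * (sn j * Phi ?L ?M)" by simp
  also have "sn j * Phi ?L ?M = Phi ?L (cone_scale q n m (sn j) ?M)"
    using cl by (simp add: Phi_scale_right) (simp add: sn_def)
  also have "\<dots> = Phi (aE j ?L) A"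
    using Phi_E[OF j inV_K(2)[OF j B] A c] unfolding sn_eps[OF j(1)] ..
  also have "cnj (sn j * Phi (aE j ?L) A) = cnj (sn j) * Phi A (aE j ?L)"
    using Phi_cnj[OF cA cl(4)] by simp
  also have "\<dots> = Phi A (cone_scale q n m (sn j) (aE j ?L))"
    using cl by (simp add: Phi_scale_right)
  finally show ?thesis .
qed

text \<open>For a product a b, the first step pairs b A with the image of B under the star of a.
  That the induction hypothesis applies to these elements is the content of
  \<open>inV_act\<close>.\<close>

lemma Phi_invariant:
  assumes a: "a \<in> UF" and A: "inV c A" and B: "inV c B"
    and c: "c * cnj c * of_real (q ^ (2 * (N - 1))) = 1"
  shows "Phi (act (uc a) A) B = Phi A (act (uc (ustar a)) B)"
  using a A B
proof (induction a arbitrary: A B rule: free_alg_induct)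
  case (scal d)
  then show ?case
    using Phi_scale_right[of B A "cnj d"] by (simp add: act_uscal inV_D Phi_scale_left)
next
  case (gen x)
  note cA = inV_D(1)[OF gen(2)] and cB = inV_D(1)[OF gen(3)]
  have "\<exists>j. 1 \<le> j \<and> j < N \<and> (x = Eg j \<or> x = Fg j \<or> x = Kg j \<or> x = Ki j)"
    using gen(1) N_ne by (cases x) auto
  then obtain j where j: "1 \<le> j" "j < N" "x = Eg j \<or> x = Fg j \<or> x = Kg j \<or> x = Ki j"
    by blast
  then have g: "gen (Eg j) \<in> UF" "gen (Fg j) \<in> UF" "gen (Kg j) \<in> UF" "gen (Ki j) \<in> UF" by simp_all
  from j(3) show ?case
  proof (elim disjE)
    assume x: "x = Eg j"
    have "act (uc (ugen_star n (Eg j))) B = cone_scale q n m (sn j) (aK j (aF j B))"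
      unfolding ugen_star_sn using g cB by (simp add: act_umult act_uscal)
    then show ?thesis
      using Phi_E[OF j(1,2) gen(2,3) c] unfolding x sn_eps[OF j(1)] lift_star_gen by simp
  next
    assume x: "x = Fg j"
    have "act (uc (ugen_star n (Fg j))) B = cone_scale q n m (sn j) (aE j (aL j B))"
      unfolding ugen_star_sn using g cB by (simp add: act_umult act_uscal)
    then show ?thesis
      using Phi_F[OF j(1,2) gen(2,3) c] unfolding x lift_star_gen by simp
  next
    assume "x = Kg j"
    then show ?thesis using Phi_K(1)[OF j(1,2) cA cB] by simp
  next
    assume "x = Ki j"
    then show ?thesis using Phi_K(2)[OF j(1,2) cA cB] by simp
  qed
next
  case (add a b)
  then have "inV c A" "inV c B" by auto
  note V = inV_act[OF add(1) this(1)] inV_act[OF add(2) this(1)]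
    inV_act[OF ustar_UF[OF add(1)] this(2)] inV_act[OF ustar_UF[OF add(2)] this(2)]
  show ?case
    using add V[THEN inV_D(1)]
    by (simp add: lift_star_add act_uadd ustar_UF inV_D Phi_add_left Phi_add_right)
next
  case (mult a b)
  then have V: "inV c A" "inV c B" by auto
  then show ?case
    using mult inV_act[OF mult(2) V(1)] inV_act[OF ustar_UF[OF mult(1)] V(2)]
    by (simp add: lift_star_mult act_umult ustar_UF inV_D)
qed

end

section \<open>Faithfulness on normally ordered elements\<close>

lemma fa_module: "Modules.module (\<lambda>c (f :: 'g fa). scal c * f)"
  by unfold_locales (simp_all add: distrib_left distrib_right scal_add scal_assoc)

lemma base_expansion_less:
  fixes k pos :: "'a \<Rightarrow> nat"
  assumes "finite A" "inj_on pos A" "\<And>a. a \<in> A \<Longrightarrow> k a < D" "\<And>a. a \<in> A \<Longrightarrow> pos a < r" "0 < D"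
  shows "(\<Sum>a\<in>A. k a * D ^ pos a) < D ^ r"
proof -
  have D: "D \<ge> 1" using assms(5) by simp
  have "(\<Sum>a\<in>A. k a * D ^ pos a) \<le> (\<Sum>a\<in>A. (D - 1) * D ^ pos a)"
    using assms(3) by (intro sum_mono mult_right_mono) (fastforce simp: less_Suc_eq_le)+
  also have "\<dots> = (\<Sum>t\<in>pos ` A. (D - 1) * D ^ t)"
    using assms(2) by (simp add: sum.reindex)
  also have "\<dots> \<le> (\<Sum>t<r. (D - 1) * D ^ t)"
    using assms(1,4) by (intro sum_mono2) auto
  also have "\<dots> < D ^ r"
  proof (induction r)
    case (Suc r)
    obtain d where d: "D = Suc d" using D by (cases D) auto
    from Suc show ?case by (simp add: d)
  qed simp
  finally show ?thesis .
qed

text \<open>Base D digits, with \<open>pos\<close> assigning the places. The digit at the highest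
  place is recovered by division, as all lower places together stay below its unit.\<close>

lemma base_expansion_inj:
  fixes k k' pos :: "'a \<Rightarrow> nat"
  assumes "finite A" "inj_on pos A" "\<And>a. a \<in> A \<Longrightarrow> k a < D" "\<And>a. a \<in> A \<Longrightarrow> k' a < D"
    and "(\<Sum>a\<in>A. k a * D ^ pos a) = (\<Sum>a\<in>A. k' a * D ^ pos a)" "0 < D"
  shows "\<forall>a\<in>A. k a = k' a"
  using assms
proof (induction A rule: finite_ranking_induct[where f = pos])
  case (insert x S)
  show ?case
  proof (cases "x \<in> S")
    case True
    then have e: "insert x S = S" by (rule insert_absorb)
    show ?thesis unfolding e by (rule insert.IH) (fact insert.prems[unfolded e])+
  next
    case x: False
    have kD: "k a < D" "k' a < D" if "a \<in> insert x S" for a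
      using insert.prems(2,3) that by blast+
    have inj: "inj_on pos S" using insert.prems(1) by (rule inj_on_subset) blast
    have pos: "pos a < pos x" if a: "a \<in> S" for a
    proof -
      have "pos a \<noteq> pos x"
        using inj_onD[OF insert.prems(1), of a x] a x by blast
      then show ?thesis using insert.hyps(2)[OF a] by simp
    qed
    let ?s = "\<Sum>a\<in>S. k a * D ^ pos a" and ?s' = "\<Sum>a\<in>S. k' a * D ^ pos a"
    have lt: "?s < D ^ pos x" "?s' < D ^ pos x"
      by (rule base_expansion_less[OF insert.hyps(1) inj _ pos \<open>0 < D\<close>]; use kD in blast)+
    have eq: "?s + k x * D ^ pos x = ?s' + k' x * D ^ pos x"
      using insert.prems(4) by (simp add: x insert.hyps(1) add.commute)
    then have "(?s + k x * D ^ pos x) div D ^ pos x = (?s' + k' x * D ^ pos x) div D ^ pos x"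
      by simp
    then have kx: "k x = k' x"
      using lt \<open>0 < D\<close> by simp
    then have "?s = ?s'" using eq by simp
    then have "\<forall>a\<in>S. k a = k' a"
      by (intro insert.IH inj \<open>0 < D\<close>) (use kD in blast)+
    then show ?thesis using kx by simp
  qed
qed simp

lemma prod_list_gen_powers:
  "prod_list (map (\<lambda>a. gen (x a) ^ I a) as) = Poly_Mapping.single (Word (concat (map (\<lambda>a. replicate (I a) (x a)) as))) (1 :: complex)"
proof -
  have p: "gen (x a) ^ p = Poly_Mapping.single (Word (replicate p (x a))) 1" for a p
    by (induction p) (simp_all add: gen_def mult_single plus_fmon_def flip: one_single zero_fmon_def)
  show ?thesis
  proof (induction as)
    case Nil
    then show ?case by (simp flip: zero_fmon_def)
  next
    case (Cons a as)
    then show ?case by (simp add: p mult_single plus_fmon_def)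
  qed
qed

lemma sfw_replicate:
  "sfw (replicate p (Tg a)) i = i(a := i a - int p)"
  "sfw (replicate p (Ts a)) i = i(a := i a + int p)"
  by (induction p) (auto simp: fun_eq_iff)

lemma sfw_concat_Tg: "distinct as \<Longrightarrow> sfw (concat (map (\<lambda>a. replicate (I a) (Tg a)) as)) i
    = (\<lambda>b. if b \<in> set as then i b - int (I b) else i b)"
  by (induction as arbitrary: i) (auto simp: sfw_replicate fun_eq_iff)

lemma sfw_concat_Ts: "distinct as \<Longrightarrow> sfw (concat (map (\<lambda>a. replicate (I a) (Ts a)) as)) i
    = (\<lambda>b. if b \<in> set as then i b + int (I b) else i b)"
  by (induction as arbitrary: i) (auto simp: sfw_replicate fun_eq_iff)

lemma sfw_dist: "\<bar>sfw w i k - i k\<bar> \<le> int (length w)"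
proof (induction w)
  case (Cons x w)
  have "\<bar>sft x j k - j k\<bar> \<le> 1" for j by (cases x) auto
  from this[of "sfw w i"] Cons show ?case by simp
qed simp

type_synonym mono = "(nat \<Rightarrow> nat) \<times> (nat \<Rightarrow> nat) \<times> (nat \<Rightarrow> nat)"

context cone
begin

definition wA :: "(nat \<Rightarrow> nat) \<Rightarrow> cgen list" where
  "wA I = concat (map (\<lambda>a. replicate (I a) (Tg a)) [1..<n+1])
     @ concat (map (\<lambda>a. replicate (I a) (Ts a)) [n+1..<n+m+1])"
definition wB :: "(nat \<Rightarrow> nat) \<Rightarrow> cgen list" where
  "wB J = concat (map (\<lambda>a. replicate (J a) (Tg a)) (rev [n+1..<n+m+1]))
     @ concat (map (\<lambda>a. replicate (J a) (Ts a)) (rev [1..<n+1]))"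
definition pxi :: "(nat \<Rightarrow> nat) \<Rightarrow> nat list \<Rightarrow> cgen fa" where
  "pxi k as = prod_list (map (\<lambda>a. cone_xi n m a ^ k a) as)"

text \<open>The parts of a monomial to the left and right of the function. Separating them makes the
  linearity in the function evident modulo the relations.\<close>

definition ma :: "(nat \<Rightarrow> nat) \<Rightarrow> (nat \<Rightarrow> nat) \<Rightarrow> cgen fa" where
  "ma I k = Poly_Mapping.single (Word (wA I)) 1 * pxi k [2..<n+1]"
definition mb :: "(nat \<Rightarrow> nat) \<Rightarrow> (nat \<Rightarrow> nat) \<Rightarrow> cgen fa" where
  "mb J k = pxi k [n+2..<n+m+1] * Poly_Mapping.single (Word (wB J)) 1"

lemma cone_monom_eq: "cone_monom n m I J k g = ma I k * fn g * mb J k"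
proof -
  have "Poly_Mapping.single (Word (wA I)) 1 = prod_list (map (\<lambda>a. tt a ^ I a) [1..<n+1]) *
     prod_list (map (\<lambda>a. ts a ^ I a) [n+1..<n+m+1])"
    unfolding prod_list_gen_powers by (simp add: wA_def mult_single plus_fmon_def)
  moreover have "Poly_Mapping.single (Word (wB J)) 1 = prod_list (map (\<lambda>a. tt a ^ J a) (rev [n+1..<n+m+1])) *
     prod_list (map (\<lambda>a. ts a ^ J a) (rev [1..<n+1]))"
    unfolding prod_list_gen_powers by (simp add: wB_def mult_single plus_fmon_def)
  ultimately show ?thesis
    by (simp only: cone_monom_def ma_def mb_def pxi_def mult.assoc)
qed

lemma wA_CG: "set (wA I) \<subseteq> CG" and wB_CG: "set (wB J) \<subseteq> CG"
  by (auto simp: wA_def wB_def)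

lemma pxi_CF: "set as \<subseteq> {1..N} \<Longrightarrow> pxi k as \<in> CF"
  unfolding pxi_def by (intro free_alg_prod_list) (auto intro!: free_alg_power cone_xi_CF)

lemma ma_CF: "ma I k \<in> CF" and mb_CF: "mb J k \<in> CF"
  using wA_CG wB_CG unfolding ma_def mb_def
  by (intro free_alg_mult free_alg_single pxi_CF; auto)+

lemma cone_monom_CF: "cone_monom n m I J k g \<in> CF"
  unfolding cone_monom_eq by (intro free_alg_mult ma_CF mb_CF) simp

lemma Rop_pxi:
  assumes "i \<in> Bh" "set as \<subseteq> {1..N}"
  shows "Rop (pxi k as) v i = prod_list (map (\<lambda>a. of_real (xx a i) ^ k a) as) * v i"
proof -
  have p: "Rop (cone_xi n m a ^ p) v i = of_real (xx a i) ^ p * v i" if "a \<in> {1..N}" for a p v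
    using that assms(1) by (induction p arbitrary: v) (simp_all add: Rop_mult Rop_cone_xi)
  show ?thesis
    using assms(2) unfolding pxi_def
    by (induction as arbitrary: v) (simp_all add: Rop_mult p)
qed

definition shf :: "(nat \<Rightarrow> int) \<Rightarrow> (nat \<Rightarrow> int) \<Rightarrow> nat \<Rightarrow> int" where
  "shf E i = (\<lambda>b. if b \<in> {1..n} then i b + E b else if b \<in> {n+1..N} then i b - E b else i b)"

lemma sfw_wA: "sfw (wA I) i = shf (\<lambda>b. - int (I b)) i"
  and sfw_wB: "sfw (wB J) i = shf (\<lambda>b. int (J b)) i"
  unfolding wA_def wB_def sfw_simps sfw_concat_Tg[OF distinct_upt] sfw_concat_Ts[OF distinct_upt]
    sfw_concat_Tg[OF distinct_rev[THEN iffD2, OF distinct_upt]] sfw_concat_Ts[OF distinct_rev[THEN iffD2, OF distinct_upt]]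
  by (auto simp: shf_def fun_eq_iff)

lemma shf_shf: "shf E (shf F i) = shf (\<lambda>b. E b + F b) i"
  by (auto simp: shf_def fun_eq_iff)

definition Ks :: "nat set" where "Ks = {2..n} \<union> {n+2..N}"

text \<open>The right word acts first and leads to \<open>h\<close>; there the \<xi>_a and the
  function are diagonal, and then the left word acts. Hence a monomial moves every index by the same
  shift.\<close>

lemma Rop_monom:
  fixes I J k :: "nat \<Rightarrow> nat"
  assumes i: "i \<in> Bh"
  defines "h \<equiv> shf (\<lambda>b. int (J b)) i"
  shows "Rop (cone_monom n m I J k g) v i =
    cfw (wB J) i * ((\<Prod>a\<in>Ks. of_real (xx a h) ^ k a) * g (lev h)) * cfw (wA I) h
      * v (shf (\<lambda>b. int (J b) - int (I b)) i)"
proof -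
  have h: "sfw (wB J) i = h" by (simp add: h_def sfw_wB)
  have s: "sfw (wA I) h = shf (\<lambda>b. int (J b) - int (I b)) i"
    unfolding h_def sfw_wA shf_shf by simp
  have 1: "Rop (cone_monom n m I J k g) v i =
      cfw (wB J) i * Rop (pxi k [n+2..<n+m+1]) (Rop (fn g) (Rop (pxi k [2..<n+1]) (Rop (Poly_Mapping.single (Word (wA I)) 1) v))) h"
    unfolding cone_monom_eq ma_def mb_def Rop_mult[abs_def] by (simp del: upt_Suc add: Rop_single h)
  show ?thesis
  proof (cases "h \<in> Bh")
    case True
    have s2: "set [n+2..<n+m+1] \<subseteq> {1..N}" "set [2..<n+1] \<subseteq> {1..N}" by auto
    have "prod_list (map (\<lambda>a. of_real (xx a h) ^ k a) [n+2..<n+m+1]) = (\<Prod>a\<in>{n+2..N}. complex_of_real (xx a h) ^ k a)"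
      "prod_list (map (\<lambda>a. of_real (xx a h) ^ k a) [2..<n+1]) = (\<Prod>a\<in>{2..n}. complex_of_real (xx a h) ^ k a)"
      by (subst prod.distinct_set_conv_list[symmetric]; auto intro!: prod.cong)+
    moreover have "(\<Prod>a\<in>Ks. complex_of_real (xx a h) ^ k a) =
        (\<Prod>a\<in>{2..n}. complex_of_real (xx a h) ^ k a) * (\<Prod>a\<in>{n+2..N}. complex_of_real (xx a h) ^ k a)"
      unfolding Ks_def by (rule prod.union_disjoint) auto
    ultimately show ?thesis
      unfolding 1 Rop_pxi[OF True s2(1)] Rop_gen sft.simps Rop_pxi[OF True s2(2)] Rop_single
      by (simp add: s)
  next
    case False
    \<comment> \<open>A point outside \<open>Bh\<close> is reached only with coefficient 0.\<close>
    then have "cfw (wB J) i = 0"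
      using sfw_Bh[OF wB_CG i, of J] h by auto
    then show ?thesis unfolding 1 by simp
  qed
qed

lemma idx_sum_shf: "tot (shf E i) = tot i + (\<Sum>a\<in>{1..n}. E a) - (\<Sum>a\<in>{n+1..N}. E a)"
  if "tot = idx_sum (N + 1)" for tot
proof -
  have "{1..<N+1} = {1..n} \<union> {n+1..N}" by auto
  then have s: "idx_sum (N + 1) j = (\<Sum>a\<in>{1..n}. j a) + (\<Sum>a\<in>{n+1..N}. j a)" for j
    unfolding idx_sum_def by (simp add: sum.union_disjoint)
  have "(\<Sum>a\<in>{1..n}. shf E i a) = (\<Sum>a\<in>{1..n}. i a + E a)" "(\<Sum>a\<in>{n+1..N}. shf E i a) = (\<Sum>a\<in>{n+1..N}. i a - E a)"
    by (intro sum.cong; auto simp: shf_def)+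
  then show ?thesis
    unfolding that s by (simp add: sum.distrib sum_subtractf)
qed

definition monset :: "cgen fa set" where
  "monset = {cone_monom n m I J k (xi_power q \<kappa>) | I J k \<kappa>. admissible n m I J}"

definition nspan :: "cgen fa set" where
  "nspan = Modules.module.span (\<lambda>c f. scal c * f) monset"

lemma nspan_induct [consumes 1, case_names zero step]:
  assumes "f \<in> nspan" "P 0" "\<And>c x y. x \<in> monset \<Longrightarrow> P y \<Longrightarrow> P (scal c * x + y)"
  shows "P f"
proof -
  interpret M: Modules.module "\<lambda>c (f :: cgen fa). scal c * f" by (rule fa_module)
  show ?thesis
    by (rule M.span_induct_alt[OF assms(1)[unfolded nspan_def]]) (use assms in auto)
qed

lemma nspan_CF: "f \<in> nspan \<Longrightarrow> f \<in> CF"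
  by (induction f rule: nspan_induct) (auto simp: monset_def cone_monom_CF)

lemma powi_eq_1: "q powi a = 1 \<longleftrightarrow> a = 0"
proof
  assume e: "q powi a = 1"
  have "q powi a < 1" if "a > 0" for a :: int
  proof -
    have "q powi a \<le> q powi 1" using that by (intro powi_mono) simp
    then show ?thesis using q by simp
  qed
  from this[of a] this[of "- a"] e show "a = 0"
    by (cases a "0 :: int" rule: linorder_cases) (auto simp: power_int_minus)
qed simp

lemma C_ne_0:
  assumes "k \<in> {1..N}" "2 \<le> k \<Longrightarrow> k < N \<Longrightarrow> i k \<noteq> 1"
  shows "C k i \<noteq> 0"
  using assms n m by (auto simp: C_def powi_eq_1)

text \<open>A coefficient can vanish only at a face of the index set, and a word changes each
  coordinate by at most its length.\<close>

lemma cfw_ne_0: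
  assumes "set w \<subseteq> CG - range Fn" "\<And>k. 2 \<le> k \<Longrightarrow> k < N \<Longrightarrow> \<bar>i k\<bar> > int (length w) + 1"
  shows "cfw w i \<noteq> 0"
  using assms
proof (induction w)
  case (Cons x w)
  have j: "\<bar>sfw w i k\<bar> > 1" if "2 \<le> k" "k < N" for k
    using Cons.prems(2)[OF that] sfw_dist[of w i k] by simp
  have "cf x (sfw w i) \<noteq> 0"
  proof (cases x)
    case (Tg a)
    have "C a (sfw w i) \<noteq> 0"
      using Cons.prems(1) j[of a] by (intro C_ne_0) (auto simp: Tg)
    then show ?thesis by (simp add: Tg)
  next
    case (Ts a)
    have "C a ((sfw w i)(a := sfw w i a + 1)) \<noteq> 0"
      using Cons.prems(1) j[of a] by (intro C_ne_0) (auto simp: Ts)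
    then show ?thesis by (simp add: Ts)
  qed (use Cons.prems in auto)
  moreover have "cfw w i \<noteq> 0"
    using Cons.prems(1) by (intro Cons.IH) (use Cons.prems(2) in fastforce)+
  ultimately show ?case by simp
qed simp

lemma wAB_no_Fn: "set (wA I) \<subseteq> CG - range Fn" "set (wB J) \<subseteq> CG - range Fn"
  using wA_CG[of I] wB_CG[of J] by (auto simp: wA_def wB_def)

text \<open>Places 0 to n - 2 belong to the indices from \<open>n\<close> down to 2, the following
  ones to n + 2 up to \<open>N\<close>. They increase away from n + 1 on either side, as the partial
  sums in \<open>Bh\<close> do.\<close>

definition pos :: "nat \<Rightarrow> nat" where "pos a = (if a \<le> n then n - a else a - 3)"

lemma inj_pos: "inj_on pos Ks"
proof (rule inj_onI)
  fix a b assume "a \<in> Ks" "b \<in> Ks" "pos a = pos b"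
  then show "a = b"
    using n by (auto simp: Ks_def pos_def split: if_splits)
qed

text \<open>A path of indices going to infinity in the interior of the cone along which all monomials
  in the $\xi_a$ are separated.\<close>

definition sp :: "nat \<Rightarrow> int \<Rightarrow> nat \<Rightarrow> nat \<Rightarrow> int" where
  "sp D l0 s a = (if a < 2 then 0 else l0 + (if a = n + 1 then 0 else int s * int D ^ pos a))"
definition path :: "nat \<Rightarrow> int \<Rightarrow> nat \<Rightarrow> nat \<Rightarrow> int" where
  "path D l0 s a = (if 1 \<le> a \<and> a < N then sp D l0 s (a + 1) - sp D l0 s a else 0)"

lemma idx_sum_path: "1 \<le> a \<Longrightarrow> a \<le> N \<Longrightarrow> idx_sum a (path D l0 s) = sp D l0 s a"
proof (induction a rule: dec_induct)
  case base
  then show ?case by (simp add: idx_sum_def sp_def)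
next
  case (step a)
  then have "path D l0 s a = sp D l0 s (Suc a) - sp D l0 s a" by (simp add: path_def)
  with step show ?case using idx_sum_Suc[of a "path D l0 s"] by simp
qed

text \<open>Consecutive places differ by a factor of at least 2, so each inner coordinate moves away
  from its face at least as fast as \<open>s\<close>.\<close>

lemma path_deep:
  assumes "2 \<le> D" "2 \<le> a" "a < N"
  shows "a \<le> n \<Longrightarrow> path D l0 s a \<le> - int s" "n < a \<Longrightarrow> int s \<le> path D l0 s a"
proof -
  have D1: "1 \<le> int D ^ p" for p using assms(1) by simp
  have D2: "int D ^ Suc p \<ge> int D ^ p + 1" for p
  proof -
    have "int D * int D ^ p \<ge> 2 * int D ^ p" using assms(1) by (intro mult_right_mono) auto
    then show ?thesis using D1[of p] by simp
  qed
  show "path D l0 s a \<le> - int s" if "a \<le> n"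
  proof (cases "a = n")
    case True
    then show ?thesis using assms by (simp add: path_def sp_def pos_def)
  next
    case False
    then have "pos a = Suc (pos (a + 1))" using that by (simp add: pos_def)
    then have "int D ^ pos (a + 1) - int D ^ pos a \<le> - 1" using D2[of "pos (a + 1)"] by simp
    then have "int s * (int D ^ pos (a + 1) - int D ^ pos a) \<le> int s * (- 1)"
      by (intro mult_left_mono) auto
    then show ?thesis using assms that False by (simp add: path_def sp_def right_diff_distrib)
  qed
  show "int s \<le> path D l0 s a" if "n < a"
  proof (cases "a = n + 1")
    case True
    have "int s * 1 \<le> int s * int D ^ pos (a + 1)" by (intro mult_left_mono D1) auto
    then show ?thesis using assms True by (simp add: path_def sp_def)
  next
    case False
    then have "pos (a + 1) = Suc (pos a)" using that n by (simp add: pos_def)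
    then have "int D ^ pos (a + 1) - int D ^ pos a \<ge> 1" using D2[of "pos a"] by simp
    then have "int s * (int D ^ pos (a + 1) - int D ^ pos a) \<ge> int s * 1"
      by (intro mult_left_mono) auto
    then show ?thesis using assms that False by (simp add: path_def sp_def right_diff_distrib)
  qed
qed

definition mon :: "mono \<Rightarrow> (int \<Rightarrow> complex) \<Rightarrow> cgen fa" where
  "mon p g = (case p of (I, J, k) \<Rightarrow> cone_monom n m I J k g)"

text \<open>Besides the condition on I and J, all exponents that the product never reads are
  required to be 0, so that different triples have different monomials.\<close>

definition normal :: "mono \<Rightarrow> bool" where
  "normal p \<longleftrightarrow> (case p of (I, J, k) \<Rightarrow> (\<forall>a. I a * J a = 0) \<and> (\<forall>a. a \<notin> {1..N} \<longrightarrow> I a = 0 \<and> J a = 0)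
     \<and> (\<forall>a. a \<notin> Ks \<longrightarrow> k a = 0))"

lemma mon_linear:
  "mon p (\<lambda>l. g l + h l) - (mon p g + mon p h) \<in> P.I"
  "mon p (\<lambda>l. c * g l) - scal c * mon p g \<in> P.I"
  "mon p (\<lambda>l. 0) \<in> P.I"
proof -
  obtain I J k where p: "p = (I, J, k)" by (cases p)
  have m: "mon p g = ma I k * fn g * mb J k" for g
    by (simp add: p mon_def cone_monom_eq)
  have "ma I k * (fn (\<lambda>l. g l + h l) - (fn g + fn h)) * mb J k \<in> P.I"
    by (intro P.Idl_mult(2)[OF P.Idl_mult(1)] fun_rels_Idl ma_CF mb_CF)
  then show "mon p (\<lambda>l. g l + h l) - (mon p g + mon p h) \<in> P.I"
    unfolding m by (simp add: algebra_simps)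
  have sc: "ma I k * (fn (\<lambda>l. c * g l) - scal c * fn g) * mb J k \<in> P.I" for c g
    by (intro P.Idl_mult(2)[OF P.Idl_mult(1)] fun_rels_Idl ma_CF mb_CF)
  then show "mon p (\<lambda>l. c * g l) - scal c * mon p g \<in> P.I"
    unfolding m by (simp add: right_diff_distrib left_diff_distrib mult.assoc mult_scal_left[of "ma I k"])
  show "mon p (\<lambda>l. 0) \<in> P.I"
    using sc[of 0 "\<lambda>l. 0"] unfolding m by simp
qed

lemma monset_mon:
  assumes "x \<in> monset"
  obtains p \<kappa> where "normal p" "x = mon p (xi_power q \<kappa>)"
proof -
  from assms obtain I J k \<kappa> where x: "x = cone_monom n m I J k (xi_power q \<kappa>)" and ad: "admissible n m I J"
    by (auto simp: monset_def)
  define r where "r A f = (\<lambda>a :: nat. if a \<in> A then f a else (0 :: nat))" for A f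
  have eq: "map (\<lambda>a. tt a ^ I a) [1..<n+1] = map (\<lambda>a. tt a ^ r {1..N} I a) [1..<n+1]"
    "map (\<lambda>a. ts a ^ I a) [n+1..<n+m+1] = map (\<lambda>a. ts a ^ r {1..N} I a) [n+1..<n+m+1]"
    "map (\<lambda>a. tt a ^ J a) (rev [n+1..<n+m+1]) = map (\<lambda>a. tt a ^ r {1..N} J a) (rev [n+1..<n+m+1])"
    "map (\<lambda>a. ts a ^ J a) (rev [1..<n+1]) = map (\<lambda>a. ts a ^ r {1..N} J a) (rev [1..<n+1])"
    "map (\<lambda>a. cone_xi n m a ^ k a) [2..<n+1] = map (\<lambda>a. cone_xi n m a ^ r Ks k a) [2..<n+1]"
    "map (\<lambda>a. cone_xi n m a ^ k a) [n+2..<n+m+1] = map (\<lambda>a. cone_xi n m a ^ r Ks k a) [n+2..<n+m+1]"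
    by (rule map_cong; auto simp: r_def Ks_def)+
  have "x = mon (r {1..N} I, r {1..N} J, r Ks k) (xi_power q \<kappa>)"
    unfolding x mon_def cone_monom_def eq by simp
  moreover have "normal (r {1..N} I, r {1..N} J, r Ks k)"
    using ad by (auto simp: normal_def r_def admissible_def)
  ultimately show thesis using that by blast
qed

text \<open>A spanning combination may contain several powers \<xi>_(n+1)^\<kappa> with the same
  exponents. They are merged into one function per triple, which is all that the representation can
  distinguish.\<close>

lemma normal_form:
  assumes "f \<in> nspan"
  shows "\<exists>S G. finite S \<and> (\<forall>p\<in>S. normal p) \<and> f - (\<Sum>p\<in>S. mon p (G p)) \<in> P.I"
  using assms
proof (induction f rule: nspan_induct)
  case zero
  show ?case by (rule exI[of _ "{}"]) (simp add: P.Idl_0)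
next
  case (step c x y)
  then obtain S G where S: "finite S" "\<forall>p\<in>S. normal p" "y - (\<Sum>p\<in>S. mon p (G p)) \<in> P.I" by blast
  obtain p \<kappa> where p: "normal p" "x = mon p (xi_power q \<kappa>)" using monset_mon[OF step(1)] .
  let ?g = "\<lambda>l. c * xi_power q \<kappa> l"
  define H where "H = (if p \<in> S then G p else (\<lambda>l. 0))"
  define G' where "G' = G(p := (\<lambda>l. ?g l + H l))"
  let ?R = "\<Sum>r\<in>S - {p}. mon r (G r)"
  have 1: "(\<Sum>r\<in>insert p S. mon r (G' r)) = mon p (\<lambda>l. ?g l + H l) + ?R"
  proof -
    have "(\<Sum>r\<in>insert p S. mon r (G' r)) = mon p (G' p) + (\<Sum>r\<in>S - {p}. mon r (G' r))"
      using S(1) by (rule sum.insert_remove)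
    also have "(\<Sum>r\<in>S - {p}. mon r (G' r)) = ?R"
      by (rule sum.cong) (auto simp: G'_def)
    finally show ?thesis by (simp add: G'_def)
  qed
  have 2: "(\<Sum>r\<in>S. mon r (G r)) - (mon p H + ?R) \<in> P.I"
  proof (cases "p \<in> S")
    case True
    then show ?thesis using S(1) by (simp add: H_def sum.remove P.Idl_0)
  next
    case False
    then show ?thesis using P.Idl_uminus[OF mon_linear(3)[of p]] by (simp add: H_def)
  qed
  have "(scal c * x + y) - (\<Sum>r\<in>insert p S. mon r (G' r)) =
    (y - (\<Sum>r\<in>S. mon r (G r))) + ((\<Sum>r\<in>S. mon r (G r)) - (mon p H + ?R))
      - (mon p (\<lambda>l. ?g l + H l) - (mon p ?g + mon p H)) - (mon p ?g - scal c * mon p (xi_power q \<kappa>))"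
    unfolding 1 p(2) by simp
  also have "\<dots> \<in> P.I"
    by (intro P.Idl_diff P.Idl_add S(3) 2 mon_linear)
  finally have "(scal c * x + y) - (\<Sum>r\<in>insert p S. mon r (G' r)) \<in> P.I" .
  then show ?case using S(1,2) p(1) by blast
qed

text \<open>The shift records the difference J - I, and since one of the two exponents is 0 at each
  place, the difference determines both.\<close>

lemma normal_shift_inj:
  assumes "normal (I, J, k)" "normal (I', J', k')"
    and "shf (\<lambda>b. int (J b) - int (I b)) i = shf (\<lambda>b. int (J' b) - int (I' b)) i"
  shows "I = I' \<and> J = J'"
proof -
  have "I a = I' a \<and> J a = J' a" for a
  proof (cases "a \<in> {1..N}")
    case True
    then have "int (J a) - int (I a) = int (J' a) - int (I' a)"
      using fun_cong[OF assms(3), of a] by (auto simp: shf_def split: if_splits)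
    moreover have "I a = 0 \<or> J a = 0" "I' a = 0 \<or> J' a = 0"
      using assms(1,2) by (auto simp: normal_def)
    ultimately show ?thesis by linarith
  next
    case False
    then show ?thesis using assms(1,2) by (auto simp: normal_def)
  qed
  then show ?thesis by auto
qed

text \<open>At a fixed level l0, and up to a nonzero factor, the relevant matrix entry along the
  path is a polynomial in q^(2s) whose coefficients are multiples of the values of the functions at
  l0. It vanishes for all large \<open>s\<close>, hence identically.\<close>

lemma mon_independent:
  assumes S: "finite S" "\<forall>p\<in>S. normal p" and z: "(\<Sum>p\<in>S. mon p (G p)) \<in> ker" and p0: "p0 \<in> S"
  shows "G p0 = (\<lambda>l. 0)"
proof
  fix l0
  obtain I J k0 where p0': "p0 = (I, J, k0)" by (cases p0)
  define S' where "S' = {k. (I, J, k) \<in> S}"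
  have S': "finite S'"
    using S(1) finite_vimageI[of S "\<lambda>k. (I, J, k)"] by (simp add: S'_def vimage_def inj_on_def)
  \<comment> \<open>Larger than every exponent in question, so that the exponents are base D digits;
    the summand 2 is for \<open>path_deep\<close>.\<close>
  define D where "D = 2 + (\<Sum>k\<in>S'. \<Sum>a\<in>Ks. k a)"
  have fK: "finite Ks" by (simp add: Ks_def)
  have kD: "k a < D" if "k \<in> S'" "a \<in> Ks" for k a
  proof -
    have "k a \<le> (\<Sum>a\<in>Ks. k a)" using that fK by (intro member_le_sum) auto
    also have "\<dots> \<le> (\<Sum>k\<in>S'. \<Sum>a\<in>Ks. k a)" using that S' by (intro member_le_sum[of k S' "\<lambda>k. \<Sum>a\<in>Ks. k a"]) auto
    finally show ?thesis by (simp add: D_def)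
  qed
  \<comment> \<open>The power of q^(2s) that the monomial with exponents \<open>k\<close> acquires
    along the path.\<close>
  define e where "e k = (\<Sum>a\<in>Ks. k a * D ^ pos a)" for k
  have e_inj: "k = k'" if "k \<in> S'" "k' \<in> S'" "e k = e k'" for k k'
  proof -
    have "\<forall>a\<in>Ks. k a = k' a"
      using that kD by (intro base_expansion_inj[OF fK inj_pos, of k D k']) (auto simp: e_def D_def)
    moreover have "normal (I, J, k)" "normal (I, J, k')"
      using that(1,2) S(2) unfolding S'_def by blast+
    then have "k a = k' a" if "a \<notin> Ks" for a
      using that by (simp add: normal_def)
    ultimately show ?thesis by (intro ext) blast
  qed
  define L where "L = length (wA I) + length (wB J) + (\<Sum>a\<in>{1..N}. J a) + 2"
  define E where "E k = G (I, J, k) l0 * (\<Prod>a\<in>Ks. of_real (q powi (2 * l0)) ^ k a)" for k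
  define p where "p = (\<Sum>k\<in>S'. monom (E k) (e k))"
  have root: "poly p (of_real (q ^ (2 * s))) = 0" if s: "s > L" for s
  proof -
    define h where "h = path D l0 s"
    \<comment> \<open>The \<xi>_a are evaluated after the right word has acted. So the path is
      prescribed for \<open>h\<close>, and \<open>i\<close> is found by undoing that word.\<close>
    define i where "i = shf (\<lambda>b. - int (J b)) h"
    have hi: "shf (\<lambda>b. int (J b)) i = h" by (auto simp: i_def shf_shf shf_def)
    have J: "int (J a) \<le> int L - int (length (wA I)) - int (length (wB J)) - 2" for a
    proof (cases "a \<in> {1..N}")
      case True
      then have "J a \<le> (\<Sum>a\<in>{1..N}. J a)" by (intro member_le_sum) auto
      then show ?thesis by (simp add: L_def del: of_nat_sum)
    next
      case False
      moreover have "normal (I, J, k0)" using p0 S(2) unfolding p0' by blast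
      ultimately have "J a = 0" unfolding normal_def by simp
      then show ?thesis by (simp add: L_def del: of_nat_sum)
    qed
    have D: "2 \<le> D" by (simp add: D_def)
    have deep: "a \<le> n \<Longrightarrow> h a \<le> - int s" "n < a \<Longrightarrow> int s \<le> h a" if "2 \<le> a" "a < N" for a
      using path_deep(1)[OF D that, of l0 s] path_deep(2)[OF D that, of s l0] by (simp_all add: h_def)
    have deepi: "a \<le> n \<Longrightarrow> i a < - int (length (wB J)) - 1" "n < a \<Longrightarrow> int (length (wB J)) + 1 < i a"
      if "2 \<le> a" "a < N" for a
      using deep[OF that] J[of a] s that by (auto simp: i_def shf_def)
    have iB: "i \<in> Bh"
    proof -
      have "i a = 0" if "a \<notin> {1..N}" for a
        using that by (auto simp: i_def shf_def h_def path_def)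
      moreover have "i a \<le> 0" if "a \<in> {2..n}" for a
        using deepi(1)[of a] that m by auto
      moreover have "1 \<le> i a" if "a \<in> {n+1..N-1}" for a
      proof -
        have "2 \<le> a" "a < N" "n < a" using that n m by auto
        then show ?thesis using deepi(2)[of a] by linarith
      qed
      ultimately show ?thesis by (simp add: Bh_def)
    qed
    have cB: "cfw (wB J) i \<noteq> 0"
    proof (rule cfw_ne_0[OF wAB_no_Fn(2)])
      fix a assume "2 \<le> a" "a < N"
      then show "int (length (wB J)) + 1 < \<bar>i a\<bar>" using deepi[of a] by (cases "a \<le> n") auto
    qed
    have cA: "cfw (wA I) h \<noteq> 0"
    proof (rule cfw_ne_0[OF wAB_no_Fn(1)])
      fix a assume a: "2 \<le> a" "a < N"
      have "int (length (wA I)) + 1 < int s" using s by (simp add: L_def)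
      then show "int (length (wA I)) + 1 < \<bar>h a\<bar>" using deep[OF a] by (cases "a \<le> n") auto
    qed
    have lev: "lev h = l0"
      using idx_sum_path[of "n + 1" D l0 s] m n by (simp add: h_def sp_def)
    \<comment> \<open>Testing at this target isolates the monomials with the same I and J as
      \<open>p0\<close>.\<close>
    let ?t = "shf (\<lambda>b. int (J b) - int (I b)) i"
    let ?c = "cfw (wB J) i * cfw (wA I) h"
    have "0 = Rop (\<Sum>p\<in>S. mon p (G p)) (dl ?t) i"
      using z iB by (simp add: ker_def)
    also have "\<dots> = (\<Sum>p\<in>S. Rop (mon p (G p)) (dl ?t) i)"
      by (rule Rop_sum)
    also have "\<dots> = (\<Sum>p\<in>(\<lambda>k. (I, J, k)) ` S'. Rop (mon p (G p)) (dl ?t) i)"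
    proof (rule sum.mono_neutral_right[OF S(1)])
      show "\<forall>p\<in>S - (\<lambda>k. (I, J, k)) ` S'. Rop (mon p (G p)) (dl ?t) i = 0"
      proof
        fix p assume p: "p \<in> S - (\<lambda>k. (I, J, k)) ` S'"
        obtain I' J' k' where p': "p = (I', J', k')" by (cases p)
        have "\<not> (I' = I \<and> J' = J)" using p by (auto simp: p' S'_def)
        then have "shf (\<lambda>b. int (J' b) - int (I' b)) i \<noteq> ?t"
          using normal_shift_inj[of I' J' k' I J k0 i] p p0 S(2) p' p0' by blast
        then show "Rop (mon p (G p)) (dl ?t) i = 0"
          by (simp add: p' mon_def Rop_monom[OF iB])
      qed
    qed (auto simp: S'_def)
    also have "\<dots> = (\<Sum>k\<in>S'. Rop (mon (I, J, k) (G (I, J, k))) (dl ?t) i)"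
      by (subst sum.reindex) (auto simp: inj_on_def)
    also have "\<dots> = (\<Sum>k\<in>S'. ?c * (E k * of_real (q ^ (2 * s)) ^ e k))"
    proof (rule sum.cong[OF refl])
      fix k assume "k \<in> S'"
      have "(\<Prod>a\<in>Ks. complex_of_real (xx a h) ^ k a) =
          (\<Prod>a\<in>Ks. of_real (q powi (2 * l0)) ^ k a * of_real (q ^ (2 * s)) ^ (k a * D ^ pos a))"
      proof (rule prod.cong[OF refl])
        fix a assume a: "a \<in> Ks"
        then have "xx a h = q powi (2 * (l0 + int s * int D ^ pos a))"
          using idx_sum_path[of a D l0 s] n by (auto simp: xx_def h_def sp_def Ks_def)
        also have "\<dots> = q powi (2 * l0) * q powi (int (2 * s * D ^ pos a))"
          by (simp add: distrib_left powi_add mult.assoc)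
        also have "q powi (int (2 * s * D ^ pos a)) = (q ^ (2 * s)) ^ (D ^ pos a)"
          by (simp only: power_int_of_nat power_mult)
        finally have "xx a h = q powi (2 * l0) * (q ^ (2 * s)) ^ (D ^ pos a)" .
        then show "complex_of_real (xx a h) ^ k a =
            of_real (q powi (2 * l0)) ^ k a * of_real (q ^ (2 * s)) ^ (k a * D ^ pos a)"
          by (simp only: of_real_mult of_real_power power_mult_distrib) (simp add: mult.commute mult.left_commute flip: power_mult)
      qed
      also have "\<dots> = (\<Prod>a\<in>Ks. of_real (q powi (2 * l0)) ^ k a) * of_real (q ^ (2 * s)) ^ e k"
        by (simp only: prod.distrib e_def power_sum)
      finally have P: "(\<Prod>a\<in>Ks. complex_of_real (xx a h) ^ k a) = \<dots>" .
      show "Rop (mon (I, J, k) (G (I, J, k))) (dl ?t) i = ?c * (E k * of_real (q ^ (2 * s)) ^ e k)"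
        unfolding mon_def prod.case Rop_monom[OF iB] hi P lev E_def by simp
    qed
    also have "\<dots> = ?c * (\<Sum>k\<in>S'. E k * of_real (q ^ (2 * s)) ^ e k)"
      by (rule sum_distrib_left[symmetric])
    finally have "(\<Sum>k\<in>S'. E k * of_real (q ^ (2 * s)) ^ e k) = 0"
      using cA cB by simp
    then show ?thesis by (simp add: p_def poly_sum poly_monom)
  qed
  \<comment> \<open>The numbers q^(2s) with s > L are infinitely many distinct roots.\<close>
  have "p = 0"
  proof (rule ccontr)
    assume "p \<noteq> 0"
    then have "finite {z. poly p z = 0}" by (rule poly_roots_finite)
    moreover have "(\<lambda>s. of_real (q ^ (2 * s))) ` {s. s > L} \<subseteq> {z. poly p z = 0}"
      using root by auto
    ultimately have "finite ((\<lambda>s. of_real (q ^ (2 * s)) :: complex) ` {s. s > L})"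
      by (rule finite_subset[rotated])
    moreover have "inj_on (\<lambda>s. of_real (q ^ (2 * s)) :: complex) {s. s > L}"
    proof (rule inj_onI)
      fix s t assume "(of_real (q ^ (2 * s)) :: complex) = of_real (q ^ (2 * t))"
      then have "q ^ (2 * s) = q ^ (2 * t)" using of_real_eq_iff by blast
      then show "s = t"
        using power_strict_decreasing[of "2 * s" "2 * t" q] power_strict_decreasing[of "2 * t" "2 * s" q] q
        by (cases s t rule: linorder_cases) simp_all
    qed
    ultimately have "finite {s. s > L}" by (rule finite_imageD)
    moreover have "infinite {s. s > L}"
      unfolding infinite_nat_iff_unbounded
    proof
      fix k show "\<exists>s>k. s \<in> {s. s > L}" by (rule exI[of _ "Suc (L + k)"]) simp
    qed
    ultimately show False by blast
  qed
  have k0: "k0 \<in> S'" using p0 by (simp add: S'_def p0')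
  have "coeff p (e k0) = (\<Sum>k\<in>S'. if e k = e k0 then E k else 0)"
    by (simp add: p_def coeff_sum coeff_monom if_distrib cong: if_cong)
  also have "\<dots> = (\<Sum>k\<in>S'. if k = k0 then E k else 0)"
    using e_inj k0 by (intro sum.cong) auto
  also have "\<dots> = E k0"
    using k0 S' by simp
  finally have "E k0 = 0" using \<open>p = 0\<close> by simp
  then show "G p0 l0 = 0" by (simp add: E_def p0' fK)
qed

lemma faithful:
  assumes "f \<in> nspan" "f \<in> ker"
  shows "f \<in> P.I"
proof -
  obtain S G where S: "finite S" "\<forall>p\<in>S. normal p" "f - (\<Sum>p\<in>S. mon p (G p)) \<in> P.I"
    using normal_form[OF assms(1)] by blast
  let ?h = "\<Sum>p\<in>S. mon p (G p)"
  have "?h = f - (f - ?h)" by simp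
  moreover have "f - (f - ?h) \<in> ker"
    using assms(2) Idl_ker[OF S(3)] by (simp add: ker_def Rop_diff)
  ultimately have "?h \<in> ker" by simp
  then have "G p = (\<lambda>l. 0)" if "p \<in> S" for p
    using mon_independent[OF S(1,2) _ that] by blast
  then have mI: "mon p (G p) \<in> P.I" if "p \<in> S" for p
    using mon_linear(3) that by simp
  have "(\<Sum>p\<in>T. mon p (G p)) \<in> P.I" if "T \<subseteq> S" for T
    using finite_subset[OF that S(1)] that by (induction T rule: finite_induct) (auto simp: P.Idl_0 intro!: P.Idl_add mI)
  then have "?h \<in> P.I" by simp
  from P.Idl_add[OF S(3) this] show ?thesis by simp
qed

text \<open>The balance condition in \<open>admissible\<close> says that the shift of a monomial
  leaves the total unchanged.\<close>

lemma Rop_tot: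
  assumes "f \<in> nspan" "i \<in> Bh"
  shows "Rop f (\<lambda>k. \<tau> (idx_sum (N + 1) k) * v k) i = \<tau> (idx_sum (N + 1) i) * Rop f v i"
  using assms(1)
proof (induction f rule: nspan_induct)
  case (step c x y)
  then obtain I J k \<kappa> where x: "x = cone_monom n m I J k (xi_power q \<kappa>)" and ad: "admissible n m I J"
    by (auto simp: monset_def)
  have "idx_sum (N + 1) (shf (\<lambda>b. int (J b) - int (I b)) i) = idx_sum (N + 1) i
      + (\<Sum>a\<in>{1..n}. int (J a) - int (I a)) - (\<Sum>a\<in>{n+1..N}. int (J a) - int (I a))"
    by (rule idx_sum_shf[OF refl])
  moreover have "(\<Sum>a\<in>{1..n}. int (J a) - int (I a)) = (\<Sum>a\<in>{n+1..N}. int (J a) - int (I a))"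
  proof -
    have "int ((\<Sum>a\<in>{1..n}. I a) + (\<Sum>a\<in>{n+1..N}. J a)) = int ((\<Sum>a\<in>{1..n}. J a) + (\<Sum>a\<in>{n+1..N}. I a))"
      using ad unfolding admissible_def by simp
    then show ?thesis by (simp add: sum_subtractf)
  qed
  ultimately have t: "idx_sum (N + 1) (shf (\<lambda>b. int (J b) - int (I b)) i) = idx_sum (N + 1) i" by simp
  have "Rop x (\<lambda>k. \<tau> (idx_sum (N + 1) k) * v k) i = \<tau> (idx_sum (N + 1) i) * Rop x v i"
    unfolding x Rop_monom[OF assms(2)] t by (simp only: mult_ac)
  then show ?case
    using step(2) by (simp only: Rop_add Rop_scal_mult distrib_left mult_ac)
qed simp

lemma cone_E_eq: "cone_E q n m = cc ` nspan"
  by (simp add: cone_E_def nspan_def monset_def)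

end

section \<open>The form on the eigenspaces \<open>cone_Es\<close>\<close>

context cone_action
begin

lemma inV_cone_Es:
  assumes "A \<in> cone_Es q n m s"
  shows "inV (of_real q powr (s - of_nat N + 1)) A"
proof -
  let ?c = "of_real q powr (s - of_nat N + 1)"
  obtain f where f: "f \<in> nspan" "A = cc f"
    using assms by (auto simp: cone_Es_def cone_E_eq)
  note fF = nspan_CF[OF f(1)]
  have cA: "A \<in> carrier CA" using fF by (simp add: f)
  have "cc (gam f) = cc (scal ?c * f)"
    using assms fF by (simp add: cone_Es_def f(2) cone_gamma_cls cone_scale_cls)
  then have e: "RC (cc (gam f)) v i = RC (cc (scal ?c * f)) v i" for v i by simp
  then have g: "Rop (gam f) v i = ?c * Rop f v i" if "i \<in> Bh" for v i
    using that fF e[of v i] RC_cls[OF gam_CF[OF fF], of v i]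
      RC_cls[OF free_alg_mult[OF free_alg_scal fF], of ?c v i] by (simp only: if_True Rop_scal_mult)
  have "GU ?c A"
    unfolding GU_def
  proof (intro allI ballI)
    fix v i assume i: "i \<in> Bh"
    have "RC A v (U i) = Rop f v (U i)" using i fF by (simp add: f RC_cls)
    also have "\<dots> = Rop (gam f) (\<lambda>k. v (U k)) i"
      using Rop_gam[OF fF, of "\<lambda>k. v (U k)" i] by simp
    also have "\<dots> = ?c * RC A (\<lambda>k. v (U k)) i"
      using i fF by (simp add: g f RC_cls)
    finally show "RC A v (U i) = ?c * RC A (\<lambda>k. v (U k)) i" .
  qed
  moreover have "D0 A"
    unfolding D0_def using Rop_tot[OF f(1)] fF by (auto simp: f tot_def RC_cls)
  ultimately show ?thesis using cA by (simp add: inV_def)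
qed

text \<open>For real \<open>lam\<close> the power of q with exponent i times \<open>lam\<close> has
  absolute value 1, so only 1 - N contributes to the modulus of \<open>c\<close>.\<close>

lemma norm_weight:
  fixes lam :: real
  defines "c \<equiv> of_real q powr (\<i> * of_real lam - of_nat N + 1)"
  shows "c * cnj c * of_real (q ^ (2 * (N - 1))) = 1" "c \<noteq> 0"
proof -
  have "norm c = q powr (1 - real N)"
    using q unfolding c_def by (subst norm_powr_real_powr) (auto simp: algebra_simps)
  also have "\<dots> = inverse (q ^ (N - 1))"
  proof -
    have "1 - real N = - real (N - 1)" using n by (simp add: of_nat_diff)
    then show ?thesis using q by (simp only: powr_minus powr_realpow)
  qed
  finally have nc: "norm c = inverse (q ^ (N - 1))" .
  have cc: "c * cnj c = of_real ((norm c)\<^sup>2)" by (rule complex_norm_square[symmetric])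
  have "(norm c)\<^sup>2 * q ^ (2 * (N - 1)) = (inverse (q ^ (N - 1)) * q ^ (N - 1))\<^sup>2"
    unfolding nc power_mult_distrib by (simp only: power_mult[symmetric] mult.commute)
  also have "\<dots> = 1" using q by simp
  finally have "(norm c)\<^sup>2 * q ^ (2 * (N - 1)) = 1" .
  then show "c * cnj c * of_real (q ^ (2 * (N - 1))) = 1"
    unfolding cc of_real_mult[symmetric] by (simp only: of_real_1)
  show "c \<noteq> 0" using q by (simp add: c_def)
qed

lemma b_form_inV: "inV c A \<Longrightarrow> inV c B \<Longrightarrow> b_form q n m const l A B = Phi A B"
  by (rule b_form_Phi) (auto dest: inV_D)

lemma sesquilinear_b_form: "sesquilinear_on q n m (cone_Es q n m s) (b_form q n m const l)"
  unfolding sesquilinear_on_def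
proof (intro ballI allI)
  fix f g h d
  assume "f \<in> cone_Es q n m s" "g \<in> cone_Es q n m s" "h \<in> cone_Es q n m s"
  note V = this[THEN inV_cone_Es]
  note cl = V[THEN inV_D(1)]
  show "b_form q n m const l (f \<oplus>\<^bsub>CA\<^esub> g) h = b_form q n m const l f h + b_form q n m const l g h \<and>
    b_form q n m const l h (f \<oplus>\<^bsub>CA\<^esub> g) = b_form q n m const l h f + b_form q n m const l h g \<and>
    b_form q n m const l (cone_scale q n m d f) h = d * b_form q n m const l f h \<and>
    b_form q n m const l h (cone_scale q n m d f) = cnj d * b_form q n m const l h f"
    using b_form_inV[OF inV_add[OF V(1,2)] V(3)] b_form_inV[OF V(3) inV_add[OF V(1,2)]]
      b_form_inV[OF inV_scale[OF V(1)] V(3)] b_form_inV[OF V(3) inV_scale[OF V(1)]]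
      b_form_inV[OF V(1,3)] b_form_inV[OF V(2,3)] b_form_inV[OF V(3,1)] b_form_inV[OF V(3,2)] cl
    by (simp add: Phi_add_left Phi_add_right Phi_scale_left Phi_scale_right)
qed

text \<open>Since \<open>c\<close> is nonzero, \<open>U\<close> carries the vanishing up and down by
  one level each; this covers total 0.\<close>

lemma RC_eq_0:
  assumes A: "inV c A" and c: "c \<noteq> 0" and z: "\<And>v i. i \<in> X \<Longrightarrow> RC A v i = 0" and i: "i \<in> Bh"
  shows "RC A v i = 0"
proof -
  have U: "(\<forall>v. RC A v (U i) = 0) \<longleftrightarrow> (\<forall>v. RC A v i = 0)" if "i \<in> Bh" for i
  proof
    assume h: "\<forall>v. RC A v (U i) = 0"
    show "\<forall>v. RC A v i = 0"
    proof
      fix v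
      have "RC A (\<lambda>k. v (V k)) (U i) = c * RC A v i"
        using GU_D[OF inV_D(3)[OF A] that, of "\<lambda>k. v (V k)"] by simp
      then show "RC A v i = 0" using h c by simp
    qed
  next
    assume "\<forall>v. RC A v i = 0"
    then show "\<forall>v. RC A v (U i) = 0"
      using GU_D[OF inV_D(3)[OF A] that] by simp
  qed
  have lU: "lev (U i) = lev i + 1" for i using idx_sum_U[of "n + 1" i] n m by simp
  have tU: "tot (U i) = tot i" for i
    using N_ne idx_sum_U[of N i] idx_sum_Suc[of N "U i"] idx_sum_Suc[of N i] by (simp add: tot_def U_def)
  have X0: "\<forall>v. RC A v i = 0" if "i \<in> Bh" "tot i = 0" for i
  proof -
    have "\<forall>i. i \<in> Bh \<longrightarrow> tot i = 0 \<longrightarrow> lev i = d \<longrightarrow> (\<forall>v. RC A v i = 0)" for d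
    proof (induction d rule: int_induct[where k = l])
      case base
      then show ?case using z by (auto simp: X_def)
    next
      case (step1 d)
      show ?case
      proof (intro allI impI)
        fix i v assume h: "i \<in> Bh" "tot i = 0" "lev i = d + 1"
        have "lev (V i) = d" "tot (V i) = 0" using lU[of "V i"] tU[of "V i"] h by simp_all
        then have "\<forall>v. RC A v (V i) = 0" using step1(2) h(1) by simp
        then show "RC A v i = 0" using U[of "V i"] h(1) by simp
      qed
    next
      case (step2 d)
      show ?case
      proof (intro allI impI)
        fix i v assume h: "i \<in> Bh" "tot i = 0" "lev i = d - 1"
        have "lev (U i) = d" "tot (U i) = 0" using lU[of i] tU[of i] h by simp_all
        then have "\<forall>v. RC A v (U i) = 0" using step2(2) h(1) by simp
        then show "RC A v i = 0" using U[of i] h(1) by simp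
      qed
    qed
    then show ?thesis using that by blast
  qed
  \<comment> \<open>The remaining totals are reached by translating the additional
    coordinate.\<close>
  let ?h = "tr (- tot i) i"
  have "tr (tot i) ?h = i" by (simp add: tr_def)
  then have "RC A v i = RC A (\<lambda>k. v (tr (tot i) k)) ?h"
    using RC_tr[OF inV_D(1)[OF A], of v "tot i" ?h] by simp
  also have "\<dots> = 0"
    using X0[of ?h] i by (simp add: tot_tr)
  finally show ?thesis .
qed

lemma pos_def_b_form: "pos_def_on q n m (cone_Es q n m s) (b_form q n m const l)"
  unfolding pos_def_on_def
proof (intro ballI impI)
  fix A assume A: "A \<in> cone_Es q n m s" and ne: "A \<noteq> \<zero>\<^bsub>CA\<^esub>"
  note V = inV_cone_Es[OF A]
  note cA = inV_D(1)[OF V]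
  have c0: "(of_real q :: complex) powr (s - of_nat N + 1) \<noteq> 0" using q by simp
  have "Re (Phi A A) \<noteq> 0"
  proof
    assume r: "Re (Phi A A) = 0"
    obtain f where f: "f \<in> nspan" "A = cc f"
      using A by (auto simp: cone_Es_def cone_E_eq)
    note fF = nspan_CF[OF f(1)]
    have "RC A v i = 0" if "i \<in> Bh" for v i
      by (rule RC_eq_0[OF V c0 _ that]) (rule Phi_pos(3)[OF cA r])
    then have "f \<in> ker" using fF by (simp add: ker_def f(2) RC_cls)
    then have "f - 0 \<in> P.I" using faithful[OF f(1)] by simp
    then have "cc f = cc 0" using P.cls_eq_iff[OF fF, of 0] by (simp add: cone_cls_eq)
    then have "A = \<zero>\<^bsub>CA\<^esub>" using P.cls_zero by (simp add: f(2) cone_alg_eq cone_cls_eq)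
    then show False using ne by simp
  qed
  then show "b_form q n m const l A A \<in> \<real> \<and> 0 < Re (b_form q n m const l A A)"
    unfolding b_form_inV[OF V V] using Phi_pos(1,2)[OF cA] by linarith
qed

lemma invariant_b_form: "invariant_on q n m act (cone_Es q n m (\<i> * of_real lam)) (b_form q n m const l)"
  unfolding invariant_on_def
proof (intro ballI)
  fix a A B
  assume "a \<in> carrier UA" "A \<in> cone_Es q n m (\<i> * of_real lam)" "B \<in> cone_Es q n m (\<i> * of_real lam)"
  note V = this(2,3)[THEN inV_cone_Es]
  obtain x where x: "x \<in> UF" "a = uc x"
    using \<open>a \<in> carrier UA\<close> u.carrier_presented by (auto simp: uq_alg_eq uq_cls_eq)
  note W = inV_act[OF x(1) V(1)] inV_act[OF ustar_UF[OF x(1)] V(2)]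
  show "b_form q n m const l (act a A) B = b_form q n m const l A (act (uq_star q n m a) B)"
    unfolding x(2) uq_star_cls[OF x(1)] b_form_inV[OF W(1) V(2)] b_form_inV[OF V(1) W(2)]
    by (rule Phi_invariant[OF x(1) V norm_weight(1)])
qed

end

theorem proposition7p4:
  fixes q const lam :: real and n m :: nat and l :: int
    and act :: "ugen fa set \<Rightarrow> cgen fa set \<Rightarrow> cgen fa set"
  assumes "0 < q" and "q < 1" and "n \<ge> 1" and "m \<ge> 2" and "const > 0"
    and "uq_action q n m act"
  shows "sesquilinear_on q n m (cone_Es q n m (\<i> * of_real lam)) (b_form q n m const l)
    \<and> invariant_on q n m act (cone_Es q n m (\<i> * of_real lam)) (b_form q n m const l)
    \<and> pos_def_on q n m (cone_Es q n m (\<i> * of_real lam)) (b_form q n m const l)"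
proof -
  interpret cone_action q n m const l act
    using assms by unfold_locales auto
  show ?thesis
    by (intro conjI sesquilinear_b_form invariant_b_form pos_def_b_form)
qed

end
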